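(* (i) Let $(\alpha,\nabla,\omega)$ be an action up to homotopy of a Lie algebra $\mathfrak h$ (bracket $[\cdot,\cdot]^0$) on a Lie algebroid $\pi:E\to M$ with anchor $\rho:E\to TM$. Then there is a Lie algebroid $\mathcal A:=E\times\mathfrak h$ over $M$ whose anchor is $\rho_{\mathcal A}(e,y):=\rho(e)+\alpha_{\pi(e)}(y)$ and whose bracket is obtained by extending, using the Leibniz identity, the bracket of $\mathfrak h$-constant sections $(\epsilon_0,y_0),(\epsilon_1,y_1)\in\Gamma(E)\times\mathfrak h$, $$[(\epsilon_0,y_0),(\epsilon_1,y_1)]_{\mathcal A}=\big([\epsilon_0,\epsilon_1]_E+\nabla_{y_0}(\epsilon_1)-\nabla_{y_1}(\epsilon_0)+\omega(y_0,y_1),[y_0,y_1]^0\big).$$ Moreover, there is a short exact sequence in the category of Lie algebroids $$0\to E\hookrightarrow\mathcal A\xrightarrow{\mathrm{pr}_{\mathfrak h}}\mathfrak h\to0.$$ (ii) Conversely, let $F:\mathcal A\to\mathfrak h$ be a surjective Lie algebroid morphism from a Lie algebroid $\mathcal A\to M$ (anchor $\rho_{\mathcal A}$, bracket $[\cdot,\cdot]_{\mathcal A}$) to a Lie algebra $\mathfrak h$, and let $E=\ker(F)$. Then there is a short exact sequence of vector bundles $$0\to E\hookrightarrow\mathcal A\xrightarrow{F_*}M\times\mathfrak h\to0,$$ and any splitting $\sigma:M\times\mathfrak h\to\mathcal A$ of it yields an action up to homotopy $(\alpha,\nabla,\omega)$ of $\mathfrak h$ on $E$ given by $\alpha(y):=\rho_{\mathcal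 A}(y^\sigma)$, $\nabla_y(\epsilon):=[y^\sigma,\epsilon]_{\mathcal A}$ and $\omega(y_0,y_1):=[y_0^\sigma,y_1^\sigma]_{\mathcal A}-([y_0,y_1]^0)^\sigma$ for $y,y_0,y_1\in\mathfrak h$, $\epsilon\in\Gamma(E)$, where $y^\sigma\in\Gamma(\mathcal A)$ is the section $p\mapsto\sigma_p(y)$.
   Context: An action up to homotopy (AUTH) of a Lie algebra $\mathfrak h$ on a Lie algebroid $E\to M$ with anchor $\rho$ and bracket $[\cdot,\cdot]_E$ is a triple $(\alpha,\nabla,\omega)$ of linear maps $\alpha:\mathfrak h\to\mathfrak X(M)$, $\nabla:\mathfrak h\otimes_{\mathbb R}\Gamma(E)\to\Gamma(E)$ and an element $\omega\in\wedge^2\mathfrak h^*\otimes\Gamma(E)$ such that for all $y,y_0,y_1\in\mathfrak h$, $\phi\in C^\infty(M)$, $\epsilon,\epsilon_0,\epsilon_1\in\Gamma(E)$: (i) $\nabla_y(\phi\epsilon)=\phi\nabla_y(\epsilon)+(\mathcal L_{\alpha(y)}\phi)\epsilon$ and $\nabla_y([\epsilon_0,\epsilon_1]_E)=[\nabla_y\epsilon_0,\epsilon_1]_E+[\epsilon_0,\nabla_y\epsilon_1]_E$; (ii) $\rho(\nabla_y\epsilon)=[\alpha(y),\rho(\epsilon)]_{\mathfrak X(M)}$; (iii) $R^\nabla_{(y_0,y_1)}(\epsilon):=\nabla_{y_0}\nabla_{y_1}\epsilon-\nabla_{y_1}\nabla_{y_0}\epsilon-\nabla_{[y_0,y_1]^0}\epsilon=[\omega(y_0,y_1),\epsilon]_E$,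 together with the resulting relation $[\alpha(y_0),\alpha(y_1)]_{\mathfrak X(M)}-\alpha([y_0,y_1]^0)=\rho(\omega(y_0,y_1))$; (iv) $d_\nabla\omega=0\in\wedge^3\mathfrak h^*\otimes\Gamma(E)$, where $d_\nabla$ is defined by the Chevalley–Eilenberg formula with $\nabla$ in place of a representation. $\mathcal A=E\times\mathfrak h$ is regarded as the vector bundle $E\oplus(M\times\mathfrak h)$ over $M$, and $\mathfrak h$ as a Lie algebroid over a point. $F_*$ sends $a\in\mathcal A_p$ to $(p,F(a))$; surjective means fibrewise surjective. *)

theory Defs
  imports "HOL-Analysis.Analysis"
begin

section \<open>Smooth manifolds\<close>

text \<open>
  Coordinates live in \<^const>\<open>Euclidean_space\<close> \<open>n\<close>, whose dimension is a number (and not a type),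
  so that \<open>n = 0\<close>, hence the one-point manifold, is included.  The set \<open>S\<close> below is meant to be
  open in \<^term>\<open>Euclidean_space n\<close>; a function is of class \<open>C\<^sup>k\<close> if all its iterated partial
  derivatives of order at most \<open>k\<close> exist and are continuous on \<open>S\<close>.
\<close>

fun Ck_on :: "nat \<Rightarrow> nat \<Rightarrow> (nat \<Rightarrow> real) set \<Rightarrow> ((nat \<Rightarrow> real) \<Rightarrow> real) \<Rightarrow> bool" where
  "Ck_on n 0 S f \<longleftrightarrow> continuous_map (subtopology (Euclidean_space n) S) euclideanreal f"
| "Ck_on n (Suc k) S f \<longleftrightarrow>
     continuous_map (subtopology (Euclidean_space n) S) euclideanreal f \<and>
     (\<forall>i<n. \<exists>g. (\<forall>x\<in>S. ((\<lambda>t. f (x(i := t))) has_real_derivative g x) (at (x i))) \<and>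
                Ck_on n k S g)"

definition Cinf_on :: "nat \<Rightarrow> (nat \<Rightarrow> real) set \<Rightarrow> ((nat \<Rightarrow> real) \<Rightarrow> real) \<Rightarrow> bool" where
  "Cinf_on n S f \<longleftrightarrow> (\<forall>k. Ck_on n k S f)"

text \<open>The underlying set of a manifold is the whole type \<open>'m\<close>.\<close>

record 'm manifold =
  mtop :: "'m topology"
  mdim :: nat
  charts :: "('m set \<times> ('m \<Rightarrow> nat \<Rightarrow> real)) set"

definition smooth_manifold :: "'m manifold \<Rightarrow> bool" where
  "smooth_manifold M \<longleftrightarrow>
     topspace (mtop M) = UNIV \<and> Hausdorff_space (mtop M) \<and> second_countable (mtop M) \<and>
     \<Union>(fst ` charts M) = UNIV \<and>
     (\<forall>(V, x) \<in> charts M.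
        openin (mtop M) V \<and> openin (Euclidean_space (mdim M)) (x ` V) \<and>
        homeomorphic_map (subtopology (mtop M) V)
                         (subtopology (Euclidean_space (mdim M)) (x ` V)) x) \<and>
     (\<forall>(V, x) \<in> charts M. \<forall>(W, y) \<in> charts M. \<forall>i < mdim M.
        Cinf_on (mdim M) (x ` (V \<inter> W)) (\<lambda>u. y (inv_into V x u) i))"

text \<open>Smoothness of a function on an open subset \<open>U\<close> of \<open>M\<close>.\<close>

definition smooth_fun_on :: "'m manifold \<Rightarrow> 'm set \<Rightarrow> ('m \<Rightarrow> real) \<Rightarrow> bool" where
  "smooth_fun_on M U f \<longleftrightarrow>
     (\<forall>(V, x) \<in> charts M. Cinf_on (mdim M) (x ` (U \<inter> V)) (\<lambda>u. f (inv_into V x u)))"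

definition smooth_funs :: "'m manifold \<Rightarrow> ('m \<Rightarrow> real) set" where
  "smooth_funs M = {f. smooth_fun_on M UNIV f}"

definition smooth_map :: "'m manifold \<Rightarrow> 'n manifold \<Rightarrow> ('m \<Rightarrow> 'n) \<Rightarrow> bool" where
  "smooth_map M N \<phi> \<longleftrightarrow>
     continuous_map (mtop M) (mtop N) \<phi> \<and>
     (\<forall>(W, y) \<in> charts N. \<forall>i < mdim N. smooth_fun_on M (\<phi> -` W) (\<lambda>p. y (\<phi> p) i))"

definition point_manifold :: "unit manifold" where
  "point_manifold = \<lparr>mtop = discrete_topology UNIV, mdim = 0, charts = {(UNIV, \<lambda>_ _. 0)}\<rparr>"

text \<open>
  Tangent vectors at \<open>p\<close> are the derivations at \<open>p\<close> of the algebra of smooth functions.  They are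
  set to \<open>0\<close> on non-smooth functions, so that two derivations are equal as HOL functions iff they
  agree on all smooth functions.  A vector field \<open>X\<close> is smooth iff \<open>X f\<close> is smooth for every smooth
  \<open>f\<close>; the Lie derivative of \<open>f\<close> along \<open>X\<close> is \<^term>\<open>\<lambda>p. X p f\<close>.
\<close>

definition tangent_space :: "'m manifold \<Rightarrow> 'm \<Rightarrow> (('m \<Rightarrow> real) \<Rightarrow> real) set" where
  "tangent_space M p = {v.
     (\<forall>f\<in>smooth_funs M. \<forall>g\<in>smooth_funs M. v (\<lambda>q. f q + g q) = v f + v g) \<and>
     (\<forall>c. \<forall>f\<in>smooth_funs M. v (\<lambda>q. c * f q) = c * v f) \<and>
     (\<forall>f\<in>smooth_funs M. \<forall>g\<in>smooth_funs M. v (\<lambda>q. f q * g q) = f p * v g + v f * g p) \<and>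
     (\<forall>f. f \<notin> smooth_funs M \<longrightarrow> v f = 0)}"

definition vector_fields :: "'m manifold \<Rightarrow> ('m \<Rightarrow> ('m \<Rightarrow> real) \<Rightarrow> real) set" where
  "vector_fields M = {X. (\<forall>p. X p \<in> tangent_space M p) \<and>
                         (\<forall>f\<in>smooth_funs M. (\<lambda>p. X p f) \<in> smooth_funs M)}"

definition vf_bracket ::
  "('m \<Rightarrow> ('m \<Rightarrow> real) \<Rightarrow> real) \<Rightarrow> ('m \<Rightarrow> ('m \<Rightarrow> real) \<Rightarrow> real) \<Rightarrow> 'm \<Rightarrow> ('m \<Rightarrow> real) \<Rightarrow> real" where
  "vf_bracket X Y = (\<lambda>p f. X p (\<lambda>q. Y q f) - Y p (\<lambda>q. X q f))"


section \<open>Vector bundles\<close>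

text \<open>
  The fibres are linear subspaces of one real vector space \<open>'v\<close>, which serves only as a container:
  it carries no topology, and fibres over different points are unrelated.  The smooth structure is
  given by an atlas of local frames \<open>(U, e)\<close>, i.e. of local trivializations, where
  \<open>e 0 p, ..., e (r - 1) p\<close> is a basis of the fibre over \<open>p \<in> U\<close>.
\<close>

record ('m, 'v) vbundle =
  base :: "'m manifold"
  fibre :: "'m \<Rightarrow> 'v set"
  brank :: nat
  frames :: "('m set \<times> (nat \<Rightarrow> 'm \<Rightarrow> 'v)) set"

definition frame_on :: "('m, 'v::real_vector) vbundle \<Rightarrow> 'm set \<Rightarrow> (nat \<Rightarrow> 'm \<Rightarrow> 'v) \<Rightarrow> bool" where
  "frame_on B U e \<longleftrightarrow>
     (\<forall>p\<in>U. inj_on (\<lambda>i. e i p) {..<brank B} \<and>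
            independent ((\<lambda>i. e i p) ` {..<brank B}) \<and>
            span ((\<lambda>i. e i p) ` {..<brank B}) = fibre B p)"

text \<open>
  \<open>smooth_along B M \<phi> U s\<close>: for \<open>\<phi> : M \<rightarrow> base B\<close> and \<open>U\<close> open in \<open>M\<close>, the map \<open>s\<close>, with \<open>s p\<close> in the
  fibre over \<open>\<phi> p\<close>, is smooth on \<open>U\<close>, i.e. has smooth components with respect to the local frames.
\<close>

definition smooth_along ::
  "('n, 'v::real_vector) vbundle \<Rightarrow> 'm manifold \<Rightarrow> ('m \<Rightarrow> 'n) \<Rightarrow> 'm set \<Rightarrow> ('m \<Rightarrow> 'v) \<Rightarrow> bool" where
  "smooth_along B M \<phi> U s \<longleftrightarrow>
     (\<forall>(V, e) \<in> frames B. \<exists>c.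
        (\<forall>i<brank B. smooth_fun_on M (U \<inter> \<phi> -` V) (c i)) \<and>
        (\<forall>p \<in> U \<inter> \<phi> -` V. s p = (\<Sum>i<brank B. c i p *\<^sub>R e i (\<phi> p))))"

definition vector_bundle :: "('m, 'v::real_vector) vbundle \<Rightarrow> bool" where
  "vector_bundle B \<longleftrightarrow>
     smooth_manifold (base B) \<and>
     (\<forall>p. subspace (fibre B p)) \<and>
     \<Union>(fst ` frames B) = UNIV \<and>
     (\<forall>(U, e) \<in> frames B. openin (mtop (base B)) U \<and> frame_on B U e \<and>
        (\<forall>i<brank B. smooth_along B (base B) id U (e i)))"

definition sections :: "('m, 'v::real_vector) vbundle \<Rightarrow> ('m \<Rightarrow> 'v) set" where
  "sections B = {s. (\<forall>p. s p \<in> fibre B p) \<and> smooth_along B (base B) id UNIV s}"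

definition bundle_map ::
  "('m, 'v::real_vector) vbundle \<Rightarrow> ('n, 'w::real_vector) vbundle \<Rightarrow> ('m \<Rightarrow> 'n) \<Rightarrow> ('m \<Rightarrow> 'v \<Rightarrow> 'w) \<Rightarrow> bool"
where
  "bundle_map B B' \<phi> \<Phi> \<longleftrightarrow>
     vector_bundle B \<and> vector_bundle B' \<and> smooth_map (base B) (base B') \<phi> \<and>
     (\<forall>p. \<forall>v\<in>fibre B p. \<Phi> p v \<in> fibre B' (\<phi> p)) \<and>
     (\<forall>p. \<forall>v\<in>fibre B p. \<forall>w\<in>fibre B p. \<Phi> p (v + w) = \<Phi> p v + \<Phi> p w) \<and>
     (\<forall>p c. \<forall>v\<in>fibre B p. \<Phi> p (c *\<^sub>R v) = c *\<^sub>R \<Phi> p v) \<and>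
     (\<forall>(U, e) \<in> frames B. \<forall>i<brank B. smooth_along B' (base B) \<phi> U (\<lambda>p. \<Phi> p (e i p)))"

text \<open>
  The trivial bundle \<open>M \<times> 'h\<close>, for a finite-dimensional space \<open>'h\<close>, with all constant frames.  The
  point \<open>(p, y)\<close> of the total space is represented by \<open>y\<close> in the fibre over \<open>p\<close>.
\<close>

definition trivial_bundle :: "'m manifold \<Rightarrow> ('m, 'h::real_vector) vbundle" where
  "trivial_bundle M =
     \<lparr>base = M, fibre = (\<lambda>_. UNIV), brank = dim (UNIV :: 'h set),
      frames = {(UNIV, \<lambda>i _. b i) | b.
                  inj_on b {..<dim (UNIV :: 'h set)} \<and>
                  independent (b ` {..<dim (UNIV :: 'h set)}) \<and>
                  span (b ` {..<dim (UNIV :: 'h set)}) = UNIV}\<rparr>"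

definition bundle_sum ::
  "('m, 'v::real_vector) vbundle \<Rightarrow> ('m, 'w::real_vector) vbundle \<Rightarrow> ('m, 'v \<times> 'w) vbundle" where
  "bundle_sum B B' =
     \<lparr>base = base B, fibre = (\<lambda>p. fibre B p \<times> fibre B' p), brank = brank B + brank B',
      frames = {(U \<inter> U', \<lambda>i p. if i < brank B then (e i p, 0) else (0, e' (i - brank B) p)) | U e U' e'.
                  (U, e) \<in> frames B \<and> (U', e') \<in> frames B'}\<rparr>"

text \<open>
  The subbundle of rank \<open>r\<close> with fibres \<open>S p\<close>: its local frames are all the smooth local frames of
  \<open>S\<close> in the ambient bundle.  In general they need not cover the base, so \<^const>\<open>vector_bundle\<close> is
  a nontrivial property of the result.
\<close>

definition subbundle :: "('m, 'v::real_vector) vbundle \<Rightarrow> ('m \<Rightarrow> 'v set) \<Rightarrow> nat \<Rightarrow> ('m, 'v) vbundle" where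
  "subbundle B S r =
     \<lparr>base = base B, fibre = S, brank = r,
      frames = {(U, e). openin (mtop (base B)) U \<and>
                  (\<forall>p\<in>U. inj_on (\<lambda>i. e i p) {..<r} \<and> independent ((\<lambda>i. e i p) ` {..<r}) \<and>
                         span ((\<lambda>i. e i p) ` {..<r}) = S p) \<and>
                  (\<forall>i<r. smooth_along B (base B) id U (e i))}\<rparr>"

definition kernel_bundle ::
  "('m, 'v::real_vector) vbundle \<Rightarrow> ('m \<Rightarrow> 'v \<Rightarrow> 'h::real_vector) \<Rightarrow> ('m, 'v) vbundle" where
  "kernel_bundle B F =
     subbundle B (\<lambda>p. {a \<in> fibre B p. F p a = 0}) (brank B - dim (UNIV :: 'h set))"

text \<open>Exactness of \<open>0 \<rightarrow> K \<rightarrow> B \<rightarrow> Q \<rightarrow> 0\<close> on fibres; \<open>\<iota>\<close> covers the identity and \<open>F\<close> covers \<open>\<phi>\<close>.\<close>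

definition fibrewise_exact ::
  "('m, 'u::real_vector) vbundle \<Rightarrow> ('m, 'v::real_vector) vbundle \<Rightarrow> ('n, 'w::real_vector) vbundle \<Rightarrow>
   ('m \<Rightarrow> 'u \<Rightarrow> 'v) \<Rightarrow> ('m \<Rightarrow> 'n) \<Rightarrow> ('m \<Rightarrow> 'v \<Rightarrow> 'w) \<Rightarrow> bool" where
  "fibrewise_exact K B Q \<iota> \<phi> F \<longleftrightarrow>
     (\<forall>p. inj_on (\<iota> p) (fibre K p) \<and>
          \<iota> p ` fibre K p = {a \<in> fibre B p. F p a = 0} \<and>
          F p ` fibre B p = fibre Q (\<phi> p))"

definition bundle_ses ::
  "('m, 'u::real_vector) vbundle \<Rightarrow> ('m, 'v::real_vector) vbundle \<Rightarrow> ('m, 'w::real_vector) vbundle \<Rightarrow>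
   ('m \<Rightarrow> 'u \<Rightarrow> 'v) \<Rightarrow> ('m \<Rightarrow> 'v \<Rightarrow> 'w) \<Rightarrow> bool" where
  "bundle_ses K B Q \<iota> F \<longleftrightarrow>
     base K = base B \<and> base Q = base B \<and>
     bundle_map K B id \<iota> \<and> bundle_map B Q id F \<and> fibrewise_exact K B Q \<iota> id F"

definition bundle_splitting ::
  "('m, 'v::real_vector) vbundle \<Rightarrow> ('m, 'w::real_vector) vbundle \<Rightarrow>
   ('m \<Rightarrow> 'v \<Rightarrow> 'w) \<Rightarrow> ('m \<Rightarrow> 'w \<Rightarrow> 'v) \<Rightarrow> bool" where
  "bundle_splitting B Q F \<sigma> \<longleftrightarrow> bundle_map Q B id \<sigma> \<and> (\<forall>p. \<forall>y\<in>fibre Q p. F p (\<sigma> p y) = y)"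


section \<open>Lie algebras and Lie algebroids\<close>

definition lie_algebra :: "('h::real_vector \<Rightarrow> 'h \<Rightarrow> 'h) \<Rightarrow> bool" where
  "lie_algebra br \<longleftrightarrow>
     (\<exists>B::'h set. finite B \<and> span B = UNIV) \<and>
     bilinear br \<and> (\<forall>x. br x x = 0) \<and>
     (\<forall>x y z. br x (br y z) + br y (br z x) + br z (br x y) = 0)"

record ('m, 'v) algebroid =
  vbun :: "('m, 'v) vbundle"
  anchor :: "'m \<Rightarrow> 'v \<Rightarrow> ('m \<Rightarrow> real) \<Rightarrow> real"
  bracket :: "('m \<Rightarrow> 'v) \<Rightarrow> ('m \<Rightarrow> 'v) \<Rightarrow> 'm \<Rightarrow> 'v"

definition anchor_vf ::
  "('m, 'v) algebroid \<Rightarrow> ('m \<Rightarrow> 'v) \<Rightarrow> 'm \<Rightarrow> ('m \<Rightarrow> real) \<Rightarrow> real" where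
  "anchor_vf L a = (\<lambda>p. anchor L p (a p))"

text \<open>A smooth bundle map from \<open>B\<close> to the tangent bundle, over the identity.\<close>

definition anchor_map ::
  "('m, 'v::real_vector) vbundle \<Rightarrow> ('m \<Rightarrow> 'v \<Rightarrow> ('m \<Rightarrow> real) \<Rightarrow> real) \<Rightarrow> bool" where
  "anchor_map B \<rho> \<longleftrightarrow>
     (\<forall>p. \<forall>v\<in>fibre B p. \<rho> p v \<in> tangent_space (base B) p) \<and>
     (\<forall>p f. \<forall>v\<in>fibre B p. \<forall>w\<in>fibre B p. \<rho> p (v + w) f = \<rho> p v f + \<rho> p w f) \<and>
     (\<forall>p f c. \<forall>v\<in>fibre B p. \<rho> p (c *\<^sub>R v) f = c * \<rho> p v f) \<and>
     (\<forall>(U, e) \<in> frames B. \<forall>i<brank B. \<forall>f\<in>smooth_funs (base B).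
        smooth_fun_on (base B) U (\<lambda>p. \<rho> p (e i p) f))"

text \<open>
  The bracket is only constrained on pairs of smooth sections.  That the anchor preserves brackets
  (the last condition) follows from the other axioms, but it is customarily listed.
\<close>

definition lie_algebroid :: "('m, 'v::real_vector) algebroid \<Rightarrow> bool" where
  "lie_algebroid L \<longleftrightarrow>
     (let \<Gamma> = sections (vbun L); br = bracket L; \<rho> = anchor_vf L in
        vector_bundle (vbun L) \<and> anchor_map (vbun L) (anchor L) \<and>
        (\<forall>a\<in>\<Gamma>. \<forall>b\<in>\<Gamma>. br a b \<in> \<Gamma>) \<and>
        (\<forall>a\<in>\<Gamma>. \<forall>b\<in>\<Gamma>. \<forall>c\<in>\<Gamma>. br (\<lambda>p. a p + b p) c = (\<lambda>p. br a c p + br b c p)) \<and>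
        (\<forall>a\<in>\<Gamma>. \<forall>b\<in>\<Gamma>. \<forall>t. br (\<lambda>p. t *\<^sub>R a p) b = (\<lambda>p. t *\<^sub>R br a b p)) \<and>
        (\<forall>a\<in>\<Gamma>. \<forall>b\<in>\<Gamma>. br a b = (\<lambda>p. - br b a p)) \<and>
        (\<forall>a\<in>\<Gamma>. \<forall>b\<in>\<Gamma>. \<forall>c\<in>\<Gamma>. \<forall>p. br a (br b c) p + br b (br c a) p + br c (br a b) p = 0) \<and>
        (\<forall>a\<in>\<Gamma>. \<forall>b\<in>\<Gamma>. \<forall>f\<in>smooth_funs (base (vbun L)).
           br a (\<lambda>p. f p *\<^sub>R b p) = (\<lambda>p. f p *\<^sub>R br a b p + \<rho> a p f *\<^sub>R b p)) \<and>
        (\<forall>a\<in>\<Gamma>. \<forall>b\<in>\<Gamma>. \<rho> (br a b) = vf_bracket (\<rho> a) (\<rho> b)))"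

text \<open>
  Morphisms over an arbitrary base map, following Higgins and Mackenzie.  The bracket condition is
  expressed through decompositions \<open>\<Phi> \<circ> a = \<Sum>\<^sub>i u\<^sub>i (a'\<^sub>i \<circ> \<phi>)\<close> with smooth functions \<open>u\<^sub>i\<close> on the
  source base and sections \<open>a'\<^sub>i\<close> of the target, because \<open>\<Phi> \<circ> a\<close> is in general not of the form
  \<open>a' \<circ> \<phi>\<close>.
\<close>

definition decomposition ::
  "('m, 'v::real_vector) algebroid \<Rightarrow> ('n, 'w::real_vector) algebroid \<Rightarrow> ('m \<Rightarrow> 'n) \<Rightarrow> ('m \<Rightarrow> 'v \<Rightarrow> 'w) \<Rightarrow>
   ('m \<Rightarrow> 'v) \<Rightarrow> nat \<Rightarrow> (nat \<Rightarrow> 'm \<Rightarrow> real) \<Rightarrow> (nat \<Rightarrow> 'n \<Rightarrow> 'w) \<Rightarrow> bool" where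
  "decomposition L L' \<phi> \<Phi> a k u a' \<longleftrightarrow>
     (\<forall>i<k. u i \<in> smooth_funs (base (vbun L)) \<and> a' i \<in> sections (vbun L')) \<and>
     (\<forall>p. \<Phi> p (a p) = (\<Sum>i<k. u i p *\<^sub>R a' i (\<phi> p)))"

definition lie_algebroid_morphism ::
  "('m, 'v::real_vector) algebroid \<Rightarrow> ('n, 'w::real_vector) algebroid \<Rightarrow>
   ('m \<Rightarrow> 'n) \<Rightarrow> ('m \<Rightarrow> 'v \<Rightarrow> 'w) \<Rightarrow> bool" where
  "lie_algebroid_morphism L L' \<phi> \<Phi> \<longleftrightarrow>
     lie_algebroid L \<and> lie_algebroid L' \<and> bundle_map (vbun L) (vbun L') \<phi> \<Phi> \<and>
     (\<forall>p. \<forall>v\<in>fibre (vbun L) p. \<forall>g\<in>smooth_funs (base (vbun L')).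
        anchor L' (\<phi> p) (\<Phi> p v) g = anchor L p v (\<lambda>q. g (\<phi> q))) \<and>
     (\<forall>a\<in>sections (vbun L). \<forall>b\<in>sections (vbun L). \<forall>k u a' l v b'.
        decomposition L L' \<phi> \<Phi> a k u a' \<and> decomposition L L' \<phi> \<Phi> b l v b' \<longrightarrow>
        (\<forall>p. \<Phi> p (bracket L a b p) =
           (\<Sum>i<k. \<Sum>j<l. (u i p * v j p) *\<^sub>R bracket L' (a' i) (b' j) (\<phi> p))
           + (\<Sum>j<l. anchor L p (a p) (v j) *\<^sub>R b' j (\<phi> p))
           - (\<Sum>i<k. anchor L p (b p) (u i) *\<^sub>R a' i (\<phi> p))))"

text \<open>A Lie algebra as a Lie algebroid over a point.\<close>

definition point_algebroid :: "('h::real_vector \<Rightarrow> 'h \<Rightarrow> 'h) \<Rightarrow> (unit, 'h) algebroid" where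
  "point_algebroid br0 =
     \<lparr>vbun = trivial_bundle point_manifold, anchor = (\<lambda>_ _ _. 0),
      bracket = (\<lambda>a b p. br0 (a p) (b p))\<rparr>"

definition lie_algebroid_ses ::
  "('m, 'u::real_vector) algebroid \<Rightarrow> ('m, 'v::real_vector) algebroid \<Rightarrow> ('n, 'w::real_vector) algebroid \<Rightarrow>
   ('m \<Rightarrow> 'u \<Rightarrow> 'v) \<Rightarrow> ('m \<Rightarrow> 'n) \<Rightarrow> ('m \<Rightarrow> 'v \<Rightarrow> 'w) \<Rightarrow> bool" where
  "lie_algebroid_ses K L Q \<iota> \<phi> F \<longleftrightarrow>
     base (vbun K) = base (vbun L) \<and>
     lie_algebroid_morphism K L id \<iota> \<and> lie_algebroid_morphism L Q \<phi> F \<and>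
     fibrewise_exact (vbun K) (vbun L) (vbun Q) \<iota> \<phi> F"

text \<open>The kernel of \<open>F\<close> with the anchor and the bracket of \<open>L\<close>.\<close>

definition kernel_algebroid ::
  "('m, 'v::real_vector) algebroid \<Rightarrow> ('m \<Rightarrow> 'v \<Rightarrow> 'h::real_vector) \<Rightarrow> ('m, 'v) algebroid" where
  "kernel_algebroid L F =
     \<lparr>vbun = kernel_bundle (vbun L) F, anchor = anchor L, bracket = bracket L\<rparr>"


section \<open>Actions up to homotopy\<close>

text \<open>The Chevalley-Eilenberg formula on 2-cochains, with \<open>nabla\<close> in place of a representation.\<close>

definition d_nabla ::
  "('h \<Rightarrow> 'h \<Rightarrow> 'h) \<Rightarrow> ('h \<Rightarrow> ('m \<Rightarrow> 'v) \<Rightarrow> 'm \<Rightarrow> 'v) \<Rightarrow> ('h \<Rightarrow> 'h \<Rightarrow> 'm \<Rightarrow> 'v::real_vector) \<Rightarrow>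
   'h \<Rightarrow> 'h \<Rightarrow> 'h \<Rightarrow> 'm \<Rightarrow> 'v" where
  "d_nabla br0 nabla \<omega> y0 y1 y2 = (\<lambda>p.
     nabla y0 (\<omega> y1 y2) p - nabla y1 (\<omega> y0 y2) p + nabla y2 (\<omega> y0 y1) p
     - \<omega> (br0 y0 y1) y2 p + \<omega> (br0 y0 y2) y1 p - \<omega> (br0 y1 y2) y0 p)"

definition action_up_to_homotopy ::
  "('h::real_vector \<Rightarrow> 'h \<Rightarrow> 'h) \<Rightarrow> ('m, 'v::real_vector) algebroid \<Rightarrow>
   ('h \<Rightarrow> 'm \<Rightarrow> ('m \<Rightarrow> real) \<Rightarrow> real) \<Rightarrow> ('h \<Rightarrow> ('m \<Rightarrow> 'v) \<Rightarrow> 'm \<Rightarrow> 'v) \<Rightarrow>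
   ('h \<Rightarrow> 'h \<Rightarrow> 'm \<Rightarrow> 'v) \<Rightarrow> bool" where
  "action_up_to_homotopy br0 E \<alpha> nabla \<omega> \<longleftrightarrow>
     (let M = base (vbun E); \<Gamma> = sections (vbun E); brE = bracket E; \<rho> = anchor_vf E in
        lie_algebra br0 \<and> lie_algebroid E \<and>
        \<comment> \<open>\<open>\<alpha>\<close> is a linear map to the vector fields\<close>
        (\<forall>y. \<alpha> y \<in> vector_fields M) \<and>
        (\<forall>y z p f. \<alpha> (y + z) p f = \<alpha> y p f + \<alpha> z p f) \<and>
        (\<forall>c y p f. \<alpha> (c *\<^sub>R y) p f = c * \<alpha> y p f) \<and>
        \<comment> \<open>\<open>nabla\<close> is a bilinear map to the sections\<close>
        (\<forall>y. \<forall>s\<in>\<Gamma>. nabla y s \<in> \<Gamma>) \<and>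
        (\<forall>y z. \<forall>s\<in>\<Gamma>. nabla (y + z) s = (\<lambda>p. nabla y s p + nabla z s p)) \<and>
        (\<forall>c y. \<forall>s\<in>\<Gamma>. nabla (c *\<^sub>R y) s = (\<lambda>p. c *\<^sub>R nabla y s p)) \<and>
        (\<forall>y. \<forall>s\<in>\<Gamma>. \<forall>t\<in>\<Gamma>. nabla y (\<lambda>p. s p + t p) = (\<lambda>p. nabla y s p + nabla y t p)) \<and>
        (\<forall>c y. \<forall>s\<in>\<Gamma>. nabla y (\<lambda>p. c *\<^sub>R s p) = (\<lambda>p. c *\<^sub>R nabla y s p)) \<and>
        \<comment> \<open>\<open>\<omega>\<close> is an alternating bilinear map to the sections\<close>
        (\<forall>y z. \<omega> y z \<in> \<Gamma>) \<and> (\<forall>p. bilinear (\<lambda>y z. \<omega> y z p)) \<and> (\<forall>y p. \<omega> y y p = 0) \<and>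
        \<comment> \<open>(i)\<close>
        (\<forall>y. \<forall>f\<in>smooth_funs M. \<forall>s\<in>\<Gamma>.
           nabla y (\<lambda>p. f p *\<^sub>R s p) = (\<lambda>p. f p *\<^sub>R nabla y s p + \<alpha> y p f *\<^sub>R s p)) \<and>
        (\<forall>y. \<forall>s\<in>\<Gamma>. \<forall>t\<in>\<Gamma>.
           nabla y (brE s t) = (\<lambda>p. brE (nabla y s) t p + brE s (nabla y t) p)) \<and>
        \<comment> \<open>(ii)\<close>
        (\<forall>y. \<forall>s\<in>\<Gamma>. \<rho> (nabla y s) = vf_bracket (\<alpha> y) (\<rho> s)) \<and>
        \<comment> \<open>(iii); the second relation is not implied by the first where \<open>E\<close> has rank \<open>0\<close>\<close>
        (\<forall>y z. \<forall>s\<in>\<Gamma>.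
           (\<lambda>p. nabla y (nabla z s) p - nabla z (nabla y s) p - nabla (br0 y z) s p)
           = brE (\<omega> y z) s) \<and>
        (\<forall>y z. (\<lambda>p f. vf_bracket (\<alpha> y) (\<alpha> z) p f - \<alpha> (br0 y z) p f) = \<rho> (\<omega> y z)) \<and>
        \<comment> \<open>(iv)\<close>
        (\<forall>y0 y1 y2. d_nabla br0 nabla \<omega> y0 y1 y2 = (\<lambda>_. 0)))"

text \<open>The bundle \<open>E \<oplus> (M \<times> 'h)\<close> with the anchor \<open>\<rho>(e) + \<alpha>(y)\<close> and a prospective bracket \<open>br\<close>.\<close>

definition product_algebroid ::
  "('m, 'v::real_vector) algebroid \<Rightarrow> ('h::real_vector \<Rightarrow> 'm \<Rightarrow> ('m \<Rightarrow> real) \<Rightarrow> real) \<Rightarrow>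
   (('m \<Rightarrow> 'v \<times> 'h) \<Rightarrow> ('m \<Rightarrow> 'v \<times> 'h) \<Rightarrow> 'm \<Rightarrow> 'v \<times> 'h) \<Rightarrow> ('m, 'v \<times> 'h) algebroid" where
  "product_algebroid E \<alpha> br =
     \<lparr>vbun = bundle_sum (vbun E) (trivial_bundle (base (vbun E))),
      anchor = (\<lambda>p (e, y) f. anchor E p e f + \<alpha> y p f),
      bracket = br\<rparr>"

definition extends_constant_bracket ::
  "('h \<Rightarrow> 'h \<Rightarrow> 'h) \<Rightarrow> ('m, 'v::real_vector) algebroid \<Rightarrow>
   ('h \<Rightarrow> ('m \<Rightarrow> 'v) \<Rightarrow> 'm \<Rightarrow> 'v) \<Rightarrow> ('h \<Rightarrow> 'h \<Rightarrow> 'm \<Rightarrow> 'v) \<Rightarrow>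
   (('m \<Rightarrow> 'v \<times> 'h) \<Rightarrow> ('m \<Rightarrow> 'v \<times> 'h) \<Rightarrow> 'm \<Rightarrow> 'v \<times> 'h) \<Rightarrow> bool" where
  "extends_constant_bracket br0 E nabla \<omega> br \<longleftrightarrow>
     (\<forall>s0\<in>sections (vbun E). \<forall>s1\<in>sections (vbun E). \<forall>y0 y1.
        br (\<lambda>p. (s0 p, y0)) (\<lambda>p. (s1 p, y1)) =
        (\<lambda>p. (bracket E s0 s1 p + nabla y0 s1 p - nabla y1 s0 p + \<omega> y0 y1 p, br0 y0 y1)))"

end

theory Submission
  imports Defs
begin

text \<open>
  Part (i).  A section of \<open>E \<oplus> (M \<times> 'h)\<close> is a \<open>C\<^sup>\<infinity>(M)\<close>-combination of \<open>'h\<close>-constant sections, so the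
  Leibniz rule determines the bracket, and the extension has a closed formula.  The defect of the
  anchor and then the Jacobiator are tensorial, so it suffices to let them vanish on constant
  sections, where the terms cancel by the axioms (i)-(iv).

  Part (ii).  Locally, the kernel of \<open>F\<close> is the common kernel of the components of \<open>F\<close>, from which
  Gaussian elimination produces smooth frames.  The bracket condition of the morphism \<open>F\<close> on sections
  with constant image says \<open>F [a, b] = [F a, F b]\<^sup>0\<close>; hence \<open>[y\<^sup>\<sigma>, \<epsilon>]\<close> and the curvature \<open>\<omega>\<close> take values in
  the kernel, and all axioms are instances of the Jacobi and Leibniz identities of \<open>\<A>\<close>.
\<close>

section \<open>Functions of class \<open>C\<^sup>k\<close>\<close>

text \<open>The order "anchor first, Jacobi second" in part (i) is forced. For a bracket satisfying
  the Leibniz rule, the Jacobiator of a, b, f c differs from f times the Jacobiator of a, b, c by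
  (\<rho>(a) \<rho>(b) f - \<rho>(b) \<rho>(a) f - \<rho>([a, b]) f) c, so it is tensorial only once
  the anchor preserves brackets. The reduction to constant sections is global: \<open>'h\<close> has
  a constant frame over all of M, and the E-part of a section is itself an
  \<open>'h\<close>-constant section with second entry 0. The space \<open>'h\<close> has no
  topology, so \<open>'h\<close>-valued functions are differentiated through linear functionals;
  this derivative is what the closed formula adds to the bracket of \<open>'h\<close>. In part (ii),
  finding kernel frames is only half of the work. A kernel frame has in general fewer members than
  the ambient rank, so the coefficients of a kernel section in it solve an overdetermined system.
  Elimination is used a second time, to see that these coefficients are smooth; only then are kernel
  frames and brackets of kernel sections smooth in the kernel bundle itself.\<close>

lemma Ck_on_continuous:
  "Ck_on n k S f \<Longrightarrow> continuous_map (subtopology (Euclidean_space n) S) euclideanreal f"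
  by (cases k) auto

lemma Ck_on_partialE:
  assumes "Ck_on n (Suc k) S f" "i < n"
  obtains g where "\<And>x. x \<in> S \<Longrightarrow> ((\<lambda>t. f (x(i := t))) has_real_derivative g x) (at (x i))"
    "Ck_on n k S g"
  using assms unfolding Ck_on.simps(2) by blast

lemma Ck_on_SucD: "Ck_on n (Suc k) S f \<Longrightarrow> Ck_on n k S f"
proof (induction k arbitrary: f)
  case (Suc k)
  have "\<exists>g. (\<forall>x\<in>S. ((\<lambda>t. f (x(i := t))) has_real_derivative g x) (at (x i))) \<and> Ck_on n k S g"
    if i: "i < n" for i
  proof -
    from Suc.prems i obtain g where
      "\<forall>x\<in>S. ((\<lambda>t. f (x(i := t))) has_real_derivative g x) (at (x i))" "Ck_on n (Suc k) S g"
      unfolding Ck_on.simps(2)[of n "Suc k"] by blast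
    with Suc.IH show ?thesis by blast
  qed
  then show ?case using Ck_on_continuous[OF Suc.prems] by simp
qed simp

lemma Ck_on_subset:
  assumes "Ck_on n k S f" "T \<subseteq> S"
  shows "Ck_on n k T f"
  using assms
proof (induction k arbitrary: f)
  case 0
  then show ?case using continuous_map_from_subtopology_mono by auto
next
  case (Suc k)
  have "\<exists>g. (\<forall>x\<in>T. ((\<lambda>t. f (x(i := t))) has_real_derivative g x) (at (x i))) \<and> Ck_on n k T g"
    if i: "i < n" for i
  proof -
    from Suc.prems i obtain g where
      "\<forall>x\<in>S. ((\<lambda>t. f (x(i := t))) has_real_derivative g x) (at (x i))" "Ck_on n k S g"
      by (auto simp: Ck_on.simps(2))
    with Suc.IH Suc.prems(2) show ?thesis by blast
  qed
  moreover have "continuous_map (subtopology (Euclidean_space n) T) euclideanreal f"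
    using Ck_on_continuous[OF Suc.prems(1)] Suc.prems(2) continuous_map_from_subtopology_mono by blast
  ultimately show ?case by simp
qed

lemma continuous_map_coordinate_line:
  assumes "x \<in> topspace (Euclidean_space n)" "i < n"
  shows "continuous_map euclideanreal (Euclidean_space n) (\<lambda>t. x(i := t))"
proof -
  have eq: "(\<lambda>t. x(i := t)) = (\<lambda>t j. if j < n then (if j = i then t else x j) else 0)"
    using assms by (auto simp: topspace_Euclidean_space fun_eq_iff)
  have "continuous_map euclideanreal euclideanreal (\<lambda>t. if j = i then t else x j)" for j
    by (cases "j = i") auto
  then show ?thesis
    unfolding eq continuous_map_componentwise_Euclidean_space by blast
qed

text \<open>The derivatives in \<open>Ck_on\<close> look at \<open>f\<close> along a whole
  coordinate line. Openness of \<open>S\<close> keeps a neighbourhood of \<open>x i\<close> on that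
  line inside \<open>S\<close>, so that only the values on \<open>S\<close> matter.\<close>

lemma eventually_coordinate_line:
  assumes "openin (Euclidean_space n) S" "x \<in> S" "i < n"
  shows "\<forall>\<^sub>F t in nhds (x i). x(i := t) \<in> S"
proof -
  have "x \<in> topspace (Euclidean_space n)"
    using assms openin_subset by blast
  then have "openin euclideanreal {t \<in> topspace euclideanreal. x(i := t) \<in> S}"
    using openin_continuous_map_preimage continuous_map_coordinate_line assms by blast
  then have "open {t. x(i := t) \<in> S}" by simp
  moreover have "x i \<in> {t. x(i := t) \<in> S}" using assms by simp
  ultimately show ?thesis using eventually_nhds by blast
qed

lemma Ck_on_cong:
  assumes "openin (Euclidean_space n) S" "\<And>x. x \<in> S \<Longrightarrow> f x = g x" "Ck_on n k S f"
  shows "Ck_on n k S g"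
proof (cases k)
  case 0
  then show ?thesis using assms
    by (auto intro: continuous_map_eq)
next
  case (Suc l)
  have c: "continuous_map (subtopology (Euclidean_space n) S) euclideanreal g"
    using Ck_on_continuous[OF assms(3)] assms(2) by (auto intro: continuous_map_eq)
  have "\<exists>h. (\<forall>x\<in>S. ((\<lambda>t. g (x(i := t))) has_real_derivative h x) (at (x i))) \<and> Ck_on n l S h"
    if i: "i < n" for i
  proof -
    obtain h where
      h: "\<And>x. x\<in>S \<Longrightarrow> ((\<lambda>t. f (x(i := t))) has_real_derivative h x) (at (x i))" "Ck_on n l S h"
      using Ck_on_partialE[OF assms(3)[unfolded Suc] i] by blast
    have "((\<lambda>t. g (x(i := t))) has_real_derivative h x) (at (x i))" if "x \<in> S" for x
    proof -
      have ev: "\<forall>\<^sub>F t in nhds (x i). f (x(i := t)) = g (x(i := t))"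
        using eventually_coordinate_line[OF assms(1) that i] assms(2)
        by (auto elim: eventually_mono)
      show ?thesis using h(1)[OF that] DERIV_cong_ev[OF refl ev refl] by simp
    qed
    with h show ?thesis by blast
  qed
  with c Suc show ?thesis by simp
qed

lemma continuous_map_locally:
  assumes "\<And>x. x \<in> topspace X \<Longrightarrow> \<exists>T. openin X T \<and> x \<in> T \<and> continuous_map (subtopology X T) Y f"
  shows "continuous_map X Y f"
  unfolding continuous_map_def
proof (intro conjI allI impI)
  show "f \<in> topspace X \<rightarrow> topspace Y"
  proof
    fix x assume x: "x \<in> topspace X"
    then obtain T where "openin X T" "x \<in> T" "continuous_map (subtopology X T) Y f"
      using assms by blast
    with x show "f x \<in> topspace Y" by (auto simp: continuous_map_def Pi_iff)
  qed
next
  fix U assume U: "openin Y U"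
  show "openin X {x \<in> topspace X. f x \<in> U}"
  proof (subst openin_subopen, intro ballI)
    fix x assume x: "x \<in> {x \<in> topspace X. f x \<in> U}"
    then obtain T where T: "openin X T" "x \<in> T" "continuous_map (subtopology X T) Y f"
      using assms by blast
    have "openin (subtopology X T) {x \<in> topspace (subtopology X T). f x \<in> U}"
      using T(3) U by (rule openin_continuous_map_preimage)
    then have "openin X {x \<in> topspace (subtopology X T). f x \<in> U}"
      using T(1) openin_trans_full by blast
    then show "\<exists>T. openin X T \<and> x \<in> T \<and> T \<subseteq> {x \<in> topspace X. f x \<in> U}"
      using x T by (intro exI[of _ "{x \<in> topspace (subtopology X T). f x \<in> U}"]) auto
  qed
qed

lemma Ck_on_locally:
  assumes "S \<subseteq> topspace (Euclidean_space n)"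
    and "\<And>x. x \<in> S \<Longrightarrow> \<exists>T. openin (Euclidean_space n) T \<and> x \<in> T \<and> T \<subseteq> S \<and> Ck_on n k T f"
  shows "Ck_on n k S f"
  using assms(2)
proof (induction k arbitrary: f)
  case 0
  show ?case
    unfolding Ck_on.simps
  proof (rule continuous_map_locally)
    fix x assume "x \<in> topspace (subtopology (Euclidean_space n) S)"
    then obtain T where T: "openin (Euclidean_space n) T" "x \<in> T" "T \<subseteq> S" "Ck_on n 0 T f"
      using 0 by auto
    then show "\<exists>T. openin (subtopology (Euclidean_space n) S) T \<and> x \<in> T \<and>
         continuous_map (subtopology (subtopology (Euclidean_space n) S) T) euclideanreal f"
      by (intro exI[of _ T]) (auto simp: subtopology_subtopology inf.absorb2 openin_subset_topspace_eq
          openin_subtopology)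
  qed
next
  case (Suc k)
  have c: "continuous_map (subtopology (Euclidean_space n) S) euclideanreal f"
  proof (rule continuous_map_locally)
    fix x assume "x \<in> topspace (subtopology (Euclidean_space n) S)"
    then obtain T where T: "openin (Euclidean_space n) T" "x \<in> T" "T \<subseteq> S" "Ck_on n (Suc k) T f"
      using Suc.prems by (metis IntE topspace_subtopology)
    from Ck_on_continuous[OF T(4)] T show "\<exists>T. openin (subtopology (Euclidean_space n) S) T \<and> x \<in> T \<and>
         continuous_map (subtopology (subtopology (Euclidean_space n) S) T) euclideanreal f"
      by (intro exI[of _ T]) (auto simp: subtopology_subtopology inf.absorb2 openin_subtopology)
  qed
  have "\<exists>g. (\<forall>x\<in>S. ((\<lambda>t. f (x(i := t))) has_real_derivative g x) (at (x i))) \<and> Ck_on n k S g"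
    if i: "i < n" for i
  proof -
    \<comment> \<open>The derivatives found on the various \<open>T\<close> must agree before they
      can be glued; the definite description picks the unique derivative, which coincides with each
      of them.\<close>
    define g where "g x = (THE d. ((\<lambda>t. f (x(i := t))) has_real_derivative d) (at (x i)))" for x
    have loc: "\<exists>T. openin (Euclidean_space n) T \<and> x \<in> T \<and> T \<subseteq> S \<and> Ck_on n k T g \<and>
        ((\<lambda>t. f (x(i := t))) has_real_derivative g x) (at (x i))" if xS: "x \<in> S" for x
    proof -
      obtain T where T: "openin (Euclidean_space n) T" "x \<in> T" "T \<subseteq> S" "Ck_on n (Suc k) T f"
        using Suc.prems xS by blast
      then obtain h where h: "\<And>x. x\<in>T \<Longrightarrow> ((\<lambda>t. f (x(i := t))) has_real_derivative h x) (at (x i))"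
        "Ck_on n k T h" using Ck_on_partialE[OF T(4) i] by blast
      have "h z = g z" if "z \<in> T" for z
        unfolding g_def using h(1)[OF that] by (blast intro: the_equality[symmetric] DERIV_unique)
      then show ?thesis using T h Ck_on_cong[OF T(1) _ h(2)] by metis
    qed
    then have "Ck_on n k S g" using Suc.IH by meson
    with loc show ?thesis by meson
  qed
  with c show ?case by simp
qed

lemma Ck_on_const: "Ck_on n k S (\<lambda>_. c)"
proof (induction k arbitrary: c)
  case (Suc k)
  then show ?case by (auto intro!: exI[of _ "\<lambda>_. 0"])
qed simp

lemma Ck_on_add:
  assumes "Ck_on n k S f" "Ck_on n k S g"
  shows "Ck_on n k S (\<lambda>x. f x + g x)"
  using assms
proof (induction k arbitrary: f g)
  case 0
  then show ?case by (auto intro: continuous_intros)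
next
  case (Suc k)
  have "\<exists>h. (\<forall>x\<in>S. ((\<lambda>t. f (x(i := t)) + g (x(i := t))) has_real_derivative h x) (at (x i))) \<and> Ck_on n k S h"
    if i: "i < n" for i
  proof -
    obtain f' where
      f': "\<And>x. x\<in>S \<Longrightarrow> ((\<lambda>t. f (x(i := t))) has_real_derivative f' x) (at (x i))" "Ck_on n k S f'"
      using Ck_on_partialE[OF Suc.prems(1) i] by blast
    obtain g' where
      g': "\<And>x. x\<in>S \<Longrightarrow> ((\<lambda>t. g (x(i := t))) has_real_derivative g' x) (at (x i))" "Ck_on n k S g'"
      using Ck_on_partialE[OF Suc.prems(2) i] by blast
    have "((\<lambda>t. f (x(i := t)) + g (x(i := t))) has_real_derivative f' x + g' x) (at (x i))"
      if "x \<in> S" for x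
      using DERIV_add[OF f'(1)[OF that] g'(1)[OF that]] .
    moreover have "Ck_on n k S (\<lambda>x. f' x + g' x)"
      using Suc.IH f'(2) g'(2) .
    ultimately show ?thesis by (intro exI conjI ballI)
  qed
  with Suc.prems show ?case by (auto intro: continuous_intros)
qed

lemma Ck_on_mult:
  assumes "Ck_on n k S f" "Ck_on n k S g"
  shows "Ck_on n k S (\<lambda>x. f x * g x)"
  using assms
proof (induction k arbitrary: f g)
  case 0
  then show ?case by (auto intro: continuous_intros)
next
  case (Suc k)
  have "\<exists>h. (\<forall>x\<in>S. ((\<lambda>t. f (x(i := t)) * g (x(i := t))) has_real_derivative h x) (at (x i))) \<and> Ck_on n k S h"
    if i: "i < n" for i
  proof -
    obtain f' where
      f': "\<And>x. x\<in>S \<Longrightarrow> ((\<lambda>t. f (x(i := t))) has_real_derivative f' x) (at (x i))" "Ck_on n k S f'"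
      using Ck_on_partialE[OF Suc.prems(1) i] by blast
    obtain g' where
      g': "\<And>x. x\<in>S \<Longrightarrow> ((\<lambda>t. g (x(i := t))) has_real_derivative g' x) (at (x i))" "Ck_on n k S g'"
      using Ck_on_partialE[OF Suc.prems(2) i] by blast
    have "((\<lambda>t. f (x(i := t)) * g (x(i := t))) has_real_derivative f' x * g x + g' x * f x) (at (x i))"
      if "x \<in> S" for x
      using DERIV_mult[OF f'(1)[OF that] g'(1)[OF that]] by simp
    moreover have "Ck_on n k S (\<lambda>x. f' x * g x + g' x * f x)"
      \<comment> \<open>The product rule involves \<open>f\<close> and \<open>g\<close> themselves
        at order \<open>k\<close>, hence \<open>Ck_on_SucD\<close>.\<close>
      by (intro Ck_on_add Suc.IH f'(2) g'(2) Suc.prems[THEN Ck_on_SucD])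
    ultimately show ?thesis by (intro exI conjI ballI)
  qed
  with Suc.prems show ?case by (auto intro: continuous_intros)
qed

text \<open>The derivative of 1/f is a product of f' with two copies of 1/f and a constant, so order
  \<open>k\<close> of 1/f yields order \<open>k + 1\<close>; \<open>f\<close> stays fixed throughout
  the induction.\<close>

lemma Ck_on_inverse:
  assumes "Ck_on n k S f" "\<And>x. x \<in> S \<Longrightarrow> f x \<noteq> 0"
  shows "Ck_on n k S (\<lambda>x. inverse (f x))"
  using assms(1)
proof (induction k)
  case 0
  then show ?case using assms(2) by (auto intro!: continuous_map_real_inverse)
next
  case (Suc k)
  have "\<exists>h. (\<forall>x\<in>S. ((\<lambda>t. inverse (f (x(i := t)))) has_real_derivative h x) (at (x i))) \<and> Ck_on n k S h"
    if i: "i < n" for i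
  proof -
    obtain f' where
      f': "\<And>x. x\<in>S \<Longrightarrow> ((\<lambda>t. f (x(i := t))) has_real_derivative f' x) (at (x i))" "Ck_on n k S f'"
      using Ck_on_partialE[OF Suc.prems i] by blast
    have "((\<lambda>t. inverse (f (x(i := t)))) has_real_derivative - 1 * (inverse (f x) * f' x * inverse (f x))) (at (x i))"
      if "x \<in> S" for x
      using DERIV_inverse'[OF f'(1)[OF that]] assms(2)[OF that] by simp
    moreover have "Ck_on n k S (\<lambda>x. inverse (f x))"
      using Suc.prems Ck_on_SucD Suc.IH by blast
    then have "Ck_on n k S (\<lambda>x. - 1 * (inverse (f x) * f' x * inverse (f x)))"
      by (intro Ck_on_mult Ck_on_const f'(2))
    ultimately show ?thesis by (intro exI conjI ballI)
  qed
  with Suc.prems show ?case using assms(2) by (auto intro!: continuous_map_real_inverse)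
qed


section \<open>Smooth functions on manifolds\<close>

context
  fixes M :: "'m manifold"
  assumes M: "smooth_manifold M"
begin

lemma openin_manifold_UNIV: "openin (mtop M) UNIV"
  using M openin_topspace[of "mtop M"] by (simp add: smooth_manifold_def)

lemma
  assumes "(V, x) \<in> charts M"
  shows inj_on_chart: "inj_on x V"
    and openin_chart_image: "openin (mtop M) U \<Longrightarrow> openin (Euclidean_space (mdim M)) (x ` (U \<inter> V))"
    and openin_chart_preimage:
      "openin (Euclidean_space (mdim M)) T \<Longrightarrow> openin (mtop M) {p \<in> V. x p \<in> T}"
proof -
  have h: "openin (mtop M) V" "openin (Euclidean_space (mdim M)) (x ` V)"
    "homeomorphic_map (subtopology (mtop M) V) (subtopology (Euclidean_space (mdim M)) (x ` V)) x"
    using M assms unfolding smooth_manifold_def by auto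
  have top: "topspace (subtopology (mtop M) V) = V"
    using M by (simp add: smooth_manifold_def)
  show "inj_on x V"
    using homeomorphic_imp_injective_map[OF h(3)] top by simp
  show "openin (Euclidean_space (mdim M)) (x ` (U \<inter> V))" if "openin (mtop M) U"
  proof -
    have "openin (subtopology (mtop M) V) (U \<inter> V)"
      using that openin_subtopology by blast
    then have "openin (subtopology (Euclidean_space (mdim M)) (x ` V)) (x ` (U \<inter> V))"
      using homeomorphic_imp_open_map[OF h(3)] by (simp add: open_map_def)
    then show ?thesis using h(2) openin_trans_full by blast
  qed
  show "openin (mtop M) {p \<in> V. x p \<in> T}" if "openin (Euclidean_space (mdim M)) T"
  proof -
    have "continuous_map (subtopology (mtop M) V) (Euclidean_space (mdim M)) x"
      using homeomorphic_imp_continuous_map[OF h(3)] continuous_map_in_subtopology by blast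
    from openin_continuous_map_preimage[OF this that]
    have "openin (mtop M) {p \<in> topspace (subtopology (mtop M) V). x p \<in> T}"
      using h(1) openin_trans_full by blast
    then show ?thesis unfolding top .
  qed
qed

lemma smooth_fun_on_subset: "smooth_fun_on M U f \<Longrightarrow> T \<subseteq> U \<Longrightarrow> smooth_fun_on M T f"
  unfolding smooth_fun_on_def Cinf_on_def
  by (fast intro: Ck_on_subset)

lemma smooth_fun_on_cong:
  assumes "openin (mtop M) U" "\<And>p. p \<in> U \<Longrightarrow> f p = g p" "smooth_fun_on M U f"
  shows "smooth_fun_on M U g"
  unfolding smooth_fun_on_def Cinf_on_def
proof clarify
  fix V x k assume c: "(V, x) \<in> charts M"
  have "Ck_on (mdim M) k (x ` (U \<inter> V)) (\<lambda>u. f (inv_into V x u))"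
    using assms(3) c unfolding smooth_fun_on_def Cinf_on_def by blast
  then show "Ck_on (mdim M) k (x ` (U \<inter> V)) (\<lambda>u. g (inv_into V x u))"
    by (rule Ck_on_cong[OF openin_chart_image[OF c assms(1)], rotated])
       (use assms(2) inj_on_chart[OF c] in auto)
qed

lemma smooth_fun_on_locally:
  assumes "openin (mtop M) U"
    and "\<And>p. p \<in> U \<Longrightarrow> \<exists>T. openin (mtop M) T \<and> p \<in> T \<and> smooth_fun_on M (U \<inter> T) f"
  shows "smooth_fun_on M U f"
  unfolding smooth_fun_on_def Cinf_on_def
proof clarify
  fix V x k assume c: "(V, x) \<in> charts M"
  show "Ck_on (mdim M) k (x ` (U \<inter> V)) (\<lambda>u. f (inv_into V x u))"
  proof (rule Ck_on_locally)
    show "x ` (U \<inter> V) \<subseteq> topspace (Euclidean_space (mdim M))"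
      using openin_chart_image[OF c assms(1)] openin_subset by blast
    fix u assume "u \<in> x ` (U \<inter> V)"
    then obtain p where p: "p \<in> U" "p \<in> V" "u = x p" by blast
    then obtain T where T: "openin (mtop M) T" "p \<in> T" "smooth_fun_on M (U \<inter> T) f"
      using assms(2) by blast
    have "Ck_on (mdim M) k (x ` (U \<inter> T \<inter> V)) (\<lambda>u. f (inv_into V x u))"
      using T(3) c unfolding smooth_fun_on_def Cinf_on_def by blast
    then show "\<exists>T. openin (Euclidean_space (mdim M)) T \<and> u \<in> T \<and> T \<subseteq> x ` (U \<inter> V) \<and>
        Ck_on (mdim M) k T (\<lambda>u. f (inv_into V x u))"
      using openin_chart_image[OF c openin_Int[OF assms(1) T(1)]] p T
      by (intro exI[of _ "x ` (U \<inter> T \<inter> V)"]) auto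
  qed
qed

lemma smooth_fun_on_const [simp]: "smooth_fun_on M U (\<lambda>_. c)"
  by (auto simp: smooth_fun_on_def Cinf_on_def Ck_on_const)

lemma smooth_fun_on_add:
  "smooth_fun_on M U f \<Longrightarrow> smooth_fun_on M U g \<Longrightarrow> smooth_fun_on M U (\<lambda>p. f p + g p)"
  unfolding smooth_fun_on_def Cinf_on_def by (auto split: prod.splits intro: Ck_on_add)

lemma smooth_fun_on_mult:
  "smooth_fun_on M U f \<Longrightarrow> smooth_fun_on M U g \<Longrightarrow> smooth_fun_on M U (\<lambda>p. f p * g p)"
  unfolding smooth_fun_on_def Cinf_on_def by (auto split: prod.splits intro: Ck_on_mult)

lemma smooth_fun_on_minus: "smooth_fun_on M U f \<Longrightarrow> smooth_fun_on M U (\<lambda>p. - f p)"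
  using smooth_fun_on_mult[OF smooth_fun_on_const[of _ "-1"]] by simp

lemma smooth_fun_on_diff:
  "smooth_fun_on M U f \<Longrightarrow> smooth_fun_on M U g \<Longrightarrow> smooth_fun_on M U (\<lambda>p. f p - g p)"
  using smooth_fun_on_add[OF _ smooth_fun_on_minus] by simp

lemma smooth_fun_on_sum:
  "(\<And>i. i \<in> I \<Longrightarrow> smooth_fun_on M U (f i)) \<Longrightarrow> smooth_fun_on M U (\<lambda>p. \<Sum>i\<in>I. f i p)"
  by (induction I rule: infinite_finite_induct) (auto intro: smooth_fun_on_add)

lemma smooth_fun_on_inverse:
  assumes "smooth_fun_on M U f" "\<And>p. p \<in> U \<Longrightarrow> f p \<noteq> 0"
  shows "smooth_fun_on M U (\<lambda>p. inverse (f p))"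
  unfolding smooth_fun_on_def Cinf_on_def
proof clarify
  fix V x k assume c: "(V, x) \<in> charts M"
  have "Ck_on (mdim M) k (x ` (U \<inter> V)) (\<lambda>u. f (inv_into V x u))"
    using assms(1) c unfolding smooth_fun_on_def Cinf_on_def by blast
  then show "Ck_on (mdim M) k (x ` (U \<inter> V)) (\<lambda>u. inverse (f (inv_into V x u)))"
    by (rule Ck_on_inverse) (use assms(2) inj_on_chart[OF c] in auto)
qed

lemma smooth_fun_on_divide:
  "smooth_fun_on M U f \<Longrightarrow> smooth_fun_on M U g \<Longrightarrow> (\<And>p. p \<in> U \<Longrightarrow> g p \<noteq> 0)
    \<Longrightarrow> smooth_fun_on M U (\<lambda>p. f p / g p)"
  unfolding divide_inverse by (intro smooth_fun_on_mult smooth_fun_on_inverse)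

text \<open>Order 0 of smoothness is continuity in charts, and charts are homeomorphisms onto open
  sets. The resulting open set is where an elimination step may divide by its pivot.\<close>

lemma openin_smooth_nonzero:
  assumes "openin (mtop M) U" "smooth_fun_on M U f"
  shows "openin (mtop M) {p \<in> U. f p \<noteq> 0}"
proof (subst openin_subopen, intro ballI)
  fix p assume p: "p \<in> {p \<in> U. f p \<noteq> 0}"
  have "p \<in> \<Union>(fst ` charts M)"
    using M by (simp add: smooth_manifold_def)
  then obtain V x where c: "(V, x) \<in> charts M" "p \<in> V"
    by auto
  let ?S = "x ` (U \<inter> V)" and ?f = "\<lambda>u. f (inv_into V x u)"
  have inv: "inv_into V x (x q) = q" if "q \<in> V" for q
    using inj_on_chart[OF c(1)] that by simp
  have S: "openin (Euclidean_space (mdim M)) ?S"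
    using openin_chart_image[OF c(1) assms(1)] .
  have "Ck_on (mdim M) 0 ?S ?f"
    using assms(2) c unfolding smooth_fun_on_def Cinf_on_def by blast
  then have "continuous_map (subtopology (Euclidean_space (mdim M)) ?S) euclideanreal ?f" by simp
  from openin_continuous_map_preimage[OF this, of "- {0}"]
  have "openin (subtopology (Euclidean_space (mdim M)) ?S)
      {u \<in> topspace (subtopology (Euclidean_space (mdim M)) ?S). ?f u \<in> - {0}}"
    by (simp add: open_Compl)
  then have "openin (Euclidean_space (mdim M))
      {u \<in> topspace (subtopology (Euclidean_space (mdim M)) ?S). ?f u \<in> - {0}}" (is "openin _ ?O")
    using S openin_trans_full by blast
  moreover have O: "?O = {u \<in> ?S. ?f u \<noteq> 0}"
    using openin_subset[OF S] by auto
  ultimately have "openin (mtop M) {q \<in> V. x q \<in> {u \<in> ?S. ?f u \<noteq> 0}}"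
    using openin_chart_preimage[OF c(1), of "{u \<in> ?S. ?f u \<noteq> 0}"] by metis
  moreover have "p \<in> {q \<in> V. x q \<in> {u \<in> ?S. ?f u \<noteq> 0}}" using p c inv by auto
  moreover have "{q \<in> V. x q \<in> {u \<in> ?S. ?f u \<noteq> 0}} \<subseteq> {p \<in> U. f p \<noteq> 0}"
    by (auto simp: inv) (metis inv)+
  ultimately show "\<exists>T. openin (mtop M) T \<and> p \<in> T \<and> T \<subseteq> {p \<in> U. f p \<noteq> 0}"
    by blast
qed

text \<open>The coordinates of one chart read in another are the transition maps, whose smoothness
  is the compatibility of the atlas.\<close>

lemma smooth_map_id: "smooth_map M M id"
proof -
  have "smooth_fun_on M W (\<lambda>p. y p i)" if "(W, y) \<in> charts M" "i < mdim M" for W y i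
    unfolding smooth_fun_on_def
  proof clarify
    fix V x assume "(V, x) \<in> charts M"
    with M that have "Cinf_on (mdim M) (x ` (V \<inter> W)) (\<lambda>u. y (inv_into V x u) i)"
      unfolding smooth_manifold_def by fast
    then show "Cinf_on (mdim M) (x ` (W \<inter> V)) (\<lambda>u. y (inv_into V x u) i)"
      by (simp add: Int_commute)
  qed
  then show ?thesis by (auto simp: smooth_map_def)
qed

end


section \<open>Bases and linear functionals\<close>

text \<open>A basis as an indexed family: coefficients belong to indices, an elimination step
  deletes an index, and repetitions need no separate treatment. For finite index sets and subspaces
  it agrees with the set-based condition used in frames, see
  \<open>basis_family_iff\<close>.\<close>

definition basis_family :: "'i set \<Rightarrow> ('i \<Rightarrow> 'v::real_vector) \<Rightarrow> 'v set \<Rightarrow> bool" where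
  "basis_family I f S \<longleftrightarrow>
     (\<forall>i\<in>I. f i \<in> S) \<and>
     (\<forall>a. (\<Sum>i\<in>I. a i *\<^sub>R f i) = 0 \<longrightarrow> (\<forall>i\<in>I. a i = 0)) \<and>
     (\<forall>v\<in>S. \<exists>a. v = (\<Sum>i\<in>I. a i *\<^sub>R f i))"

lemma basis_familyD:
  assumes "basis_family I f S"
  shows "i \<in> I \<Longrightarrow> f i \<in> S"
    and "(\<Sum>i\<in>I. a i *\<^sub>R f i) = 0 \<Longrightarrow> i \<in> I \<Longrightarrow> a i = 0"
    and "v \<in> S \<Longrightarrow> \<exists>a. v = (\<Sum>i\<in>I. a i *\<^sub>R f i)"
  using assms unfolding basis_family_def by blast+

lemma basis_family_unique:
  assumes "basis_family I f S" "(\<Sum>i\<in>I. a i *\<^sub>R f i) = (\<Sum>i\<in>I. c i *\<^sub>R f i)" "i \<in> I"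
  shows "a i = c i"
proof -
  have "(\<Sum>i\<in>I. (a i - c i) *\<^sub>R f i) = 0"
    using assms(2) by (simp add: scaleR_left_diff_distrib sum_subtractf)
  from basis_familyD(2)[OF assms(1) this assms(3)] show ?thesis by simp
qed

lemma basis_family_iff:
  assumes "finite I" "subspace S"
  shows "basis_family I f S \<longleftrightarrow> inj_on f I \<and> independent (f ` I) \<and> span (f ` I) = S"
proof
  assume B: "basis_family I f S"
  have inj: "inj_on f I"
  proof (rule inj_onI, rule ccontr)
    fix i j assume ij: "i \<in> I" "j \<in> I" "f i = f j" "i \<noteq> j"
    \<comment> \<open>A repeated vector would satisfy the relation with coefficient 1 at
      \<open>i\<close> and -1 at \<open>j\<close>.\<close>
    let ?a = "\<lambda>k. (if k = i then 1 else 0) - (if k = j then 1 else (0::real))"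
    have "(\<Sum>k\<in>I. ?a k *\<^sub>R f k) = (\<Sum>k\<in>I. if k = i then f k else 0) - (\<Sum>k\<in>I. if k = j then f k else 0)"
      by (subst sum_subtractf[symmetric]) (auto intro: sum.cong simp: scaleR_left_diff_distrib)
    also have "\<dots> = 0" using ij assms(1) by simp
    finally have "(\<Sum>k\<in>I. ?a k *\<^sub>R f k) = 0" .
    from basis_familyD(2)[OF B this ij(1)] ij(4) show False by simp
  qed
  have "independent (f ` I)"
  proof
    assume "dependent (f ` I)"
    then obtain u i where u: "i \<in> I" "u (f i) \<noteq> 0" "(\<Sum>v\<in>f ` I. u v *\<^sub>R v) = 0"
      using assms(1) by (auto simp: dependent_finite)
    have "(\<Sum>i\<in>I. u (f i) *\<^sub>R f i) = 0"
      using u(3) inj by (simp add: sum.reindex)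
    from basis_familyD(2)[OF B this u(1)] u(2) show False by simp
  qed
  moreover have "span (f ` I) = S"
  proof
    show "span (f ` I) \<subseteq> S"
      using basis_familyD(1)[OF B] assms(2) by (intro span_minimal) auto
    show "S \<subseteq> span (f ` I)"
    proof
      fix v assume "v \<in> S"
      then obtain a where "v = (\<Sum>i\<in>I. a i *\<^sub>R f i)" using basis_familyD(3)[OF B] by blast
      moreover have "(\<Sum>i\<in>I. a i *\<^sub>R f i) \<in> span (f ` I)"
        by (intro span_sum span_scale span_base) simp
      ultimately show "v \<in> span (f ` I)" by simp
    qed
  qed
  ultimately show "inj_on f I \<and> independent (f ` I) \<and> span (f ` I) = S" using inj by blast
next
  assume A: "inj_on f I \<and> independent (f ` I) \<and> span (f ` I) = S"
  then have inj: "inj_on f I" by simp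
  show "basis_family I f S"
    unfolding basis_family_def
  proof (intro conjI ballI allI impI)
    fix i assume "i \<in> I" then show "f i \<in> S" using A span_base[of "f i" "f ` I"] by auto
  next
    fix a i assume a: "(\<Sum>i\<in>I. a i *\<^sub>R f i) = 0" "i \<in> I"
    let ?u = "\<lambda>v. a (inv_into I f v)"
    have sum0: "(\<Sum>v\<in>f ` I. ?u v *\<^sub>R v) = 0"
      using a(1) inj by (simp add: sum.reindex)
    have "independent (f ` I)" "finite (f ` I)" "f i \<in> f ` I" using A assms(1) a(2) by auto
    from independentD[OF this(1,2) subset_refl sum0 this(3)] a(2) inj show "a i = 0" by simp
  next
    fix v assume "v \<in> S"
    then obtain u where "v = (\<Sum>w\<in>f ` I. u w *\<^sub>R w)"
      using A assms(1) span_finite[of "f ` I"] by auto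
    then show "\<exists>a. v = (\<Sum>i\<in>I. a i *\<^sub>R f i)"
      using inj by (intro exI[of _ "\<lambda>i. u (f i)"]) (simp add: sum.reindex)
  qed
qed

lemma basis_family_reindex:
  assumes "bij_betw g J I" "basis_family I f S"
  shows "basis_family J (\<lambda>j. f (g j)) S"
  unfolding basis_family_def
proof (intro conjI ballI allI impI)
  have g: "\<And>j. j \<in> J \<Longrightarrow> g j \<in> I" using assms(1) bij_betwE by blast
  fix j assume "j \<in> J"
  then show "f (g j) \<in> S" using basis_familyD(1)[OF assms(2)] g by blast
next
  fix a j assume a: "(\<Sum>j\<in>J. a j *\<^sub>R f (g j)) = 0" and j: "j \<in> J"
  have inv: "\<And>j. j \<in> J \<Longrightarrow> inv_into J g (g j) = j"
    using assms(1) by (simp add: bij_betw_def)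
  have "(\<Sum>i\<in>I. a (inv_into J g i) *\<^sub>R f i) = (\<Sum>j\<in>J. a (inv_into J g (g j)) *\<^sub>R f (g j))"
    using sum.reindex_bij_betw[OF assms(1), of "\<lambda>i. a (inv_into J g i) *\<^sub>R f i"] by simp
  also have "\<dots> = 0" using a inv by simp
  finally have "a (inv_into J g (g j)) = 0"
    by (rule basis_familyD(2)[OF assms(2), of "\<lambda>i. a (inv_into J g i)"])
      (use j assms(1) bij_betwE in blast)
  then show "a j = 0" using inv j by simp
next
  fix v assume "v \<in> S"
  then obtain a where "v = (\<Sum>i\<in>I. a i *\<^sub>R f i)" using basis_familyD(3)[OF assms(2)] by blast
  then have "v = (\<Sum>j\<in>J. a (g j) *\<^sub>R f (g j))"
    using sum.reindex_bij_betw[OF assms(1), of "\<lambda>i. a i *\<^sub>R f i"] by simp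
  then show "\<exists>a. v = (\<Sum>j\<in>J. a j *\<^sub>R f (g j))"
    by (intro exI[of _ "\<lambda>j. a (g j)"])
qed

lemma basis_family_coordinates:
  fixes b :: "'i \<Rightarrow> 'h::real_vector"
  assumes "basis_family I b UNIV"
  obtains \<kappa> :: "'i \<Rightarrow> 'h \<Rightarrow> real"
  where "\<And>i. i \<in> I \<Longrightarrow> linear (\<kappa> i)" "\<And>y. (\<Sum>i\<in>I. \<kappa> i y *\<^sub>R b i) = y"
proof -
  \<comment> \<open>One whole coefficient family is chosen for each \<open>y\<close> and then
    evaluated at \<open>i\<close>; uniqueness of coefficients makes the choice linear in
    \<open>y\<close>.\<close>
  define \<kappa> where "\<kappa> i y = (SOME a. y = (\<Sum>i\<in>I. a i *\<^sub>R b i)) i" for i y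
  have \<kappa>: "y = (\<Sum>i\<in>I. \<kappa> i y *\<^sub>R b i)" for y
    unfolding \<kappa>_def using basis_familyD(3)[OF assms UNIV_I, of y] by (rule someI_ex)
  have "linear (\<kappa> i)" if i: "i \<in> I" for i
  proof (rule linearI)
    fix x y
    have "(\<Sum>i\<in>I. \<kappa> i (x + y) *\<^sub>R b i) = (\<Sum>i\<in>I. (\<kappa> i x + \<kappa> i y) *\<^sub>R b i)"
      by (simp add: scaleR_left_distrib sum.distrib flip: \<kappa>)
    from basis_family_unique[OF assms this i] show "\<kappa> i (x + y) = \<kappa> i x + \<kappa> i y" .
  next
    fix c x
    have "(\<Sum>i\<in>I. \<kappa> i (c *\<^sub>R x) *\<^sub>R b i) = (\<Sum>i\<in>I. (c * \<kappa> i x) *\<^sub>R b i)"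
      by (simp flip: \<kappa> scaleR_scaleR scaleR_sum_right)
    from basis_family_unique[OF assms this i] show "\<kappa> i (c *\<^sub>R x) = c *\<^sub>R \<kappa> i x" by simp
  qed
  with \<kappa> show ?thesis using that by metis
qed

text \<open>The clause of \<open>lie_algebra\<close> that does not involve the bracket, as a
  predicate on the type, because \<open>'h\<close> belongs only to the class
  \<open>real_vector\<close>.\<close>

definition finite_dimensional :: "'h::real_vector itself \<Rightarrow> bool" where
  "finite_dimensional _ \<longleftrightarrow> (\<exists>B::'h set. finite B \<and> span B = UNIV)"

lemma finite_dimensional_basis:
  assumes "finite_dimensional TYPE('h::real_vector)"
  obtains b where "basis_family {..<dim (UNIV :: 'h::real_vector set)} b (UNIV :: 'h set)"
proof -
  obtain B0 :: "'h set" where B0: "finite B0" "span B0 = UNIV"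
    using assms by (auto simp: finite_dimensional_def)
  obtain B where B: "B \<subseteq> B0" "independent B" "B0 \<subseteq> span B"
    using maximal_independent_subset[of B0] by blast
  have fin: "finite B" using B(1) B0(1) finite_subset by blast
  have span: "span B = UNIV"
    using B(3) B0(2) span_mono[of B0 "span B"] by (simp add: span_span top.extremum_uniqueI)
  have "card B = dim (UNIV :: 'h set)"
    using dim_eq_card[of B UNIV] B(2) span by simp
  then obtain b where "bij_betw b {..<dim (UNIV :: 'h set)} B"
    using ex_bij_betw_nat_finite[OF fin] by (auto simp: atLeast0LessThan)
  then have "basis_family {..<dim (UNIV :: 'h set)} b (UNIV :: 'h set)"
    using B(2) span by (subst basis_family_iff) (auto simp: bij_betw_def)
  then show ?thesis using that by blast
qed

lemma finite_dimensional_coordinates: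
  assumes "finite_dimensional TYPE('h::real_vector)"
  shows "\<exists>b (\<kappa> :: nat \<Rightarrow> 'h \<Rightarrow> real). (\<forall>i<dim (UNIV :: 'h set). linear (\<kappa> i)) \<and>
    (\<forall>y. (\<Sum>i<dim (UNIV :: 'h set). \<kappa> i y *\<^sub>R b i) = y)"
proof -
  obtain b where "basis_family {..<dim (UNIV :: 'h set)} b (UNIV :: 'h set)"
    using finite_dimensional_basis[OF assms] .
  from basis_family_coordinates[OF this] show ?thesis by (metis lessThan_iff)
qed

text \<open>Coordinates in a finite basis are linear functionals, so functionals separate points.
  Identities in \<open>'h\<close> are reduced in this way to identities between real
  numbers.\<close>

lemma linear_functional_eqI:
  fixes x y :: "'h::real_vector"
  assumes "finite_dimensional TYPE('h)" "\<And>l. linear l \<Longrightarrow> l x = (l y :: real)"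
  shows "x = y"
proof -
  obtain b and \<kappa> :: "nat \<Rightarrow> 'h \<Rightarrow> real"
    where \<kappa>: "\<forall>i<dim (UNIV :: 'h set). linear (\<kappa> i)"
      "\<forall>y. (\<Sum>i<dim (UNIV :: 'h set). \<kappa> i y *\<^sub>R b i) = y"
    using finite_dimensional_coordinates[OF assms(1)] by blast
  have "x = (\<Sum>i<dim (UNIV :: 'h set). \<kappa> i x *\<^sub>R b i)" using \<kappa>(2) by simp
  also have "\<dots> = (\<Sum>i<dim (UNIV :: 'h set). \<kappa> i y *\<^sub>R b i)"
    by (rule sum.cong[OF refl]) (use assms(2) \<kappa>(1) in auto)
  also have "\<dots> = y" using \<kappa>(2) by simp
  finally show ?thesis .
qed


section \<open>Smooth maps into vector bundles\<close>

abbreviation smooth_section_on :: "('m, 'v::real_vector) vbundle \<Rightarrow> 'm set \<Rightarrow> ('m \<Rightarrow> 'v) \<Rightarrow> bool" where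
  "smooth_section_on B U s \<equiv> smooth_along B (base B) id U s"

lemma smooth_alongE:
  assumes "smooth_along B M \<phi> U s" "(V, e) \<in> frames B"
  obtains c where "\<And>i. i < brank B \<Longrightarrow> smooth_fun_on M (U \<inter> \<phi> -` V) (c i)"
    "\<And>p. p \<in> U \<Longrightarrow> \<phi> p \<in> V \<Longrightarrow> s p = (\<Sum>i<brank B. c i p *\<^sub>R e i (\<phi> p))"
  using assms unfolding smooth_along_def by fastforce

lemma smooth_section_onE:
  assumes "smooth_section_on B U s" "(V, e) \<in> frames B"
  obtains c where "\<And>i. i < brank B \<Longrightarrow> smooth_fun_on (base B) (U \<inter> V) (c i)"
    "\<And>p. p \<in> U \<Longrightarrow> p \<in> V \<Longrightarrow> s p = (\<Sum>i<brank B. c i p *\<^sub>R e i p)"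
  using smooth_alongE[OF assms] by (metis id_apply vimage_id)

lemma smooth_alongI:
  assumes "\<And>V e. (V, e) \<in> frames B \<Longrightarrow> \<exists>c. (\<forall>i<brank B. smooth_fun_on M (U \<inter> \<phi> -` V) (c i)) \<and>
     (\<forall>p\<in>U. \<phi> p \<in> V \<longrightarrow> s p = (\<Sum>i<brank B. c i p *\<^sub>R e i (\<phi> p)))"
  shows "smooth_along B M \<phi> U s"
  using assms unfolding smooth_along_def by fastforce

context
  fixes M :: "'m manifold"
  assumes M: "smooth_manifold M"
begin

lemma smooth_along_subset:
  assumes "smooth_along B M \<phi> U s" "T \<subseteq> U"
  shows "smooth_along B M \<phi> T s"
proof (rule smooth_alongI)
  fix V e assume "(V, e) \<in> frames B"
  from smooth_alongE[OF assms(1) this] obtain c where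
    c: "\<And>i. i < brank B \<Longrightarrow> smooth_fun_on M (U \<inter> \<phi> -` V) (c i)"
    "\<And>p. p \<in> U \<Longrightarrow> \<phi> p \<in> V \<Longrightarrow> s p = (\<Sum>i<brank B. c i p *\<^sub>R e i (\<phi> p))" by blast
  have "smooth_fun_on M (T \<inter> \<phi> -` V) (c i)" if "i < brank B" for i
    using smooth_fun_on_subset[OF M c(1)[OF that]] assms(2) by blast
  with c(2) assms(2) show "\<exists>c. (\<forall>i<brank B. smooth_fun_on M (T \<inter> \<phi> -` V) (c i)) \<and>
     (\<forall>p\<in>T. \<phi> p \<in> V \<longrightarrow> s p = (\<Sum>i<brank B. c i p *\<^sub>R e i (\<phi> p)))"
    by (intro exI[of _ c]) auto
qed

lemma smooth_along_cong:
  assumes "smooth_along B M \<phi> U s" "\<And>p. p \<in> U \<Longrightarrow> s p = t p"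
  shows "smooth_along B M \<phi> U t"
proof (rule smooth_alongI)
  fix V e assume "(V, e) \<in> frames B"
  from smooth_alongE[OF assms(1) this] obtain c where
    c: "\<And>i. i < brank B \<Longrightarrow> smooth_fun_on M (U \<inter> \<phi> -` V) (c i)"
    "\<And>p. p \<in> U \<Longrightarrow> \<phi> p \<in> V \<Longrightarrow> s p = (\<Sum>i<brank B. c i p *\<^sub>R e i (\<phi> p))" by blast
  then show "\<exists>c. (\<forall>i<brank B. smooth_fun_on M (U \<inter> \<phi> -` V) (c i)) \<and>
     (\<forall>p\<in>U. \<phi> p \<in> V \<longrightarrow> t p = (\<Sum>i<brank B. c i p *\<^sub>R e i (\<phi> p)))"
    using assms(2) by (intro exI[of _ c]) simp
qed

lemma smooth_along_zero: "smooth_along B M \<phi> U (\<lambda>_. 0)"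
  by (rule smooth_alongI) (auto intro!: exI[of _ "\<lambda>_ _. 0"] smooth_fun_on_const[OF M])

lemma smooth_along_add:
  assumes "smooth_along B M \<phi> U s" "smooth_along B M \<phi> U t"
  shows "smooth_along B M \<phi> U (\<lambda>p. s p + t p)"
proof (rule smooth_alongI)
  fix V e assume V: "(V, e) \<in> frames B"
  from smooth_alongE[OF assms(1) V] obtain c where
    c: "\<And>i. i < brank B \<Longrightarrow> smooth_fun_on M (U \<inter> \<phi> -` V) (c i)"
    "\<And>p. p \<in> U \<Longrightarrow> \<phi> p \<in> V \<Longrightarrow> s p = (\<Sum>i<brank B. c i p *\<^sub>R e i (\<phi> p))" by blast
  from smooth_alongE[OF assms(2) V] obtain d where
    d: "\<And>i. i < brank B \<Longrightarrow> smooth_fun_on M (U \<inter> \<phi> -` V) (d i)"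
    "\<And>p. p \<in> U \<Longrightarrow> \<phi> p \<in> V \<Longrightarrow> t p = (\<Sum>i<brank B. d i p *\<^sub>R e i (\<phi> p))" by blast
  show "\<exists>c. (\<forall>i<brank B. smooth_fun_on M (U \<inter> \<phi> -` V) (c i)) \<and>
     (\<forall>p\<in>U. \<phi> p \<in> V \<longrightarrow> s p + t p = (\<Sum>i<brank B. c i p *\<^sub>R e i (\<phi> p)))"
    using c d by (intro exI[of _ "\<lambda>i p. c i p + d i p"])
      (auto simp: scaleR_left_distrib sum.distrib intro: smooth_fun_on_add[OF M])
qed

lemma smooth_along_scale:
  assumes "smooth_fun_on M U f" "smooth_along B M \<phi> U s"
  shows "smooth_along B M \<phi> U (\<lambda>p. f p *\<^sub>R s p)"
proof (rule smooth_alongI)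
  fix V e assume "(V, e) \<in> frames B"
  from smooth_alongE[OF assms(2) this] obtain c where
    c: "\<And>i. i < brank B \<Longrightarrow> smooth_fun_on M (U \<inter> \<phi> -` V) (c i)"
    "\<And>p. p \<in> U \<Longrightarrow> \<phi> p \<in> V \<Longrightarrow> s p = (\<Sum>i<brank B. c i p *\<^sub>R e i (\<phi> p))" by blast
  have f: "smooth_fun_on M (U \<inter> \<phi> -` V) f"
    using smooth_fun_on_subset[OF M assms(1)] by blast
  show "\<exists>c. (\<forall>i<brank B. smooth_fun_on M (U \<inter> \<phi> -` V) (c i)) \<and>
     (\<forall>p\<in>U. \<phi> p \<in> V \<longrightarrow> f p *\<^sub>R s p = (\<Sum>i<brank B. c i p *\<^sub>R e i (\<phi> p)))"
    using c by (intro exI[of _ "\<lambda>i p. f p * c i p"])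
      (auto simp: scaleR_sum_right intro: smooth_fun_on_mult[OF M f])
qed

lemma smooth_along_sum:
  "(\<And>i. i \<in> I \<Longrightarrow> smooth_along B M \<phi> U (s i)) \<Longrightarrow> smooth_along B M \<phi> U (\<lambda>p. \<Sum>i\<in>I. s i p)"
  by (induction I rule: infinite_finite_induct) (auto intro: smooth_along_add smooth_along_zero)

end

text \<open>A smooth section of the dual bundle, with linearity demanded only inside the fibres.
  Both \<open>\<lambda>p v. \<rho> p v f\<close> for an anchor \<open>\<rho>\<close> and a fixed
  smooth \<open>f\<close>, and the components \<open>l (F p v)\<close> of a bundle map, are of this
  kind.\<close>

definition smooth_functional ::
  "('m, 'v::real_vector) vbundle \<Rightarrow> ('m \<Rightarrow> 'v \<Rightarrow> real) \<Rightarrow> bool" where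
  "smooth_functional B \<phi> \<longleftrightarrow>
     (\<forall>p. \<forall>v\<in>fibre B p. \<forall>w\<in>fibre B p. \<phi> p (v + w) = \<phi> p v + \<phi> p w) \<and>
     (\<forall>p c. \<forall>v\<in>fibre B p. \<phi> p (c *\<^sub>R v) = c * \<phi> p v) \<and>
     (\<forall>(V, e)\<in>frames B. \<forall>i<brank B. smooth_fun_on (base B) V (\<lambda>p. \<phi> p (e i p)))"

lemma smooth_functional_sum:
  assumes "smooth_functional B \<phi>" "subspace (fibre B p)" "\<And>i. i \<in> I \<Longrightarrow> f i \<in> fibre B p"
  shows "\<phi> p (\<Sum>i\<in>I. a i *\<^sub>R f i) = (\<Sum>i\<in>I. a i * \<phi> p (f i))"
  using assms(3)
proof (induction I rule: infinite_finite_induct)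
  case (insert i I)
  have "(\<Sum>i\<in>I. a i *\<^sub>R f i) \<in> fibre B p" "a i *\<^sub>R f i \<in> fibre B p"
    using insert assms(2) by (auto intro!: subspace_sum subspace_scale)
  with insert assms(1) show ?case by (simp add: smooth_functional_def)
next
  case empty
  have "0 \<in> fibre B p" using assms(2) subspace_0 by blast
  then have "\<phi> p (0 *\<^sub>R 0) = 0 * \<phi> p 0" using assms(1) unfolding smooth_functional_def by blast
  then show ?case by simp
next
  case (infinite I)
  have "0 \<in> fibre B p" using assms(2) subspace_0 by blast
  then have "\<phi> p (0 *\<^sub>R 0) = 0 * \<phi> p 0" using assms(1) unfolding smooth_functional_def by blast
  with infinite show ?case by simp
qed

context
  fixes B :: "('m, 'v::real_vector) vbundle"
  assumes B: "vector_bundle B"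
begin

lemma vector_bundle_manifold: "smooth_manifold (base B)"
  and vector_bundle_subspace: "subspace (fibre B p)"
  using B by (auto simp: vector_bundle_def)

lemma vector_bundle_frameD:
  assumes "(V, e) \<in> frames B"
  shows "openin (mtop (base B)) V" "i < brank B \<Longrightarrow> smooth_section_on B V (e i)"
    "p \<in> V \<Longrightarrow> basis_family {..<brank B} (\<lambda>i. e i p) (fibre B p)"
proof -
  have "openin (mtop (base B)) V \<and> frame_on B V e \<and> (\<forall>i<brank B. smooth_section_on B V (e i))"
    using B assms unfolding vector_bundle_def by blast
  then show "openin (mtop (base B)) V" "i < brank B \<Longrightarrow> smooth_section_on B V (e i)"
    "p \<in> V \<Longrightarrow> basis_family {..<brank B} (\<lambda>i. e i p) (fibre B p)"
    using vector_bundle_subspace[of p] by (auto simp: frame_on_def basis_family_iff)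
qed

lemma vector_bundle_frame_at:
  obtains V e where "(V, e) \<in> frames B" "p \<in> V"
proof -
  have "p \<in> \<Union>(fst ` frames B)" using B by (simp add: vector_bundle_def)
  then show ?thesis using that by auto
qed

text \<open>Smoothness is tested in all frames, but components in a single frame suffice: that the
  fields of this frame are smooth with respect to all others is part of
  \<open>vector_bundle\<close>.\<close>

lemma smooth_section_on_frameI:
  assumes V: "(V, e) \<in> frames B" and U: "U \<subseteq> V"
    and c: "\<And>i. i < brank B \<Longrightarrow> smooth_fun_on (base B) U (c i)"
    and s: "\<And>p. p \<in> U \<Longrightarrow> s p = (\<Sum>i<brank B. c i p *\<^sub>R e i p)"
  shows "smooth_section_on B U s"
proof -
  note M = vector_bundle_manifold
  have "smooth_section_on B U (e i)" if "i < brank B" for i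
    using smooth_along_subset[OF M vector_bundle_frameD(2)[OF V that] U] .
  then have "smooth_section_on B U (\<lambda>p. \<Sum>i<brank B. c i p *\<^sub>R e i p)"
    using c by (auto intro!: smooth_along_sum[OF M] smooth_along_scale[OF M])
  then show ?thesis using s by (auto elim: smooth_along_cong[OF M])
qed

lemma smooth_section_on_locally:
  assumes U: "openin (mtop (base B)) U"
    and loc: "\<And>p. p \<in> U \<Longrightarrow> \<exists>T. openin (mtop (base B)) T \<and> p \<in> T \<and> smooth_section_on B (U \<inter> T) s"
  shows "smooth_section_on B U s"
proof (rule smooth_alongI)
  note M = vector_bundle_manifold
  fix V e assume V: "(V, e) \<in> frames B"
  have ex: "\<exists>a. s p = (\<Sum>i<brank B. a i *\<^sub>R e i p)" if "p \<in> U" "p \<in> V" for p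
    using loc[OF that(1)] smooth_section_onE[OF _ V] that by (metis IntI)
  \<comment> \<open>The components are chosen pointwise on \<open>U\<close> and \<open>V\<close>;
    locally they agree with smooth ones because the frame is a basis of each fibre.\<close>
  define c where "c i p = (SOME a. s p = (\<Sum>i<brank B. a i *\<^sub>R e i p)) i" for i p
  have c: "s p = (\<Sum>i<brank B. c i p *\<^sub>R e i p)" if "p \<in> U" "p \<in> V" for p
    unfolding c_def using ex[OF that] by (rule someI_ex)
  have "smooth_fun_on (base B) (U \<inter> V) (c i)" if i: "i < brank B" for i
  proof (rule smooth_fun_on_locally[OF M])
    show UV: "openin (mtop (base B)) (U \<inter> V)"
      using U vector_bundle_frameD(1)[OF V] by blast
    fix p assume p: "p \<in> U \<inter> V"
    then obtain T where T: "openin (mtop (base B)) T" "p \<in> T" "smooth_section_on B (U \<inter> T) s"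
      using loc by blast
    from smooth_section_onE[OF T(3) V] obtain d where
      d: "\<And>i. i < brank B \<Longrightarrow> smooth_fun_on (base B) (U \<inter> T \<inter> V) (d i)"
      "\<And>p. p \<in> U \<inter> T \<Longrightarrow> p \<in> V \<Longrightarrow> s p = (\<Sum>i<brank B. d i p *\<^sub>R e i p)" by blast
    have eq: "d i q = c i q" if "q \<in> U \<inter> V \<inter> T" for q
    proof -
      have sums: "(\<Sum>i<brank B. d i q *\<^sub>R e i q) = (\<Sum>i<brank B. c i q *\<^sub>R e i q)"
        using c[of q] d(2)[of q] that by simp
      have bas: "basis_family {..<brank B} (\<lambda>i. e i q) (fibre B q)"
        using vector_bundle_frameD(3)[OF V] that by blast
      show ?thesis
        by (rule basis_family_unique[OF bas sums]) (simp add: i)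
    qed
    have "U \<inter> T \<inter> V = U \<inter> V \<inter> T" by blast
    then have di: "smooth_fun_on (base B) (U \<inter> V \<inter> T) (d i)"
      using d(1)[OF i] by metis
    have "smooth_fun_on (base B) (U \<inter> V \<inter> T) (c i)"
      by (rule smooth_fun_on_cong[OF M openin_Int[OF UV T(1)] eq di])
    with T show "\<exists>T. openin (mtop (base B)) T \<and> p \<in> T \<and> smooth_fun_on (base B) (U \<inter> V \<inter> T) (c i)"
      by blast
  qed
  with c show "\<exists>c. (\<forall>i<brank B. smooth_fun_on (base B) (U \<inter> id -` V) (c i)) \<and>
     (\<forall>p\<in>U. id p \<in> V \<longrightarrow> s p = (\<Sum>i<brank B. c i p *\<^sub>R e i (id p)))"
    by (intro exI[of _ c]) simp
qed

text \<open>In a local frame the value is the sum of the components of \<open>s\<close> times the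
  values of the functional on the frame fields, and all of these are smooth.\<close>

lemma smooth_functional_section:
  assumes \<phi>: "smooth_functional B \<phi>" and U: "openin (mtop (base B)) U"
    and s: "smooth_section_on B U s"
  shows "smooth_fun_on (base B) U (\<lambda>p. \<phi> p (s p))"
proof (rule smooth_fun_on_locally[OF vector_bundle_manifold U])
  note M = vector_bundle_manifold
  fix p assume "p \<in> U"
  obtain V e where V: "(V, e) \<in> frames B" "p \<in> V" using vector_bundle_frame_at .
  have op: "openin (mtop (base B)) V" using vector_bundle_frameD(1)[OF V(1)] .
  from smooth_section_onE[OF s V(1)] obtain c where
    c: "\<And>i. i < brank B \<Longrightarrow> smooth_fun_on (base B) (U \<inter> V) (c i)"
    "\<And>p. p \<in> U \<Longrightarrow> p \<in> V \<Longrightarrow> s p = (\<Sum>i<brank B. c i p *\<^sub>R e i p)" by blast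
  have "smooth_fun_on (base B) V (\<lambda>p. \<phi> p (e i p))" if "i < brank B" for i
    using \<phi> V(1) that unfolding smooth_functional_def by blast
  then have "smooth_fun_on (base B) (U \<inter> V) (\<lambda>p. \<phi> p (e i p))" if "i < brank B" for i
    using smooth_fun_on_subset[OF M] that by (meson Int_lower2)
  then have sm: "smooth_fun_on (base B) (U \<inter> V) (\<lambda>p. \<Sum>i<brank B. c i p * \<phi> p (e i p))"
    using c(1) by (auto intro!: smooth_fun_on_sum[OF M] smooth_fun_on_mult[OF M])
  have eq: "(\<Sum>i<brank B. c i p * \<phi> p (e i p)) = \<phi> p (s p)" if "p \<in> U \<inter> V" for p
    using that c(2)[of p] basis_familyD(1)[OF vector_bundle_frameD(3)[OF V(1)]]
    by (subst smooth_functional_sum[OF \<phi> vector_bundle_subspace, symmetric]) auto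
  have "smooth_fun_on (base B) (U \<inter> V) (\<lambda>p. \<phi> p (s p))"
    by (rule smooth_fun_on_cong[OF M openin_Int[OF U op] eq sm])
  with V op show "\<exists>T. openin (mtop (base B)) T \<and> p \<in> T \<and> smooth_fun_on (base B) (U \<inter> T) (\<lambda>p. \<phi> p (s p))"
    by blast
qed

lemma sections_fibre: "s \<in> sections B \<Longrightarrow> s p \<in> fibre B p"
  and sections_smooth: "s \<in> sections B \<Longrightarrow> smooth_section_on B UNIV s"
  by (auto simp: sections_def)

lemma sections_zero: "(\<lambda>_. 0) \<in> sections B"
  using smooth_along_zero[OF vector_bundle_manifold] subspace_0[OF vector_bundle_subspace]
  by (auto simp: sections_def)

lemma sections_add: "s \<in> sections B \<Longrightarrow> t \<in> sections B \<Longrightarrow> (\<lambda>p. s p + t p) \<in> sections B"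
  using smooth_along_add[OF vector_bundle_manifold] subspace_add[OF vector_bundle_subspace]
  by (auto simp: sections_def)

lemma sections_scale:
  "f \<in> smooth_funs (base B) \<Longrightarrow> s \<in> sections B \<Longrightarrow> (\<lambda>p. f p *\<^sub>R s p) \<in> sections B"
  using smooth_along_scale[OF vector_bundle_manifold] subspace_scale[OF vector_bundle_subspace]
  by (auto simp: sections_def smooth_funs_def)

lemma sections_scaleR: "s \<in> sections B \<Longrightarrow> (\<lambda>p. c *\<^sub>R s p) \<in> sections B"
  using sections_scale[of "\<lambda>_. c" s] smooth_fun_on_const[OF vector_bundle_manifold]
  by (simp add: smooth_funs_def)

lemma sections_uminus: "s \<in> sections B \<Longrightarrow> (\<lambda>p. - s p) \<in> sections B"
  using sections_scaleR[of s "-1"] by simp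

lemma sections_diff: "s \<in> sections B \<Longrightarrow> t \<in> sections B \<Longrightarrow> (\<lambda>p. s p - t p) \<in> sections B"
  using sections_add[OF _ sections_uminus] by simp

lemma sections_sum:
  "(\<And>i. i \<in> I \<Longrightarrow> s i \<in> sections B) \<Longrightarrow> (\<lambda>p. \<Sum>i\<in>I. s i p) \<in> sections B"
  by (induction I rule: infinite_finite_induct) (auto intro: sections_add sections_zero)

end


section \<open>Smoothness of coefficients\<close>

text \<open>
  Gaussian elimination: the last vector has a component that does not vanish near \<open>p\<close>; subtracting
  multiples of it removes it from the system.
\<close>

lemma smooth_linear_system_at:
  fixes W :: "nat \<Rightarrow> nat \<Rightarrow> 'm \<Rightarrow> real"
  assumes M: "smooth_manifold M" and U: "openin (mtop M) U" "p \<in> U"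
    and W: "\<And>j m. j < k \<Longrightarrow> m < r \<Longrightarrow> smooth_fun_on M U (W j m)"
    and T: "\<And>m. m < r \<Longrightarrow> smooth_fun_on M U (T m)"
    and eq: "\<And>q m. q \<in> U \<Longrightarrow> m < r \<Longrightarrow> T m q = (\<Sum>j<k. c j q * W j m q)"
    and ind: "\<And>a. (\<forall>m<r. (\<Sum>j<k. a j * W j m p) = 0) \<Longrightarrow> (\<forall>j<k. a j = (0::real))"
  shows "\<exists>U'. openin (mtop M) U' \<and> p \<in> U' \<and> U' \<subseteq> U \<and> (\<forall>j<k. smooth_fun_on M U' (c j))"
  using U W T eq ind
proof (induction k arbitrary: U W T)
  case 0
  then show ?case by auto
next
  case (Suc k)
  \<comment> \<open>If every component of the last vector vanished at \<open>p\<close>, coefficient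
    1 at \<open>k\<close> and 0 elsewhere would be a nontrivial relation.\<close>
  have "\<exists>m0<r. W k m0 p \<noteq> 0"
  proof (rule ccontr)
    assume "\<not> ?thesis"
    then have "\<forall>m<r. (\<Sum>j<Suc k. (if j = k then 1 else 0) * W j m p) = 0"
      by (auto intro!: sum.neutral)
    from Suc.prems(6)[OF this] show False by auto
  qed
  then obtain m0 where m0: "m0 < r" "W k m0 p \<noteq> 0" by blast
  let ?U = "{q \<in> U. W k m0 q \<noteq> 0}"
  have Wk: "smooth_fun_on M U (W k m)" if "m < r" for m
    using Suc.prems(3) that by simp
  have U': "openin (mtop M) ?U"
    using openin_smooth_nonzero[OF M Suc.prems(1) Wk[OF m0(1)]] .
  have sub: "smooth_fun_on M ?U f" if "smooth_fun_on M U f" for f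
    by (rule smooth_fun_on_subset[OF M that]) blast
  let ?W = "\<lambda>j m q. W j m q - (W j m0 q / W k m0 q) * W k m q"
  let ?T = "\<lambda>m q. T m q - (T m0 q / W k m0 q) * W k m q"
  have "\<exists>U'. openin (mtop M) U' \<and> p \<in> U' \<and> U' \<subseteq> ?U \<and> (\<forall>j<k. smooth_fun_on M U' (c j))"
  proof (rule Suc.IH)
    show "openin (mtop M) ?U" by fact
    show "p \<in> ?U" using m0 Suc.prems by simp
    show "smooth_fun_on M ?U (?W j m)" if "j < k" "m < r" for j m
      using that m0(1) Suc.prems(3) Wk
      by (intro smooth_fun_on_diff[OF M] smooth_fun_on_mult[OF M] smooth_fun_on_divide[OF M] sub) auto
    show "smooth_fun_on M ?U (?T m)" if "m < r" for m
      using that m0(1) Suc.prems(4) Wk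
      by (intro smooth_fun_on_diff[OF M] smooth_fun_on_mult[OF M] smooth_fun_on_divide[OF M] sub) auto
    show "?T m q = (\<Sum>j<k. c j q * ?W j m q)" if q: "q \<in> ?U" and m: "m < r" for q m
    proof -
      have T1: "T m q = (\<Sum>j<k. c j q * W j m q) + c k q * W k m q"
        using Suc.prems(5)[of q m] q m by simp
      have T0: "T m0 q / W k m0 q = (\<Sum>j<k. c j q * (W j m0 q / W k m0 q)) + c k q"
        using Suc.prems(5)[of q m0] q m0(1) by (simp add: add_divide_distrib sum_divide_distrib)
      show ?thesis
        unfolding T1 T0
        by (simp add: algebra_simps sum_subtractf sum_distrib_left sum_distrib_right)
    qed
    show "\<forall>j<k. a j = 0" if a: "\<forall>m<r. (\<Sum>j<k. a j * ?W j m p) = 0" for a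
    proof -
      \<comment> \<open>A relation between the reduced vectors lifts to one between the original
        vectors; the coefficient of the pivot vector collects the multiples that were
        subtracted.\<close>
      define a' where "a' j = (if j = k then - (\<Sum>j<k. a j * (W j m0 p / W k m0 p)) else a j)" for j
      have "(\<Sum>j<Suc k. a' j * W j m p) = 0" if m: "m < r" for m
      proof -
        have "(\<Sum>j<Suc k. a' j * W j m p) = (\<Sum>j<k. a j * W j m p) + a' k * W k m p"
          by (simp add: a'_def)
        also have "\<dots> = (\<Sum>j<k. a j * ?W j m p)"
          by (simp add: a'_def algebra_simps sum_subtractf sum_distrib_left sum_distrib_right)
        finally show ?thesis using a m by simp
      qed
      then have "\<forall>j<Suc k. a' j = 0" using Suc.prems(6)[of a'] by blast
      then show ?thesis by (metis a'_def less_Suc_eq less_irrefl_nat)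
    qed
  qed
  then obtain U2 where U2: "openin (mtop M) U2" "p \<in> U2" "U2 \<subseteq> ?U"
    "\<forall>j<k. smooth_fun_on M U2 (c j)" by blast
  have sub2: "smooth_fun_on M U2 f" if "smooth_fun_on M U f" for f
    by (rule smooth_fun_on_subset[OF M that]) (use U2(3) in blast)
  \<comment> \<open>Back substitution: the pivot equation \<open>m0\<close> expresses the last
    unknown through the others, which are already smooth.\<close>
  have sm: "smooth_fun_on M U2 (\<lambda>q. (T m0 q - (\<Sum>j<k. c j q * W j m0 q)) / W k m0 q)"
  proof (intro smooth_fun_on_divide[OF M] smooth_fun_on_diff[OF M] smooth_fun_on_sum[OF M]
      smooth_fun_on_mult[OF M])
    show "smooth_fun_on M U2 (T m0)" "smooth_fun_on M U2 (W k m0)"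
      using sub2 Suc.prems(3,4) m0 by auto
    show "smooth_fun_on M U2 (c j)" if "j \<in> {..<k}" for j using U2(4) that by simp
    show "smooth_fun_on M U2 (W j m0)" if "j \<in> {..<k}" for j
      using sub2 Suc.prems(3) m0(1) that by simp
    show "W k m0 q \<noteq> 0" if "q \<in> U2" for q using U2(3) that by auto
  qed
  have eqk: "(T m0 q - (\<Sum>j<k. c j q * W j m0 q)) / W k m0 q = c k q" if "q \<in> U2" for q
    using Suc.prems(5)[of q m0] m0(1) U2(3) that by auto
  have "smooth_fun_on M U2 (c k)"
    by (rule smooth_fun_on_cong[OF M U2(1) eqk sm])
  then have "\<forall>j<Suc k. smooth_fun_on M U2 (c j)" using U2(4) by (simp add: less_Suc_eq)
  with U2 show ?case by blast
qed

text \<open>Expanding \<open>s\<close> and all \<open>w j\<close> in an ambient frame gives one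
  equation for each of the \<open>brank B\<close> components, but only \<open>k\<close> unknowns.
  Independence of the \<open>w j\<close> at each point allows the system to be solved smoothly near
  that point.\<close>

lemma smooth_coefficients:
  fixes k :: nat
  assumes B: "vector_bundle B" and U: "openin (mtop (base B)) U"
    and w: "\<And>j. j < k \<Longrightarrow> smooth_section_on B U (w j)"
    and ind: "\<And>q. q \<in> U \<Longrightarrow> basis_family {..<k} (\<lambda>j. w j q) (S q)"
    and s: "smooth_section_on B U s" "\<And>q. q \<in> U \<Longrightarrow> s q = (\<Sum>j<k. c j q *\<^sub>R w j q)"
    and l: "l < k"
  shows "smooth_fun_on (base B) U (c l)"
proof (rule smooth_fun_on_locally[OF vector_bundle_manifold[OF B] U])
  note M = vector_bundle_manifold[OF B]
  fix p assume p: "p \<in> U"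
  obtain V e where V: "(V, e) \<in> frames B" "p \<in> V" using vector_bundle_frame_at[OF B] .
  have op: "openin (mtop (base B)) (U \<inter> V)" using vector_bundle_frameD(1)[OF B V(1)] U by blast
  have bas: "basis_family {..<brank B} (\<lambda>i. e i q) (fibre B q)" if "q \<in> V" for q
    using vector_bundle_frameD(3)[OF B V(1) that] .
  have "\<exists>W. (\<forall>m<brank B. smooth_fun_on (base B) (U \<inter> V) (W m)) \<and>
      (\<forall>q\<in>U \<inter> V. w j q = (\<Sum>m<brank B. W m q *\<^sub>R e m q))" if "j < k" for j
    using w[OF that] V(1) unfolding smooth_along_def by fastforce
  then obtain W where W: "\<And>j m. j < k \<Longrightarrow> m < brank B \<Longrightarrow> smooth_fun_on (base B) (U \<inter> V) (W j m)"
      "\<And>j q. j < k \<Longrightarrow> q \<in> U \<inter> V \<Longrightarrow> w j q = (\<Sum>m<brank B. W j m q *\<^sub>R e m q)"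
    by metis
  from smooth_section_onE[OF s(1) V(1)] obtain T where
    T: "\<And>m. m < brank B \<Longrightarrow> smooth_fun_on (base B) (U \<inter> V) (T m)"
    "\<And>q. q \<in> U \<Longrightarrow> q \<in> V \<Longrightarrow> s q = (\<Sum>m<brank B. T m q *\<^sub>R e m q)" by blast
  have comb: "(\<Sum>j<k. a j *\<^sub>R w j q) = (\<Sum>m<brank B. (\<Sum>j<k. a j * W j m q) *\<^sub>R e m q)"
    if "q \<in> U \<inter> V" for a q
  proof -
    have "(\<Sum>j<k. a j *\<^sub>R w j q) = (\<Sum>j<k. \<Sum>m<brank B. (a j * W j m q) *\<^sub>R e m q)"
      using W(2) that by (simp add: scaleR_sum_right)
    also have "\<dots> = (\<Sum>m<brank B. \<Sum>j<k. (a j * W j m q) *\<^sub>R e m q)"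
      by (rule sum.swap)
    finally show ?thesis by (simp add: scaleR_sum_left)
  qed
  have "\<exists>U'. openin (mtop (base B)) U' \<and> p \<in> U' \<and> U' \<subseteq> U \<inter> V \<and>
      (\<forall>j<k. smooth_fun_on (base B) U' (c j))"
  proof (rule smooth_linear_system_at[OF M op, where W = W and T = T and r = "brank B"])
    show "p \<in> U \<inter> V" using p V by simp
    show "smooth_fun_on (base B) (U \<inter> V) (W j m)" if "j < k" "m < brank B" for j m
      using W(1) that .
    show "smooth_fun_on (base B) (U \<inter> V) (T m)" if "m < brank B" for m
      using T(1) that .
    show "T m q = (\<Sum>j<k. c j q * W j m q)" if q: "q \<in> U \<inter> V" and m: "m < brank B" for q m
    proof -
      have eq: "(\<Sum>m<brank B. T m q *\<^sub>R e m q) = (\<Sum>m<brank B. (\<Sum>j<k. c j q * W j m q) *\<^sub>R e m q)"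
        using comb[OF q, of "\<lambda>j. c j q"] s(2)[of q] T(2)[of q] q by simp
      show ?thesis
        by (rule basis_family_unique[OF bas eq]) (use q m in auto)
    qed
    show "\<forall>j<k. a j = 0" if a: "\<forall>m<brank B. (\<Sum>j<k. a j * W j m p) = 0" for a
    proof -
      have "(\<Sum>j<k. a j *\<^sub>R w j p) = 0"
        using comb[of p a] p V a by simp
      from basis_familyD(2)[OF ind[OF p] this] show ?thesis by simp
    qed
  qed
  then obtain U' where U': "openin (mtop (base B)) U'" "p \<in> U'" "U' \<subseteq> U \<inter> V"
    "\<forall>j<k. smooth_fun_on (base B) U' (c j)" by blast
  have "U \<inter> U' = U'" using U' by blast
  with U' l show "\<exists>T. openin (mtop (base B)) T \<and> p \<in> T \<and> smooth_fun_on (base B) (U \<inter> T) (c l)"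
    by (intro exI[of _ U']) simp
qed


section \<open>Kernels of linear functionals\<close>

text \<open>One step of elimination: each vector is corrected by the multiple of the pivot
  \<open>f j\<close> that moves it into the kernel, and the pivot itself is dropped.\<close>

lemma basis_family_kernel:
  fixes \<phi> :: "'v::real_vector \<Rightarrow> real"
  assumes fin: "finite I" and bas: "basis_family I f S" and S: "subspace S"
    and add: "\<And>v w. v \<in> S \<Longrightarrow> w \<in> S \<Longrightarrow> \<phi> (v + w) = \<phi> v + \<phi> w"
    and scale: "\<And>c v. v \<in> S \<Longrightarrow> \<phi> (c *\<^sub>R v) = c * \<phi> v"
    and j: "j \<in> I" "\<phi> (f j) \<noteq> 0"
  shows "basis_family (I - {j}) (\<lambda>i. f i - (\<phi> (f i) / \<phi> (f j)) *\<^sub>R f j) {v \<in> S. \<phi> v = 0}"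
    (is "basis_family _ ?f _")
proof -
  have S0: "0 \<in> S" using S subspace_0 by blast
  have \<phi>0: "\<phi> 0 = 0" using scale[OF S0, of 0] by simp
  have \<phi>sum: "\<phi> (\<Sum>i\<in>J. a i *\<^sub>R f i) = (\<Sum>i\<in>J. a i * \<phi> (f i))" if "J \<subseteq> I" for J a
    using finite_subset[OF that fin] that
  proof (induction J)
    case (insert i J)
    have "(\<Sum>i\<in>J. a i *\<^sub>R f i) \<in> S" "a i *\<^sub>R f i \<in> S" "f i \<in> S"
      using insert.prems basis_familyD(1)[OF bas] S by (auto intro!: subspace_sum subspace_scale)
    then show ?case using insert add scale by auto
  qed (simp add: \<phi>0)
  \<comment> \<open>In terms of the original family only the coefficient of the pivot changes; this
    single identity serves for both independence and spanning.\<close>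
  have expand: "(\<Sum>i\<in>I - {j}. a i *\<^sub>R ?f i) =
      (\<Sum>i\<in>I. (if i = j then - (\<Sum>i\<in>I - {j}. a i * (\<phi> (f i) / \<phi> (f j))) else a i) *\<^sub>R f i)" for a
  proof -
    have "(\<Sum>i\<in>I - {j}. a i *\<^sub>R ?f i)
        = (\<Sum>i\<in>I - {j}. a i *\<^sub>R f i) - (\<Sum>i\<in>I - {j}. a i * (\<phi> (f i) / \<phi> (f j))) *\<^sub>R f j"
      by (simp add: scaleR_diff_right sum_subtractf scaleR_sum_left)
    also have "(\<Sum>i\<in>I - {j}. a i *\<^sub>R f i) =
        (\<Sum>i\<in>I - {j}. (if i = j then - (\<Sum>i\<in>I - {j}. a i * (\<phi> (f i) / \<phi> (f j))) else a i) *\<^sub>R f i)"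
      by (rule sum.cong) auto
    finally show ?thesis by (subst sum.remove[OF fin j(1)]) simp
  qed
  show ?thesis
    unfolding basis_family_def
  proof (intro conjI ballI allI impI)
    fix i assume i: "i \<in> I - {j}"
    have fS: "f i \<in> S" "f j \<in> S" using i j basis_familyD(1)[OF bas] by auto
    have "\<phi> (f i + (- (\<phi> (f i) / \<phi> (f j))) *\<^sub>R f j) = \<phi> (f i) + - (\<phi> (f i) / \<phi> (f j)) * \<phi> (f j)"
      using add scale fS S subspace_scale by metis
    also have "\<dots> = 0" using j by simp
    finally have "\<phi> (?f i) = 0" by simp
    moreover have "?f i \<in> S" using fS S by (intro subspace_diff subspace_scale)
    ultimately show "?f i \<in> {v \<in> S. \<phi> v = 0}" by simp
  next
    fix a i assume "(\<Sum>i\<in>I - {j}. a i *\<^sub>R ?f i) = 0" and i: "i \<in> I - {j}"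
    then have "(\<Sum>i\<in>I. (if i = j then - (\<Sum>i\<in>I - {j}. a i * (\<phi> (f i) / \<phi> (f j))) else a i) *\<^sub>R f i) = 0"
      by (simp only: expand)
    from basis_familyD(2)[OF bas this, of i] i show "a i = 0" by auto
  next
    fix v assume v: "v \<in> {v \<in> S. \<phi> v = 0}"
    then obtain a where a: "v = (\<Sum>i\<in>I. a i *\<^sub>R f i)" using basis_familyD(3)[OF bas, of v] by auto
    have "0 = (\<Sum>i\<in>I. a i * \<phi> (f i))" using \<phi>sum[of I a] a v by simp
    also have "\<dots> = a j * \<phi> (f j) + (\<Sum>i\<in>I - {j}. a i * \<phi> (f i))"
      by (rule sum.remove[OF fin j(1)])
    \<comment> \<open>Lying in the kernel forces the coefficient of the pivot to be the one produced
      by \<open>expand\<close>, so the other coefficients of \<open>v\<close> can be kept.\<close>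
    finally have "a j = - (\<Sum>i\<in>I - {j}. a i * \<phi> (f i)) / \<phi> (f j)"
      using j(2) by (simp add: field_simps)
    then have "a j = - (\<Sum>i\<in>I - {j}. a i * (\<phi> (f i) / \<phi> (f j)))"
      by (simp add: sum_divide_distrib)
    then have "(\<Sum>i\<in>I - {j}. a i *\<^sub>R ?f i) = (\<Sum>i\<in>I. (if i = j then a j else a i) *\<^sub>R f i)"
      by (simp only: expand)
    also have "\<dots> = v" unfolding a by (rule sum.cong) auto
    finally show "\<exists>a. v = (\<Sum>i\<in>I - {j}. a i *\<^sub>R ?f i)" by (intro exI[of _ a]) (rule sym)
  qed
qed

text \<open>The functionals are imposed one at a time, each costing one frame vector and shrinking
  the neighbourhood to where the pivot is nonzero. Joint surjectivity at \<open>p\<close> supplies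
  the pivots. The index set is an arbitrary finite set of numbers because the deleted index depends
  on the pivot; it is renumbered later.\<close>

lemma kernel_frame_at:
  fixes B :: "('m, 'v::real_vector) vbundle"
  assumes B: "vector_bundle B"
    and \<phi>: "\<And>l. l < k \<Longrightarrow> smooth_functional B (\<phi> l)"
    and surj: "\<And>t. \<exists>v\<in>fibre B p. \<forall>l<k. \<phi> l p v = t l"
  shows "\<exists>U (I :: nat set) e. openin (mtop (base B)) U \<and> p \<in> U \<and> finite I \<and> card I + k = brank B \<and>
     (\<forall>i\<in>I. smooth_section_on B U (e i)) \<and>
     (\<forall>q\<in>U. basis_family I (\<lambda>i. e i q) {v \<in> fibre B q. \<forall>l<k. \<phi> l q v = 0})"
  using \<phi> surj
proof (induction k)
  case 0
  obtain V e where V: "(V, e) \<in> frames B" "p \<in> V" using vector_bundle_frame_at[OF B] .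
  show ?case
    by (intro exI[of _ V] exI[of _ "{..<brank B}"] exI[of _ e] conjI ballI)
      (use vector_bundle_frameD[OF B V(1)] V(2) in \<open>simp_all del: id_apply\<close>)
next
  case (Suc k)
  note M = vector_bundle_manifold[OF B]
  let ?K = "\<lambda>q. {v \<in> fibre B q. \<forall>l<k. \<phi> l q v = 0}"
  have surj: "\<exists>v\<in>fibre B p. \<forall>l<k. \<phi> l p v = t l" for t
    using Suc.prems(2)[of t] less_SucI by blast
  have "\<exists>U (I :: nat set) e. openin (mtop (base B)) U \<and> p \<in> U \<and> finite I \<and> card I + k = brank B \<and>
      (\<forall>i\<in>I. smooth_section_on B U (e i)) \<and> (\<forall>q\<in>U. basis_family I (\<lambda>i. e i q) (?K q))"
    by (rule Suc.IH[OF Suc.prems(1) surj]) simp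
  then obtain U and I :: "nat set" and e where U: "openin (mtop (base B)) U" "p \<in> U"
    and I: "finite I" "card I + k = brank B" and e: "\<forall>i\<in>I. smooth_section_on B U (e i)"
    and bas: "\<forall>q\<in>U. basis_family I (\<lambda>i. e i q) (?K q)"
    by blast
  have \<phi>k: "smooth_functional B (\<phi> k)" using Suc.prems(1) by simp
  have eK: "e i q \<in> ?K q" if "i \<in> I" "q \<in> U" for i q
    using basis_familyD(1)[OF bas[rule_format, OF that(2)] that(1)] .
  have lin: "\<phi> l q (v + w) = \<phi> l q v + \<phi> l q w" "\<phi> l q (c *\<^sub>R v) = c * \<phi> l q v"
    if "l < Suc k" "v \<in> fibre B q" "w \<in> fibre B q" for l q v w c
    using Suc.prems(1)[OF that(1)] that(2,3) unfolding smooth_functional_def by blast+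
  have K: "subspace (?K q)" for q
  proof (rule subspaceI)
    have z: "0 \<in> fibre B q" using vector_bundle_subspace[OF B] subspace_0 by blast
    have "\<phi> l q 0 = 0" if "l < k" for l using lin(2)[of l 0 q 0 0] z that by simp
    with z show "0 \<in> ?K q" by simp
    show "x + y \<in> ?K q" if "x \<in> ?K q" "y \<in> ?K q" for x y
      using that lin(1) subspace_add[OF vector_bundle_subspace[OF B]] by auto
    show "c *\<^sub>R x \<in> ?K q" if "x \<in> ?K q" for x c
      using that lin(2) subspace_scale[OF vector_bundle_subspace[OF B]] by auto
  qed
  \<comment> \<open>A vector killed by the first \<open>k\<close> functionals but not by the next
    one: it is a combination of the current frame at \<open>p\<close>, so some frame vector must be
    a pivot.\<close>
  obtain v where v: "v \<in> fibre B p" "\<forall>l<Suc k. \<phi> l p v = (if l = k then 1 else 0)"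
    using Suc.prems(2)[of "\<lambda>l. if l = k then 1 else 0"] by blast
  then have "v \<in> ?K p" by auto
  then obtain a where a: "v = (\<Sum>i\<in>I. a i *\<^sub>R e i p)"
    using basis_familyD(3)[OF bas[rule_format, OF U(2)]] by blast
  have "\<phi> k p v = (\<Sum>i\<in>I. a i * \<phi> k p (e i p))"
    unfolding a using eK U by (intro smooth_functional_sum[OF \<phi>k vector_bundle_subspace[OF B]]) auto
  moreover have "\<phi> k p v \<noteq> 0" using v by simp
  ultimately obtain j where j: "j \<in> I" "\<phi> k p (e j p) \<noteq> 0"
    by (metis (no_types, lifting) mult_zero_right sum.neutral)
  have sm: "smooth_fun_on (base B) U (\<lambda>q. \<phi> k q (e i q))" if "i \<in> I" for i
    using smooth_functional_section[OF B \<phi>k U(1)] e that by blast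
  let ?U = "{q \<in> U. \<phi> k q (e j q) \<noteq> 0}"
  have sub: "?U \<subseteq> U" by blast
  have U': "openin (mtop (base B)) ?U" using openin_smooth_nonzero[OF M U(1) sm[OF j(1)]] .
  let ?e = "\<lambda>i q. e i q - (\<phi> k q (e i q) / \<phi> k q (e j q)) *\<^sub>R e j q"
  have "smooth_section_on B ?U (\<lambda>q. e i q + (- (\<phi> k q (e i q) / \<phi> k q (e j q))) *\<^sub>R e j q)"
    if "i \<in> I" for i
    using e that j(1) smooth_fun_on_subset[OF M sm sub]
    by (intro smooth_along_add[OF M] smooth_along_scale[OF M] smooth_fun_on_minus[OF M]
        smooth_fun_on_divide[OF M] smooth_along_subset[OF M _ sub]) auto
  then have e': "\<forall>i\<in>I - {j}. smooth_section_on B ?U (?e i)" by simp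
  have "basis_family (I - {j}) (\<lambda>i. ?e i q) {v \<in> fibre B q. \<forall>l<Suc k. \<phi> l q v = 0}" if q: "q \<in> ?U" for q
  proof -
    have "basis_family (I - {j}) (\<lambda>i. ?e i q) {v \<in> ?K q. \<phi> k q v = 0}"
      using bas q j(1) lin by (intro basis_family_kernel[OF I(1) _ K]) auto
    moreover have "{v \<in> ?K q. \<phi> k q v = 0} = {v \<in> fibre B q. \<forall>l<Suc k. \<phi> l q v = 0}"
      by (auto simp: less_Suc_eq)
    ultimately show ?thesis by simp
  qed
  moreover have "finite (I - {j})" "card (I - {j}) + Suc k = brank B"
    using I j(1) by (auto simp: card_Diff_singleton_if) (metis Suc_pred card_gt_0_iff add_Suc empty_iff)
  moreover have "p \<in> ?U" using U j by simp
  ultimately show ?case using U' e'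
    by (intro exI[of _ ?U] exI[of _ "I - {j}"] exI[of _ ?e]) blast
qed


section \<open>Trivial bundles, sums and kernels\<close>

lemma trivial_bundle_simps [simp]:
  "base (trivial_bundle M) = M"
  "fibre (trivial_bundle M :: ('m, 'h::real_vector) vbundle) p = UNIV"
  "brank (trivial_bundle M :: ('m, 'h) vbundle) = dim (UNIV :: 'h set)"
  by (simp_all add: trivial_bundle_def)

lemma frames_trivial_bundle:
  "(V, e) \<in> frames (trivial_bundle M :: ('m, 'h::real_vector) vbundle) \<longleftrightarrow>
     V = UNIV \<and> (\<exists>b. basis_family {..<dim (UNIV :: 'h set)} b (UNIV :: 'h set) \<and> e = (\<lambda>i _. b i))"
  by (auto simp: trivial_bundle_def basis_family_iff)

text \<open>Every linear functional is a constant combination of the coordinates in a basis, and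
  these coordinates are themselves linear functionals. The right-hand side mentions neither
  \<open>N\<close> nor \<open>\<phi>\<close>, so smoothness passes between the trivial bundle over M
  and the one over the point.\<close>

lemma smooth_along_trivial_iff:
  fixes Y :: "'m \<Rightarrow> 'h::real_vector"
  assumes M: "smooth_manifold M" and fd: "finite_dimensional TYPE('h)" and U: "openin (mtop M) U"
  shows "smooth_along (trivial_bundle N) M \<phi> U Y \<longleftrightarrow>
    (\<forall>l :: 'h \<Rightarrow> real. linear l \<longrightarrow> smooth_fun_on M U (\<lambda>p. l (Y p)))"
proof (intro iffI allI impI)
  fix l :: "'h \<Rightarrow> real" assume Y: "smooth_along (trivial_bundle N) M \<phi> U Y" and l: "linear l"
  obtain b where b: "basis_family {..<dim (UNIV :: 'h set)} b (UNIV :: 'h set)"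
    using finite_dimensional_basis[OF fd] .
  have fr: "(UNIV, \<lambda>i _. b i) \<in> frames (trivial_bundle N :: (_, 'h) vbundle)"
    using b by (auto simp: frames_trivial_bundle)
  obtain c where c: "\<And>i. i < dim (UNIV :: 'h set) \<Longrightarrow> smooth_fun_on M U (c i)"
    "\<And>p. p \<in> U \<Longrightarrow> Y p = (\<Sum>i<dim (UNIV :: 'h set). c i p *\<^sub>R b i)"
    using smooth_alongE[OF Y fr] by auto
  have sm: "smooth_fun_on M U (\<lambda>p. \<Sum>i<dim (UNIV :: 'h set). c i p * l (b i))"
    using c(1) by (intro smooth_fun_on_sum[OF M] smooth_fun_on_mult[OF M] smooth_fun_on_const[OF M]) auto
  have eq: "(\<Sum>i<dim (UNIV :: 'h set). c i p * l (b i)) = l (Y p)" if "p \<in> U" for p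
    using c(2)[OF that] l by (simp add: linear_sum linear_scale)
  show "smooth_fun_on M U (\<lambda>p. l (Y p))"
    by (rule smooth_fun_on_cong[OF M U eq sm])
next
  assume Y: "\<forall>l :: 'h \<Rightarrow> real. linear l \<longrightarrow> smooth_fun_on M U (\<lambda>p. l (Y p))"
  show "smooth_along (trivial_bundle N) M \<phi> U Y"
  proof (rule smooth_alongI)
    fix V e assume "(V, e) \<in> frames (trivial_bundle N :: (_, 'h) vbundle)"
    then obtain b where V: "V = UNIV" and e: "e = (\<lambda>i _. b i)"
      and b: "basis_family {..<dim (UNIV :: 'h set)} b (UNIV :: 'h set)"
      by (auto simp: frames_trivial_bundle)
    obtain \<kappa> :: "nat \<Rightarrow> 'h \<Rightarrow> real" where "\<And>i. i \<in> {..<dim (UNIV :: 'h set)} \<Longrightarrow> linear (\<kappa> i)"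
      "\<And>y. (\<Sum>i<dim (UNIV :: 'h set). \<kappa> i y *\<^sub>R b i) = y"
      using basis_family_coordinates[OF b] by blast
    with Y show "\<exists>c. (\<forall>i<brank (trivial_bundle N :: (_, 'h) vbundle). smooth_fun_on M (U \<inter> \<phi> -` V) (c i)) \<and>
       (\<forall>p\<in>U. \<phi> p \<in> V \<longrightarrow> Y p = (\<Sum>i<brank (trivial_bundle N :: (_, 'h) vbundle). c i p *\<^sub>R e i (\<phi> p)))"
      by (intro exI[of _ "\<lambda>i p. \<kappa> i (Y p)"]) (simp add: V e)
  qed
qed

lemma vector_bundle_trivial:
  assumes "smooth_manifold M" "finite_dimensional TYPE('h::real_vector)"
  shows "vector_bundle (trivial_bundle M :: ('m, 'h) vbundle)"
proof -
  let ?T = "trivial_bundle M :: ('m, 'h) vbundle"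
  obtain b where b: "basis_family {..<dim (UNIV :: 'h set)} b (UNIV :: 'h set)"
    using finite_dimensional_basis[OF assms(2)] .
  then have "(UNIV, \<lambda>i _. b i) \<in> frames ?T" by (auto simp: frames_trivial_bundle)
  then have "\<Union>(fst ` frames ?T) = UNIV" by force
  moreover have "openin (mtop M) U \<and> frame_on ?T U e \<and> (\<forall>i<brank ?T. smooth_along ?T M id U (e i))"
    if "(U, e) \<in> frames ?T" for U e
    using that openin_manifold_UNIV[OF assms(1)] smooth_fun_on_const[OF assms(1)]
    by (auto simp: frames_trivial_bundle frame_on_def basis_family_iff
        smooth_along_trivial_iff[OF assms openin_manifold_UNIV[OF assms(1)]])
  ultimately show ?thesis
    using assms(1) unfolding vector_bundle_def by auto
qed

lemma sections_trivial_iff: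
  fixes Y :: "'m \<Rightarrow> 'h::real_vector"
  assumes M: "smooth_manifold M" and fd: "finite_dimensional TYPE('h)"
  shows "Y \<in> sections (trivial_bundle M) \<longleftrightarrow> (\<forall>l :: 'h \<Rightarrow> real. linear l \<longrightarrow> (\<lambda>p. l (Y p)) \<in> smooth_funs M)"
  using smooth_along_trivial_iff[OF M fd openin_manifold_UNIV[OF M], of M id Y]
  by (simp add: sections_def smooth_funs_def)

section \<open>Direct sums of vector bundles\<close>

lemma bundle_sum_simps [simp]:
  "base (bundle_sum B B') = base B"
  "fibre (bundle_sum B B') p = fibre B p \<times> fibre B' p"
  "brank (bundle_sum B B') = brank B + brank B'"
  by (simp_all add: bundle_sum_def)

lemma frames_bundle_sum:
  "(W, f) \<in> frames (bundle_sum B B') \<longleftrightarrow>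
     (\<exists>U e U' e'. (U, e) \<in> frames B \<and> (U', e') \<in> frames B' \<and> W = U \<inter> U' \<and>
        f = (\<lambda>i p. if i < brank B then (e i p, 0) else (0, e' (i - brank B) p)))"
  unfolding bundle_sum_def by simp blast

lemma sum_lessThan_add:
  fixes f :: "nat \<Rightarrow> 'a::comm_monoid_add"
  shows "(\<Sum>i<m + n. f i) = (\<Sum>i<m. f i) + (\<Sum>i<n. f (m + i))"
  by (induction n) (auto simp: ac_simps)

lemma sum_frame_expansion:
  fixes e :: "nat \<Rightarrow> 'v::real_vector" and e' :: "nat \<Rightarrow> 'w::real_vector"
  shows "(\<Sum>i<m + n. a i *\<^sub>R (if i < m then (e i, 0) else (0, e' (i - m)))) =
    ((\<Sum>i<m. a i *\<^sub>R e i), (\<Sum>i<n. a (m + i) *\<^sub>R e' i))"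
proof -
  have 1: "(\<Sum>i<m. a i *\<^sub>R (if i < m then (e i, 0) else (0, e' (i - m)))) = ((\<Sum>i<m. a i *\<^sub>R e i), 0)"
    by (simp add: prod_eq_iff fst_sum snd_sum)
  have 2: "(\<Sum>i<n. a (m + i) *\<^sub>R (if m + i < m then (e (m + i), 0) else (0, e' (m + i - m)))) =
      (0, (\<Sum>i<n. a (m + i) *\<^sub>R e' i))"
    by (simp add: prod_eq_iff fst_sum snd_sum)
  show ?thesis unfolding sum_lessThan_add 1 2 by simp
qed

text \<open>Frames of the sum live on intersections of frame domains of the two summands. From left
  to right, a frame of the other summand must therefore be chosen around each point, and the local
  results are glued.\<close>

lemma smooth_section_on_bundle_sum:
  assumes B: "vector_bundle B" and B': "vector_bundle B'" and base: "base B' = base B"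
    and U: "openin (mtop (base B)) U"
  shows "smooth_section_on (bundle_sum B B') U s \<longleftrightarrow>
    smooth_section_on B U (\<lambda>p. fst (s p)) \<and> smooth_section_on B' U (\<lambda>p. snd (s p))"
proof
  note M = vector_bundle_manifold[OF B]
  assume s: "smooth_section_on (bundle_sum B B') U s"
  have loc: "\<exists>T. openin (mtop (base B)) T \<and> p \<in> T \<and> smooth_section_on B (U \<inter> T) (\<lambda>p. fst (s p)) \<and>
      smooth_section_on B' (U \<inter> T) (\<lambda>p. snd (s p))" if p: "p \<in> U" for p
  proof -
    obtain V e where V: "(V, e) \<in> frames B" "p \<in> V" using vector_bundle_frame_at[OF B] .
    obtain V' e' where V': "(V', e') \<in> frames B'" "p \<in> V'" using vector_bundle_frame_at[OF B'] .
    let ?f = "\<lambda>i p. if i < brank B then (e i p, 0) else (0, e' (i - brank B) p)"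
    have "(V \<inter> V', ?f) \<in> frames (bundle_sum B B')" using V V' frames_bundle_sum by blast
    from smooth_section_onE[OF s this] obtain c where
      c: "\<And>i. i < brank B + brank B' \<Longrightarrow> smooth_fun_on (base B) (U \<inter> (V \<inter> V')) (c i)"
      "\<And>p. p \<in> U \<Longrightarrow> p \<in> V \<inter> V' \<Longrightarrow> s p = (\<Sum>i<brank B + brank B'. c i p *\<^sub>R ?f i p)"
      by auto
    have eq: "s q = ((\<Sum>i<brank B. c i q *\<^sub>R e i q), (\<Sum>i<brank B'. c (brank B + i) q *\<^sub>R e' i q))"
      if "q \<in> U \<inter> (V \<inter> V')" for q
      using c(2)[of q] that sum_frame_expansion[of "\<lambda>i. c i q" "brank B" "\<lambda>i. e i q" "\<lambda>i. e' i q" "brank B'"]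
      by simp
    have 1: "smooth_section_on B (U \<inter> (V \<inter> V')) (\<lambda>p. fst (s p))"
      by (rule smooth_section_on_frameI[OF B V(1), where c = c]) (use c(1) eq in auto)
    have 2: "smooth_section_on B' (U \<inter> (V \<inter> V')) (\<lambda>p. snd (s p))"
      by (rule smooth_section_on_frameI[OF B' V'(1), where c = "\<lambda>i. c (brank B + i)"])
        (use c(1) eq base in auto)
    have "openin (mtop (base B)) (V \<inter> V')"
      using vector_bundle_frameD(1)[OF B V(1)] vector_bundle_frameD(1)[OF B' V'(1)] base
      by (simp add: openin_Int)
    with 1 2 V V' show ?thesis by blast
  qed
  have "smooth_section_on B U (\<lambda>p. fst (s p))"
    by (rule smooth_section_on_locally[OF B U]) (use loc in blast)
  moreover have "smooth_section_on B' U (\<lambda>p. snd (s p))"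
  proof (rule smooth_section_on_locally[OF B'])
    show "openin (mtop (base B')) U" using U base by simp
    show "\<exists>T. openin (mtop (base B')) T \<and> p \<in> T \<and> smooth_section_on B' (U \<inter> T) (\<lambda>p. snd (s p))"
      if "p \<in> U" for p
      unfolding base using loc[OF that] base by metis
  qed
  ultimately show "smooth_section_on B U (\<lambda>p. fst (s p)) \<and> smooth_section_on B' U (\<lambda>p. snd (s p))"
    by blast
next
  note M = vector_bundle_manifold[OF B]
  assume s: "smooth_section_on B U (\<lambda>p. fst (s p)) \<and> smooth_section_on B' U (\<lambda>p. snd (s p))"
  show "smooth_section_on (bundle_sum B B') U s"
  proof (rule smooth_alongI)
    fix W f assume "(W, f) \<in> frames (bundle_sum B B')"
    then obtain V e V' e' where V: "(V, e) \<in> frames B" and V': "(V', e') \<in> frames B'"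
      and W: "W = V \<inter> V'"
      and f: "f = (\<lambda>i p. if i < brank B then (e i p, 0) else (0, e' (i - brank B) p))"
      unfolding frames_bundle_sum by blast
    from smooth_section_onE[OF conjunct1[OF s] V] obtain c where
      c: "\<And>i. i < brank B \<Longrightarrow> smooth_fun_on (base B) (U \<inter> V) (c i)"
      "\<And>p. p \<in> U \<Longrightarrow> p \<in> V \<Longrightarrow> fst (s p) = (\<Sum>i<brank B. c i p *\<^sub>R e i p)" by blast
    from smooth_section_onE[OF conjunct2[OF s] V'] obtain c' where
      c': "\<And>i. i < brank B' \<Longrightarrow> smooth_fun_on (base B') (U \<inter> V') (c' i)"
      "\<And>p. p \<in> U \<Longrightarrow> p \<in> V' \<Longrightarrow> snd (s p) = (\<Sum>i<brank B'. c' i p *\<^sub>R e' i p)" by blast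
    let ?c = "\<lambda>i. if i < brank B then c i else c' (i - brank B)"
    have "smooth_fun_on (base B) (U \<inter> W) (?c i)" if i: "i < brank B + brank B'" for i
    proof (cases "i < brank B")
      case True
      have "smooth_fun_on (base B) (U \<inter> W) (c i)"
        by (rule smooth_fun_on_subset[OF M c(1)[OF True]]) (use W in blast)
      with True show ?thesis by simp
    next
      case False
      then have "i - brank B < brank B'" using i by simp
      have "smooth_fun_on (base B) (U \<inter> W) (c' (i - brank B))"
        by (rule smooth_fun_on_subset[OF M c'(1)[unfolded base, OF \<open>i - brank B < brank B'\<close>]]) (use W in blast)
      with False show ?thesis by simp
    qed
    moreover have "s p = (\<Sum>i<brank B + brank B'. ?c i p *\<^sub>R f i p)" if "p \<in> U" "p \<in> W" for p
    proof -
      have "(\<Sum>i<brank B + brank B'. ?c i p *\<^sub>R f i p) =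
          ((\<Sum>i<brank B. ?c i p *\<^sub>R e i p), (\<Sum>i<brank B'. ?c (brank B + i) p *\<^sub>R e' i p))"
        unfolding f by (rule sum_frame_expansion)
      also have "\<dots> = (fst (s p), snd (s p))" using c(2)[of p] c'(2)[of p] that W by simp
      finally show ?thesis by simp
    qed
    ultimately show "\<exists>c. (\<forall>i<brank (bundle_sum B B'). smooth_fun_on (base (bundle_sum B B')) (U \<inter> id -` W) (c i)) \<and>
        (\<forall>p\<in>U. id p \<in> W \<longrightarrow> s p = (\<Sum>i<brank (bundle_sum B B'). c i p *\<^sub>R f i (id p)))"
      by (intro exI[of _ ?c]) simp
  qed
qed

lemma vector_bundle_bundle_sum:
  assumes B: "vector_bundle B" and B': "vector_bundle B'" and base: "base B' = base B"
  shows "vector_bundle (bundle_sum B B')"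
  unfolding vector_bundle_def
proof (intro conjI allI)
  note M = vector_bundle_manifold[OF B]
  show "smooth_manifold (base (bundle_sum B B'))" using M by simp
  show "subspace (fibre (bundle_sum B B') p)" for p
    using vector_bundle_subspace[OF B] vector_bundle_subspace[OF B'] by (simp add: subspace_Times)
  show "\<Union>(fst ` frames (bundle_sum B B')) = UNIV"
  proof (rule UNIV_eq_I[symmetric])
    fix p
    obtain V e where V: "(V, e) \<in> frames B" "p \<in> V" using vector_bundle_frame_at[OF B] .
    obtain V' e' where V': "(V', e') \<in> frames B'" "p \<in> V'" using vector_bundle_frame_at[OF B'] .
    have "(V \<inter> V', \<lambda>i p. if i < brank B then (e i p, 0) else (0, e' (i - brank B) p)) \<in> frames (bundle_sum B B')"
      using V V' frames_bundle_sum by blast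
    with V V' show "p \<in> \<Union>(fst ` frames (bundle_sum B B'))" by force
  qed
  show "\<forall>(W, f)\<in>frames (bundle_sum B B'). openin (mtop (base (bundle_sum B B'))) W \<and>
      frame_on (bundle_sum B B') W f \<and>
      (\<forall>i<brank (bundle_sum B B'). smooth_section_on (bundle_sum B B') W (f i))"
  proof clarify
    fix W f assume "(W, f) \<in> frames (bundle_sum B B')"
    then obtain V e V' e' where V: "(V, e) \<in> frames B" and V': "(V', e') \<in> frames B'"
      and W: "W = V \<inter> V'"
      and f: "f = (\<lambda>i p. if i < brank B then (e i p, 0) else (0, e' (i - brank B) p))"
      unfolding frames_bundle_sum by blast
    have op: "openin (mtop (base B)) W"
      using vector_bundle_frameD(1)[OF B V] vector_bundle_frameD(1)[OF B' V'] base
      by (simp add: openin_Int W)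
    have "smooth_section_on (bundle_sum B B') W (f i)" if i: "i < brank B + brank B'" for i
    proof (cases "i < brank B")
      case True
      have "smooth_section_on B W (e i)"
        by (rule smooth_along_subset[OF M vector_bundle_frameD(2)[OF B V True]]) (use W in blast)
      with True show ?thesis
        unfolding smooth_section_on_bundle_sum[OF B B' base op] f base
        by (simp add: smooth_along_zero[OF M] del: id_apply)
    next
      case False
      then have i': "i - brank B < brank B'" using i by simp
      have "smooth_section_on B' W (e' (i - brank B))"
        by (rule smooth_along_subset[OF vector_bundle_manifold[OF B'] vector_bundle_frameD(2)[OF B' V' i']])
          (use W in blast)
      with False show ?thesis
        unfolding smooth_section_on_bundle_sum[OF B B' base op] f base
        by (simp add: smooth_along_zero[OF M] del: id_apply)
    qed
    moreover have "basis_family {..<brank B + brank B'} (\<lambda>i. f i p) (fibre B p \<times> fibre B' p)" if p: "p \<in> W" for p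
    proof -
      have b: "basis_family {..<brank B} (\<lambda>i. e i p) (fibre B p)"
        "basis_family {..<brank B'} (\<lambda>i. e' i p) (fibre B' p)"
        using vector_bundle_frameD(3)[OF B V] vector_bundle_frameD(3)[OF B' V'] p W by auto
      have z: "0 \<in> fibre B p" "0 \<in> fibre B' p"
        using vector_bundle_subspace[OF B] vector_bundle_subspace[OF B'] subspace_0 by blast+
      have exp: "(\<Sum>i<brank B + brank B'. a i *\<^sub>R f i p) =
        ((\<Sum>i<brank B. a i *\<^sub>R e i p), (\<Sum>i<brank B'. a (brank B + i) *\<^sub>R e' i p))" for a
        unfolding f by (rule sum_frame_expansion)
      show ?thesis
        unfolding basis_family_def
      proof (intro conjI ballI allI impI)
        fix i assume "i \<in> {..<brank B + brank B'}"
        then show "f i p \<in> fibre B p \<times> fibre B' p"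
          using basis_familyD(1)[OF b(1), of i] basis_familyD(1)[OF b(2), of "i - brank B"] z
          by (auto simp: f)
      next
        fix a i assume a: "(\<Sum>i<brank B + brank B'. a i *\<^sub>R f i p) = 0" and i: "i \<in> {..<brank B + brank B'}"
        have a0: "(\<Sum>i<brank B. a i *\<^sub>R e i p) = 0" "(\<Sum>i<brank B'. a (brank B + i) *\<^sub>R e' i p) = 0"
          using a unfolding exp by (auto simp: zero_prod_def)
        show "a i = 0"
          using basis_familyD(2)[OF b(1) a0(1), of i] basis_familyD(2)[OF b(2) a0(2), of "i - brank B"] i
          by (cases "i < brank B") auto
      next
        fix v assume v: "v \<in> fibre B p \<times> fibre B' p"
        then obtain a a' where "fst v = (\<Sum>i<brank B. a i *\<^sub>R e i p)" "snd v = (\<Sum>i<brank B'. a' i *\<^sub>R e' i p)"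
          using basis_familyD(3)[OF b(1), of "fst v"] basis_familyD(3)[OF b(2), of "snd v"] by auto
        then show "\<exists>a. v = (\<Sum>i<brank B + brank B'. a i *\<^sub>R f i p)"
          unfolding exp
          by (intro exI[of _ "\<lambda>i. if i < brank B then a i else a' (i - brank B)"]) (simp add: prod_eq_iff)
      qed
    qed
    then have "frame_on (bundle_sum B B') W f"
      using vector_bundle_subspace[OF B] vector_bundle_subspace[OF B']
      by (simp add: frame_on_def basis_family_iff subspace_Times)
    ultimately show "openin (mtop (base (bundle_sum B B'))) W \<and> frame_on (bundle_sum B B') W f \<and>
      (\<forall>i<brank (bundle_sum B B'). smooth_section_on (bundle_sum B B') W (f i))"
      using op by simp
  qed
qed

section \<open>The kernel of a fibrewise surjective map\<close>

lemma kernel_bundle_simps [simp]: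
  "base (kernel_bundle B F) = base B"
  "fibre (kernel_bundle B F) p = {a \<in> fibre B p. F p a = 0}"
  "brank (kernel_bundle B (F :: 'm \<Rightarrow> 'v::real_vector \<Rightarrow> 'h::real_vector)) = brank B - dim (UNIV :: 'h set)"
  by (simp_all add: kernel_bundle_def subbundle_def)

context
  fixes B :: "('m, 'v::real_vector) vbundle" and F :: "'m \<Rightarrow> 'v \<Rightarrow> 'h::real_vector"
  assumes B: "vector_bundle B" and fd: "finite_dimensional TYPE('h)"
    and F: "\<And>l :: 'h \<Rightarrow> real. linear l \<Longrightarrow> smooth_functional B (\<lambda>p v. l (F p v))"
    and surj: "\<And>p. F p ` fibre B p = UNIV"
begin

text \<open>The linearity of \<open>F\<close> is encoded in its scalar components, which separate
  the points of \<open>'h\<close>.\<close>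

lemma fibre_map_add: "v \<in> fibre B p \<Longrightarrow> w \<in> fibre B p \<Longrightarrow> F p (v + w) = F p v + F p w"
  by (rule linear_functional_eqI[OF fd]) (use F in \<open>auto simp: smooth_functional_def linear_add\<close>)

lemma fibre_map_scale: "v \<in> fibre B p \<Longrightarrow> F p (c *\<^sub>R v) = c *\<^sub>R F p v"
  by (rule linear_functional_eqI[OF fd]) (use F in \<open>auto simp: smooth_functional_def linear_scale\<close>)

lemma subspace_kernel: "subspace {a \<in> fibre B p. F p a = 0}"
proof (rule subspaceI)
  have z: "0 \<in> fibre B p" using vector_bundle_subspace[OF B] subspace_0 by blast
  then show "0 \<in> {a \<in> fibre B p. F p a = 0}" using fibre_map_scale[OF z, of 0] by simp
qed (use vector_bundle_subspace[OF B, of p] fibre_map_add fibre_map_scale in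
    \<open>auto simp: subspace_add subspace_scale\<close>)

lemma frames_kernel_bundle:
  "(U, e) \<in> frames (kernel_bundle B F) \<longleftrightarrow> openin (mtop (base B)) U \<and>
     (\<forall>p\<in>U. basis_family {..<brank B - dim (UNIV :: 'h set)} (\<lambda>i. e i p) {a \<in> fibre B p. F p a = 0}) \<and>
     (\<forall>i<brank B - dim (UNIV :: 'h set). smooth_section_on B U (e i))"
  by (simp add: kernel_bundle_def subbundle_def basis_family_iff[OF _ subspace_kernel])

text \<open>The coordinates of \<open>F\<close> in a basis of \<open>'h\<close> are jointly
  surjective on the fibre, and their common kernel is the kernel of \<open>F\<close>; thus
  \<open>kernel_frame_at\<close> applies with as many functionals as the dimension of
  \<open>'h\<close>.\<close>

lemma kernel_bundle_frame_at:
  obtains U e where "(U, e) \<in> frames (kernel_bundle B F)" "p \<in> U"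
proof -
  let ?d = "dim (UNIV :: 'h set)"
  obtain b where b: "basis_family {..<?d} b (UNIV :: 'h set)"
    using finite_dimensional_basis[OF fd] .
  obtain \<kappa> :: "nat \<Rightarrow> 'h \<Rightarrow> real" where \<kappa>: "\<And>i. i \<in> {..<?d} \<Longrightarrow> linear (\<kappa> i)"
    "\<And>y. (\<Sum>i<?d. \<kappa> i y *\<^sub>R b i) = y"
    using basis_family_coordinates[OF b] by blast
  let ?\<phi> = "\<lambda>l p v. \<kappa> l (F p v)"
  have \<phi>: "smooth_functional B (?\<phi> l)" if "l < ?d" for l
    using F[OF \<kappa>(1)] that by simp
  have onto: "\<exists>v\<in>fibre B p. \<forall>l<?d. ?\<phi> l p v = t l" for t
  proof -
    obtain v where v: "v \<in> fibre B p" "F p v = (\<Sum>i<?d. t i *\<^sub>R b i)"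
      using surj[of p] by (metis (no_types, lifting) UNIV_I imageE)
    have eq: "(\<Sum>i<?d. \<kappa> i (F p v) *\<^sub>R b i) = (\<Sum>i<?d. t i *\<^sub>R b i)"
      using \<kappa>(2)[of "F p v"] v(2) by simp
    have "?\<phi> l p v = t l" if "l < ?d" for l
      by (rule basis_family_unique[OF b eq]) (simp add: that)
    with v(1) show ?thesis by blast
  qed
  obtain U and I :: "nat set" and e where U: "openin (mtop (base B)) U" "p \<in> U"
    and I: "finite I" "card I + ?d = brank B"
    and e: "\<forall>i\<in>I. smooth_section_on B U (e i)"
    and bas: "\<forall>q\<in>U. basis_family I (\<lambda>i. e i q) {v \<in> fibre B q. \<forall>l<?d. ?\<phi> l q v = 0}"
    using kernel_frame_at[of B ?d ?\<phi> p, OF B \<phi> onto] by blast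
  have ker: "(\<forall>l<?d. \<kappa> l y = 0) \<longleftrightarrow> y = 0" for y
  proof
    assume "\<forall>l<?d. \<kappa> l y = 0"
    then have "(\<Sum>i<?d. \<kappa> i y *\<^sub>R b i) = 0" by simp
    then show "y = 0" using \<kappa>(2)[of y] by simp
  qed (use \<kappa>(1) in \<open>auto simp: linear_0\<close>)
  have "card I = brank B - ?d" using I by simp
  \<comment> \<open>The frame comes indexed by some finite set of numbers and is renumbered by an
    initial segment, as \<open>frames\<close> requires.\<close>
  then obtain g where g: "bij_betw g {..<brank B - ?d} I"
    using ex_bij_betw_nat_finite[OF I(1)] by (auto simp: atLeast0LessThan)
  have "(U, \<lambda>i. e (g i)) \<in> frames (kernel_bundle B F)"
    unfolding frames_kernel_bundle
  proof (intro conjI ballI allI impI)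
    show "openin (mtop (base B)) U" by fact
    show "basis_family {..<brank B - ?d} (\<lambda>i. e (g i) q) {a \<in> fibre B q. F q a = 0}" if "q \<in> U" for q
      using basis_family_reindex[OF g bas[rule_format, OF that]] by (simp add: ker)
    show "smooth_section_on B U (e (g i))" if "i < brank B - ?d" for i
      using e bij_betwE[OF g] that by simp
  qed
  with U that show ?thesis by blast
qed

text \<open>Membership in the kernel yields coefficients in each kernel frame, and
  \<open>smooth_coefficients\<close> makes them smooth. Applied to the frame fields it shows that
  the kernel is a vector bundle; applied to brackets it will show closure.\<close>

lemma smooth_section_on_kernel:
  assumes s: "smooth_section_on B U s" and U: "openin (mtop (base B)) U"
    and ker: "\<And>p. p \<in> U \<Longrightarrow> s p \<in> fibre B p \<and> F p (s p) = 0"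
  shows "smooth_section_on (kernel_bundle B F) U s"
proof (rule smooth_alongI)
  let ?r = "brank B - dim (UNIV :: 'h set)"
  note M = vector_bundle_manifold[OF B]
  fix V e assume "(V, e) \<in> frames (kernel_bundle B F)"
  then have V: "openin (mtop (base B)) V"
      "\<And>p. p \<in> V \<Longrightarrow> basis_family {..<?r} (\<lambda>i. e i p) {a \<in> fibre B p. F p a = 0}"
      "\<And>i. i < ?r \<Longrightarrow> smooth_section_on B V (e i)"
    by (auto simp: frames_kernel_bundle simp del: id_apply)
  have UV: "openin (mtop (base B)) (U \<inter> V)" using U V(1) by blast
  have ex: "\<exists>a. s p = (\<Sum>i<?r. a i *\<^sub>R e i p)" if "p \<in> U \<inter> V" for p
    using basis_familyD(3)[OF V(2), of p "s p"] ker[of p] that by blast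
  define c where "c i p = (SOME a. s p = (\<Sum>i<?r. a i *\<^sub>R e i p)) i" for i p
  have c: "s p = (\<Sum>i<?r. c i p *\<^sub>R e i p)" if "p \<in> U \<inter> V" for p
    unfolding c_def using ex[OF that] by (rule someI_ex)
  have "smooth_fun_on (base B) (U \<inter> V) (c i)" if i: "i < ?r" for i
  proof (rule smooth_coefficients[OF B UV _ _ _ c i])
    show "smooth_section_on B (U \<inter> V) (e j)" if "j < ?r" for j
      by (rule smooth_along_subset[OF M V(3)[OF that]]) blast
    show "basis_family {..<?r} (\<lambda>j. e j q) {a \<in> fibre B q. F q a = 0}" if "q \<in> U \<inter> V" for q
      using V(2) that by blast
    show "smooth_section_on B (U \<inter> V) s"
      by (rule smooth_along_subset[OF M s]) blast
  qed
  with c show "\<exists>c. (\<forall>i<brank (kernel_bundle B F). smooth_fun_on (base (kernel_bundle B F)) (U \<inter> id -` V) (c i)) \<and>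
       (\<forall>p\<in>U. id p \<in> V \<longrightarrow> s p = (\<Sum>i<brank (kernel_bundle B F). c i p *\<^sub>R e i (id p)))"
    by (intro exI[of _ c]) simp
qed

lemma vector_bundle_kernel: "vector_bundle (kernel_bundle B F)"
  unfolding vector_bundle_def
proof (intro conjI allI)
  let ?r = "brank B - dim (UNIV :: 'h set)"
  show "smooth_manifold (base (kernel_bundle B F))" using vector_bundle_manifold[OF B] by simp
  show "subspace (fibre (kernel_bundle B F) p)" for p using subspace_kernel by simp
  show "\<Union>(fst ` frames (kernel_bundle B F)) = UNIV"
  proof (rule UNIV_eq_I[symmetric])
    fix p
    obtain U e where "(U, e) \<in> frames (kernel_bundle B F)" "p \<in> U" using kernel_bundle_frame_at .
    then show "p \<in> \<Union>(fst ` frames (kernel_bundle B F))" by force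
  qed
  show "\<forall>(U, e)\<in>frames (kernel_bundle B F). openin (mtop (base (kernel_bundle B F))) U \<and>
      frame_on (kernel_bundle B F) U e \<and>
      (\<forall>i<brank (kernel_bundle B F). smooth_section_on (kernel_bundle B F) U (e i))"
  proof clarify
    fix U e assume "(U, e) \<in> frames (kernel_bundle B F)"
    then have U: "openin (mtop (base B)) U"
        "\<And>p. p \<in> U \<Longrightarrow> basis_family {..<?r} (\<lambda>i. e i p) {a \<in> fibre B p. F p a = 0}"
        "\<And>i. i < ?r \<Longrightarrow> smooth_section_on B U (e i)"
      by (auto simp: frames_kernel_bundle simp del: id_apply)
    have "smooth_section_on (kernel_bundle B F) U (e i)" if "i < ?r" for i
      by (rule smooth_section_on_kernel[OF U(3)[OF that] U(1)])
        (use basis_familyD(1)[OF U(2), of _ i] that in auto)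
    moreover have "frame_on (kernel_bundle B F) U e"
      using U(2) by (simp add: frame_on_def basis_family_iff[OF _ subspace_kernel])
    ultimately show "openin (mtop (base (kernel_bundle B F))) U \<and> frame_on (kernel_bundle B F) U e \<and>
      (\<forall>i<brank (kernel_bundle B F). smooth_section_on (kernel_bundle B F) U (e i))"
      using U(1) by simp
  qed
qed

text \<open>Near each point the section is a smooth combination of kernel frame fields, which are
  smooth in the ambient bundle by the definition of \<open>subbundle\<close>.\<close>

lemma smooth_section_on_kernelD:
  assumes s: "smooth_section_on (kernel_bundle B F) U s" and U: "openin (mtop (base B)) U"
  shows "smooth_section_on B U s"
proof (rule smooth_section_on_locally[OF B U])
  let ?r = "brank B - dim (UNIV :: 'h set)"
  note M = vector_bundle_manifold[OF B]
  fix p assume "p \<in> U"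
  obtain V e where V: "(V, e) \<in> frames (kernel_bundle B F)" "p \<in> V" using kernel_bundle_frame_at .
  from smooth_section_onE[OF s V(1)] obtain c where
    c: "\<And>i. i < ?r \<Longrightarrow> smooth_fun_on (base B) (U \<inter> V) (c i)"
    "\<And>p. p \<in> U \<Longrightarrow> p \<in> V \<Longrightarrow> s p = (\<Sum>i<?r. c i p *\<^sub>R e i p)" by auto
  have e: "openin (mtop (base B)) V" "\<And>i. i < ?r \<Longrightarrow> smooth_section_on B V (e i)"
    using V(1) by (auto simp: frames_kernel_bundle simp del: id_apply)
  have "smooth_section_on B (U \<inter> V) (\<lambda>p. c i p *\<^sub>R e i p)" if "i < ?r" for i
    by (rule smooth_along_scale[OF M c(1)[OF that]], rule smooth_along_subset[OF M e(2)[OF that]]) blast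
  then have sum: "smooth_section_on B (U \<inter> V) (\<lambda>p. \<Sum>i<?r. c i p *\<^sub>R e i p)"
    by (intro smooth_along_sum[OF M]) simp
  have "smooth_section_on B (U \<inter> V) s"
    by (rule smooth_along_cong[OF M sum]) (use c(2) in auto)
  with V(2) e(1) show "\<exists>T. openin (mtop (base B)) T \<and> p \<in> T \<and> smooth_section_on B (U \<inter> T) s"
    by blast
qed

lemma sections_kernel_bundle:
  "s \<in> sections (kernel_bundle B F) \<longleftrightarrow> s \<in> sections B \<and> (\<forall>p. F p (s p) = 0)"
  using smooth_section_on_kernelD[of UNIV s] smooth_section_on_kernel[of UNIV s]
    openin_manifold_UNIV[OF vector_bundle_manifold[OF B]]
  unfolding sections_def by auto

end


section \<open>Derivations\<close>

lemma tangent_space_add: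
  "v \<in> tangent_space M p \<Longrightarrow> f \<in> smooth_funs M \<Longrightarrow> g \<in> smooth_funs M \<Longrightarrow> v (\<lambda>q. f q + g q) = v f + v g"
  and tangent_space_scale: "v \<in> tangent_space M p \<Longrightarrow> f \<in> smooth_funs M \<Longrightarrow> v (\<lambda>q. c * f q) = c * v f"
  and tangent_space_mult:
  "v \<in> tangent_space M p \<Longrightarrow> f \<in> smooth_funs M \<Longrightarrow> g \<in> smooth_funs M \<Longrightarrow>
     v (\<lambda>q. f q * g q) = f p * v g + v f * g p"
  and tangent_space_nonsmooth: "v \<in> tangent_space M p \<Longrightarrow> f \<notin> smooth_funs M \<Longrightarrow> v f = 0"
  by (simp_all add: tangent_space_def)

context
  fixes M :: "'m manifold"
  assumes M: "smooth_manifold M"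
begin

lemma smooth_funs_const [simp]: "(\<lambda>_. c) \<in> smooth_funs M"
  using smooth_fun_on_const[OF M] by (simp add: smooth_funs_def)

lemma smooth_funs_mult: "f \<in> smooth_funs M \<Longrightarrow> g \<in> smooth_funs M \<Longrightarrow> (\<lambda>p. f p * g p) \<in> smooth_funs M"
  using smooth_fun_on_mult[OF M] by (simp add: smooth_funs_def)

lemma smooth_funs_sum: "(\<And>i. i \<in> I \<Longrightarrow> f i \<in> smooth_funs M) \<Longrightarrow> (\<lambda>p. \<Sum>i\<in>I. f i p) \<in> smooth_funs M"
  unfolding smooth_funs_def mem_Collect_eq by (rule smooth_fun_on_sum[OF M])

lemma tangent_space_const:
  assumes "v \<in> tangent_space M p"
  shows "v (\<lambda>_. c) = 0"
proof -
  have "v (\<lambda>_. 1 * 1) = 1 * v (\<lambda>_. 1) + v (\<lambda>_. 1) * 1"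
    by (rule tangent_space_mult[OF assms]) simp_all
  then have "v (\<lambda>_. 1) = 0" by simp
  then show ?thesis using tangent_space_scale[OF assms, of "\<lambda>_. 1" c] by simp
qed

lemma tangent_space_sum:
  assumes "v \<in> tangent_space M p" "\<And>i. i \<in> I \<Longrightarrow> f i \<in> smooth_funs M"
  shows "v (\<lambda>q. \<Sum>i\<in>I. c i * f i q) = (\<Sum>i\<in>I. c i * v (f i))"
  using assms(2)
proof (induction I rule: infinite_finite_induct)
  case (insert i I)
  have "(\<lambda>q. \<Sum>i\<in>I. c i * f i q) \<in> smooth_funs M" "(\<lambda>q. c i * f i q) \<in> smooth_funs M"
    using insert by (auto intro!: smooth_funs_sum smooth_funs_mult)
  with insert show ?case
    using tangent_space_add[OF assms(1)] tangent_space_scale[OF assms(1)] by simp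
qed (simp_all add: tangent_space_const[OF assms(1)])

lemma tangent_space_plus:
  assumes v: "v \<in> tangent_space M p" and w: "w \<in> tangent_space M p"
  shows "(\<lambda>f. v f + w f) \<in> tangent_space M p"
  unfolding tangent_space_def
  by (auto simp: tangent_space_add[OF v] tangent_space_add[OF w] tangent_space_scale[OF v]
      tangent_space_scale[OF w] tangent_space_mult[OF v] tangent_space_mult[OF w]
      tangent_space_nonsmooth[OF v] tangent_space_nonsmooth[OF w] algebra_simps)

lemma vector_fieldsD:
  "X \<in> vector_fields M \<Longrightarrow> X p \<in> tangent_space M p"
  "X \<in> vector_fields M \<Longrightarrow> f \<in> smooth_funs M \<Longrightarrow> (\<lambda>p. X p f) \<in> smooth_funs M"
  by (auto simp: vector_fields_def)

text \<open>Tangent vectors send \<open>f\<close> to 0, so both inner functions are the constant 0,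
  which derivations annihilate. Vector fields are compared on all functions, so the identities below
  need this case.\<close>

lemma vf_bracket_nonsmooth:
  assumes "X \<in> vector_fields M" "Y \<in> vector_fields M" "f \<notin> smooth_funs M"
  shows "vf_bracket X Y p f = 0"
proof -
  have "X q f = 0" "Y q f = 0" for q
    using assms tangent_space_nonsmooth[OF vector_fieldsD(1)] by blast+
  then show ?thesis
    using tangent_space_const[OF vector_fieldsD(1)[OF assms(1), of p]]
      tangent_space_const[OF vector_fieldsD(1)[OF assms(2), of p]]
    by (simp add: vf_bracket_def)
qed

end


section \<open>Derivatives of vector-valued functions\<close>

text \<open>The derivative of an \<open>'h\<close>-valued function along \<open>v\<close>, taken
  componentwise but described without a basis; in finite dimension the functionals determine the
  vector.\<close>

definition vderiv :: "(('m \<Rightarrow> real) \<Rightarrow> real) \<Rightarrow> ('m \<Rightarrow> 'h::real_vector) \<Rightarrow> 'h" where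
  "vderiv v Y = (SOME w. \<forall>l. linear l \<longrightarrow> l w = v (\<lambda>p. l (Y p)))"

context
  fixes M :: "'m manifold"
  assumes M: "smooth_manifold M" and fd: "finite_dimensional TYPE('h::real_vector)"
begin

text \<open>Existence of the chosen vector: differentiate the coordinates in one basis. Any other
  functional is a constant combination of these coordinates, and \<open>v\<close> is linear on
  smooth functions. All rules for \<open>vderiv\<close> follow by testing with functionals.\<close>

lemma linear_vderiv:
  fixes Y :: "'m \<Rightarrow> 'h" and l :: "'h \<Rightarrow> real"
  assumes v: "v \<in> tangent_space M p" and Y: "Y \<in> sections (trivial_bundle M)" and l: "linear l"
  shows "l (vderiv v Y) = v (\<lambda>p. l (Y p))"
proof -
  let ?d = "dim (UNIV :: 'h set)"
  obtain b and \<kappa> :: "nat \<Rightarrow> 'h \<Rightarrow> real" where \<kappa>: "\<forall>i<?d. linear (\<kappa> i)" "\<forall>y. (\<Sum>i<?d. \<kappa> i y *\<^sub>R b i) = y"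
    using finite_dimensional_coordinates[OF fd] by blast
  have sm: "(\<lambda>p. \<kappa> i (Y p)) \<in> smooth_funs M" if "i < ?d" for i
    using Y \<kappa>(1) that by (auto simp: sections_trivial_iff[OF M fd])
  have "l' (\<Sum>i<?d. v (\<lambda>p. \<kappa> i (Y p)) *\<^sub>R b i) = v (\<lambda>p. l' (Y p))" if l': "linear l'" for l' :: "'h \<Rightarrow> real"
  proof -
    have "l' (Y p) = (\<Sum>i<?d. l' (b i) * \<kappa> i (Y p))" for p
    proof -
      have "l' (Y p) = l' (\<Sum>i<?d. \<kappa> i (Y p) *\<^sub>R b i)" using \<kappa>(2) by simp
      also have "\<dots> = (\<Sum>i<?d. \<kappa> i (Y p) * l' (b i))"
        by (simp only: linear_sum[OF l'] linear_scale[OF l'] real_scaleR_def)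
      finally show ?thesis by (simp add: mult.commute)
    qed
    then have "v (\<lambda>p. l' (Y p)) = v (\<lambda>p. \<Sum>i<?d. l' (b i) * \<kappa> i (Y p))" by simp
    also have "\<dots> = (\<Sum>i<?d. l' (b i) * v (\<lambda>p. \<kappa> i (Y p)))"
      using sm by (intro tangent_space_sum[OF M v]) simp
    finally show ?thesis
      by (simp add: linear_sum[OF l'] linear_scale[OF l'] mult.commute)
  qed
  then have "\<exists>w. \<forall>l :: 'h \<Rightarrow> real. linear l \<longrightarrow> l w = v (\<lambda>p. l (Y p))" by blast
  then have "\<forall>l :: 'h \<Rightarrow> real. linear l \<longrightarrow> l (vderiv v Y) = v (\<lambda>p. l (Y p))"
    unfolding vderiv_def by (rule someI_ex)
  then show ?thesis using l by blast
qed

lemma sections_trivialD: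
  "(Y :: 'm \<Rightarrow> 'h) \<in> sections (trivial_bundle M) \<Longrightarrow> linear l \<Longrightarrow> (\<lambda>p. l (Y p) :: real) \<in> smooth_funs M"
  by (simp add: sections_trivial_iff[OF M fd])

lemma sections_trivial_const [simp]: "(\<lambda>_. y :: 'h) \<in> sections (trivial_bundle M)"
  by (simp add: sections_trivial_iff[OF M fd] smooth_funs_const[OF M])

lemmas sections_trivial_add = sections_add[OF vector_bundle_trivial[OF M fd]]
  and sections_trivial_scale = sections_scale[OF vector_bundle_trivial[OF M fd], simplified]

lemma vderiv_const: "v \<in> tangent_space M p \<Longrightarrow> vderiv v (\<lambda>_. y :: 'h) = 0"
  by (rule linear_functional_eqI[OF fd])
    (simp add: linear_vderiv tangent_space_const[OF M] linear_0)

lemma vderiv_add: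
  assumes "v \<in> tangent_space M p" "(Y :: 'm \<Rightarrow> 'h) \<in> sections (trivial_bundle M)"
    "Z \<in> sections (trivial_bundle M)"
  shows "vderiv v (\<lambda>p. Y p + Z p) = vderiv v Y + vderiv v Z"
  by (rule linear_functional_eqI[OF fd])
    (simp add: linear_vderiv[OF assms(1)] assms sections_trivial_add linear_add
      tangent_space_add[OF assms(1)] sections_trivialD)

lemma vderiv_scale:
  assumes "v \<in> tangent_space M p" "(Y :: 'm \<Rightarrow> 'h) \<in> sections (trivial_bundle M)" "f \<in> smooth_funs M"
  shows "vderiv v (\<lambda>p. f p *\<^sub>R Y p) = f p *\<^sub>R vderiv v Y + v f *\<^sub>R Y p"
  by (rule linear_functional_eqI[OF fd])
    (simp add: linear_vderiv[OF assms(1)] assms sections_trivial_scale linear_add linear_scale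
      tangent_space_mult[OF assms(1)] sections_trivialD)

lemma vderiv_sum:
  assumes "v \<in> tangent_space M p" "\<And>i. i \<in> I \<Longrightarrow> f i \<in> smooth_funs M"
  shows "vderiv v (\<lambda>p. \<Sum>i\<in>I. f i p *\<^sub>R (y i :: 'h)) = (\<Sum>i\<in>I. v (f i) *\<^sub>R y i)"
  using assms(2)
proof (induction I rule: infinite_finite_induct)
  case (insert i I)
  have 1: "(\<lambda>p. f j p *\<^sub>R y j) \<in> sections (trivial_bundle M)" if "j \<in> insert i I" for j
    using sections_trivial_scale[OF insert.prems[OF that] sections_trivial_const] .
  then have 2: "(\<lambda>p. \<Sum>i\<in>I. f i p *\<^sub>R y i) \<in> sections (trivial_bundle M)"
    by (intro sections_sum[OF vector_bundle_trivial[OF M fd]]) simp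
  have "vderiv v (\<lambda>p. f i p *\<^sub>R y i) = v (f i) *\<^sub>R y i"
    using vderiv_scale[OF assms(1) sections_trivial_const[of "y i"] insert.prems[of i]]
    by (simp add: vderiv_const[OF assms(1)])
  then show ?case using insert 1 2 vderiv_add[OF assms(1) 1[of i] 2] by simp
qed (simp_all add: vderiv_const[OF assms(1)])

lemma vderiv_plus:
  assumes v: "v \<in> tangent_space M p" and w: "w \<in> tangent_space M p"
    and Y: "(Y :: 'm \<Rightarrow> 'h) \<in> sections (trivial_bundle M)"
  shows "vderiv (\<lambda>f. v f + w f) Y = vderiv v Y + vderiv w Y"
  by (rule linear_functional_eqI[OF fd])
    (simp add: linear_vderiv[OF tangent_space_plus[OF M v w] Y] linear_vderiv[OF v Y]
      linear_vderiv[OF w Y] linear_add)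

end


section \<open>Calculus in Lie algebroids\<close>

lemma anchor_map_functional:
  assumes "anchor_map B \<rho>" "f \<in> smooth_funs (base B)"
  shows "smooth_functional B (\<lambda>p v. \<rho> p v f)"
  using assms unfolding anchor_map_def smooth_functional_def by blast

lemma anchor_map_vector_field:
  assumes B: "vector_bundle B" and \<rho>: "anchor_map B \<rho>" and a: "a \<in> sections B"
  shows "(\<lambda>p. \<rho> p (a p)) \<in> vector_fields (base B)"
proof -
  have "\<rho> p (a p) \<in> tangent_space (base B) p" for p
    using \<rho> sections_fibre[OF B a] unfolding anchor_map_def by blast
  moreover have "(\<lambda>p. \<rho> p (a p) f) \<in> smooth_funs (base B)" if "f \<in> smooth_funs (base B)" for f
    using smooth_functional_section[OF B anchor_map_functional[OF \<rho> that]
        openin_manifold_UNIV[OF vector_bundle_manifold[OF B]] sections_smooth[OF B a]]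
    by (simp add: smooth_funs_def)
  ultimately show ?thesis by (simp add: vector_fields_def)
qed

lemma lie_algebroidI:
  fixes L :: "('m, 'v::real_vector) algebroid"
  defines "\<Gamma> \<equiv> sections (vbun L)"
  assumes "vector_bundle (vbun L)" "anchor_map (vbun L) (anchor L)"
    and "\<And>a b. a \<in> \<Gamma> \<Longrightarrow> b \<in> \<Gamma> \<Longrightarrow> bracket L a b \<in> \<Gamma>"
    and "\<And>a b c p. a \<in> \<Gamma> \<Longrightarrow> b \<in> \<Gamma> \<Longrightarrow> c \<in> \<Gamma> \<Longrightarrow>
      bracket L (\<lambda>p. a p + b p) c p = bracket L a c p + bracket L b c p"
    and "\<And>a b t p. a \<in> \<Gamma> \<Longrightarrow> b \<in> \<Gamma> \<Longrightarrow> bracket L (\<lambda>p. t *\<^sub>R a p) b p = t *\<^sub>R bracket L a b p"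
    and "\<And>a b p. a \<in> \<Gamma> \<Longrightarrow> b \<in> \<Gamma> \<Longrightarrow> bracket L a b p = - bracket L b a p"
    and "\<And>a b c p. a \<in> \<Gamma> \<Longrightarrow> b \<in> \<Gamma> \<Longrightarrow> c \<in> \<Gamma> \<Longrightarrow>
      bracket L a (bracket L b c) p + bracket L b (bracket L c a) p + bracket L c (bracket L a b) p = 0"
    and "\<And>a b f p. a \<in> \<Gamma> \<Longrightarrow> b \<in> \<Gamma> \<Longrightarrow> f \<in> smooth_funs (base (vbun L)) \<Longrightarrow>
      bracket L a (\<lambda>p. f p *\<^sub>R b p) p = f p *\<^sub>R bracket L a b p + anchor_vf L a p f *\<^sub>R b p"
    and "\<And>a b p f. a \<in> \<Gamma> \<Longrightarrow> b \<in> \<Gamma> \<Longrightarrow>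
      anchor_vf L (bracket L a b) p f = vf_bracket (anchor_vf L a) (anchor_vf L b) p f"
  shows "lie_algebroid L"
  unfolding lie_algebroid_def Let_def \<Gamma>_def[symmetric]
  by (intro conjI ballI allI ext assms(2-))

abbreviation Gamma :: "('m, 'v::real_vector) algebroid \<Rightarrow> ('m \<Rightarrow> 'v) set" where
  "Gamma L \<equiv> sections (vbun L)"

context
  fixes L :: "('m, 'v::real_vector) algebroid"
  assumes L: "lie_algebroid L"
begin

lemma algebroid_bundle: "vector_bundle (vbun L)"
  and algebroid_anchor: "anchor_map (vbun L) (anchor L)"
  using L by (simp_all add: lie_algebroid_def Let_def)

lemmas algebroid_manifold = vector_bundle_manifold[OF algebroid_bundle]
  and gamma_fibre = sections_fibre[OF algebroid_bundle]
  and gamma_zero = sections_zero[OF algebroid_bundle]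
  and gamma_add = sections_add[OF algebroid_bundle]
  and gamma_diff = sections_diff[OF algebroid_bundle]
  and gamma_uminus = sections_uminus[OF algebroid_bundle]
  and gamma_scale = sections_scale[OF algebroid_bundle]
  and gamma_scaleR = sections_scaleR[OF algebroid_bundle]
  and gamma_sum = sections_sum[OF algebroid_bundle]

lemma algebroid_facts:
  "\<forall>a\<in>Gamma L. \<forall>b\<in>Gamma L. bracket L a b \<in> Gamma L"
  "\<forall>a\<in>Gamma L. \<forall>b\<in>Gamma L. \<forall>c\<in>Gamma L.
     bracket L (\<lambda>p. a p + b p) c = (\<lambda>p. bracket L a c p + bracket L b c p)"
  "\<forall>a\<in>Gamma L. \<forall>b\<in>Gamma L. \<forall>t.
     bracket L (\<lambda>p. t *\<^sub>R a p) b = (\<lambda>p. t *\<^sub>R bracket L a b p)"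
  "\<forall>a\<in>Gamma L. \<forall>b\<in>Gamma L. bracket L a b = (\<lambda>p. - bracket L b a p)"
  "\<forall>a\<in>Gamma L. \<forall>b\<in>Gamma L. \<forall>c\<in>Gamma L. \<forall>p.
     bracket L a (bracket L b c) p + bracket L b (bracket L c a) p + bracket L c (bracket L a b) p = 0"
  "\<forall>a\<in>Gamma L. \<forall>b\<in>Gamma L. \<forall>f\<in>smooth_funs (base (vbun L)).
     bracket L a (\<lambda>p. f p *\<^sub>R b p) = (\<lambda>p. f p *\<^sub>R bracket L a b p + anchor_vf L a p f *\<^sub>R b p)"
  "\<forall>a\<in>Gamma L. \<forall>b\<in>Gamma L.
     anchor_vf L (bracket L a b) = vf_bracket (anchor_vf L a) (anchor_vf L b)"
  using L unfolding lie_algebroid_def Let_def by - (elim conjE, assumption)+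

lemmas bracket_closed = algebroid_facts(1)[rule_format]
  and bracket_add_left = algebroid_facts(2)[rule_format, THEN fun_cong]
  and bracket_scaleR_left = algebroid_facts(3)[rule_format, THEN fun_cong]
  and bracket_anti = algebroid_facts(4)[rule_format, THEN fun_cong]
  and bracket_jacobi = algebroid_facts(5)[rule_format]
  and bracket_leibniz = algebroid_facts(6)[rule_format, THEN fun_cong]
  and anchor_vf_bracket = algebroid_facts(7)[rule_format]

text \<open>The axioms list linearity in the left argument; antisymmetry transfers it to the right
  one.\<close>

lemma bracket_add_right:
  assumes "a \<in> Gamma L" "b \<in> Gamma L" "c \<in> Gamma L"
  shows "bracket L c (\<lambda>p. a p + b p) p = bracket L c a p + bracket L c b p"
  using bracket_anti[OF assms(3) gamma_add[OF assms(1,2)]] bracket_add_left[OF assms]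
    bracket_anti[OF assms(3,1)] bracket_anti[OF assms(3,2)] by simp

lemma bracket_scaleR_right:
  assumes "a \<in> Gamma L" "b \<in> Gamma L"
  shows "bracket L a (\<lambda>p. t *\<^sub>R b p) p = t *\<^sub>R bracket L a b p"
  using bracket_anti[OF assms(1) gamma_scaleR[OF assms(2)]] bracket_scaleR_left[OF assms(2,1)]
    bracket_anti[OF assms] by simp

lemma bracket_uminus_right:
  "a \<in> Gamma L \<Longrightarrow> b \<in> Gamma L \<Longrightarrow> bracket L a (\<lambda>p. - b p) p = - bracket L a b p"
  using bracket_scaleR_right[of a b "-1"] by simp

lemma bracket_diff_right:
  assumes "a \<in> Gamma L" "b \<in> Gamma L" "c \<in> Gamma L"
  shows "bracket L c (\<lambda>p. a p - b p) p = bracket L c a p - bracket L c b p"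
  using bracket_add_right[OF assms(1) gamma_uminus[OF assms(2)] assms(3)]
    bracket_uminus_right[OF assms(3,2)] by simp

lemma bracket_diff_left:
  assumes "a \<in> Gamma L" "b \<in> Gamma L" "c \<in> Gamma L"
  shows "bracket L (\<lambda>p. a p - b p) c p = bracket L a c p - bracket L b c p"
  using bracket_anti[OF gamma_diff[OF assms(1,2)] assms(3)] bracket_diff_right[OF assms]
    bracket_anti[OF assms(3,1)] bracket_anti[OF assms(3,2)] by simp

lemma bracket_zero_right: "a \<in> Gamma L \<Longrightarrow> bracket L a (\<lambda>_. 0) p = 0"
  using bracket_scaleR_right[OF _ gamma_zero, of a 0] by simp

lemma anchor_vf_vector_field: "a \<in> Gamma L \<Longrightarrow> anchor_vf L a \<in> vector_fields (base (vbun L))"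
  unfolding anchor_vf_def by (rule anchor_map_vector_field[OF algebroid_bundle algebroid_anchor])

lemma anchor_linear:
  "v \<in> fibre (vbun L) p \<Longrightarrow> w \<in> fibre (vbun L) p \<Longrightarrow> anchor L p (v + w) f = anchor L p v f + anchor L p w f"
  "v \<in> fibre (vbun L) p \<Longrightarrow> anchor L p (c *\<^sub>R v) f = c * anchor L p v f"
  using algebroid_anchor unfolding anchor_map_def by blast+

lemma anchor_vf_add:
  "a \<in> Gamma L \<Longrightarrow> b \<in> Gamma L \<Longrightarrow>
     anchor_vf L (\<lambda>p. a p + b p) p f = anchor_vf L a p f + anchor_vf L b p f"
  by (simp add: anchor_vf_def anchor_linear gamma_fibre)

lemma anchor_vf_scale:
  "a \<in> Gamma L \<Longrightarrow> anchor_vf L (\<lambda>p. g p *\<^sub>R a p) p f = g p * anchor_vf L a p f"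
  by (simp add: anchor_vf_def anchor_linear gamma_fibre)

lemma anchor_vf_diff:
  "a \<in> Gamma L \<Longrightarrow> b \<in> Gamma L \<Longrightarrow>
     anchor_vf L (\<lambda>p. a p - b p) p f = anchor_vf L a p f - anchor_vf L b p f"
  using anchor_vf_add[OF _ gamma_uminus, of a b p f] anchor_vf_scale[of b "\<lambda>_. -1" p f] by simp

lemma bracket_sum_right:
  assumes "a \<in> Gamma L" "\<And>i. i \<in> I \<Longrightarrow> b i \<in> Gamma L"
    "\<And>i. i \<in> I \<Longrightarrow> f i \<in> smooth_funs (base (vbun L))"
  shows "bracket L a (\<lambda>p. \<Sum>i\<in>I. f i p *\<^sub>R b i p) p =
    (\<Sum>i\<in>I. f i p *\<^sub>R bracket L a (b i) p + anchor_vf L a p (f i) *\<^sub>R b i p)"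
  using assms(2,3)
proof (induction I rule: infinite_finite_induct)
  case (insert i I)
  have "(\<lambda>p. \<Sum>i\<in>I. f i p *\<^sub>R b i p) \<in> Gamma L" "(\<lambda>p. f i p *\<^sub>R b i p) \<in> Gamma L"
    using insert.prems by (auto intro!: gamma_sum gamma_scale)
  with insert show ?case
    using bracket_add_right[OF _ _ assms(1)] bracket_leibniz[OF assms(1)] by simp
qed (simp_all add: bracket_zero_right[OF assms(1)])

lemma bracket_sum_left:
  assumes "b \<in> Gamma L" "\<And>i. i \<in> I \<Longrightarrow> a i \<in> Gamma L"
    "\<And>i. i \<in> I \<Longrightarrow> f i \<in> smooth_funs (base (vbun L))"
  shows "bracket L (\<lambda>p. \<Sum>i\<in>I. f i p *\<^sub>R a i p) b p =
    (\<Sum>i\<in>I. f i p *\<^sub>R bracket L (a i) b p - anchor_vf L b p (f i) *\<^sub>R a i p)"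
proof -
  have s: "(\<lambda>p. \<Sum>i\<in>I. f i p *\<^sub>R a i p) \<in> Gamma L"
    using assms(2,3) by (auto intro!: gamma_sum gamma_scale)
  have "bracket L (\<lambda>p. \<Sum>i\<in>I. f i p *\<^sub>R a i p) b p =
      - (\<Sum>i\<in>I. f i p *\<^sub>R bracket L b (a i) p + anchor_vf L b p (f i) *\<^sub>R a i p)"
    by (subst bracket_anti[OF s assms(1)], subst bracket_sum_right[OF assms]) simp_all
  also have "\<dots> = (\<Sum>i\<in>I. - (f i p *\<^sub>R bracket L b (a i) p + anchor_vf L b p (f i) *\<^sub>R a i p))"
    by (rule sum_negf[symmetric])
  also have "\<dots> = (\<Sum>i\<in>I. f i p *\<^sub>R bracket L (a i) b p - anchor_vf L b p (f i) *\<^sub>R a i p)"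
  proof (rule sum.cong[OF refl])
    fix i assume "i \<in> I"
    from bracket_anti[OF assms(1) assms(2)[OF this], of p]
    show "- (f i p *\<^sub>R bracket L b (a i) p + anchor_vf L b p (f i) *\<^sub>R a i p) =
        f i p *\<^sub>R bracket L (a i) b p - anchor_vf L b p (f i) *\<^sub>R a i p"
      by simp
  qed
  finally show ?thesis .
qed

text \<open>The Leibniz rule applied in both arguments. The result has exactly the shape of the
  bracket condition for morphisms, which is why that condition will hold for the inclusion of the
  kernel.\<close>

lemma bracket_sum_sum:
  assumes "\<And>i. i < k \<Longrightarrow> a i \<in> Gamma L" "\<And>j. j < l \<Longrightarrow> b j \<in> Gamma L"
    and "\<And>i. i < k \<Longrightarrow> u i \<in> smooth_funs (base (vbun L))" "\<And>j. j < l \<Longrightarrow> v j \<in> smooth_funs (base (vbun L))"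
  shows "bracket L (\<lambda>p. \<Sum>i<(k::nat). u i p *\<^sub>R a i p) (\<lambda>p. \<Sum>j<(l::nat). v j p *\<^sub>R b j p) p =
    (\<Sum>i<k. \<Sum>j<l. (u i p * v j p) *\<^sub>R bracket L (a i) (b j) p)
    + (\<Sum>j<l. anchor_vf L (\<lambda>p. \<Sum>i<k. u i p *\<^sub>R a i p) p (v j) *\<^sub>R b j p)
    - (\<Sum>i<k. anchor_vf L (\<lambda>p. \<Sum>j<l. v j p *\<^sub>R b j p) p (u i) *\<^sub>R a i p)"
proof -
  let ?a = "\<lambda>p. \<Sum>i<k. u i p *\<^sub>R a i p" and ?b = "\<lambda>p. \<Sum>j<l. v j p *\<^sub>R b j p"
  have a: "?a \<in> Gamma L" and b: "?b \<in> Gamma L"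
    using assms by (auto intro!: gamma_sum gamma_scale)
  have "bracket L ?a ?b p = (\<Sum>j<l. v j p *\<^sub>R bracket L ?a (b j) p + anchor_vf L ?a p (v j) *\<^sub>R b j p)"
    using assms by (intro bracket_sum_right[OF a]) auto
  also have "\<dots> = (\<Sum>j<l. v j p *\<^sub>R bracket L ?a (b j) p) + (\<Sum>j<l. anchor_vf L ?a p (v j) *\<^sub>R b j p)"
    by (rule sum.distrib)
  finally have 1: "bracket L ?a ?b p = \<dots>" .
  \<comment> \<open>The derivatives coming from the left expansion involve the anchors of the single
    \<open>b j\<close>; summed up they give the anchor of the whole right argument.\<close>
  have anc: "anchor_vf L ?b p f = (\<Sum>j<l. v j p * anchor_vf L (b j) p f)" if "f \<in> smooth_funs (base (vbun L))" for f
    unfolding anchor_vf_def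
    using assms(2) gamma_fibre
    by (intro smooth_functional_sum[OF anchor_map_functional[OF algebroid_anchor that]
          vector_bundle_subspace[OF algebroid_bundle]]) auto
  have "(\<Sum>j<l. v j p *\<^sub>R bracket L ?a (b j) p) =
      (\<Sum>j<l. \<Sum>i<k. (u i p * v j p) *\<^sub>R bracket L (a i) (b j) p - (v j p * anchor_vf L (b j) p (u i)) *\<^sub>R a i p)"
    using assms by (intro sum.cong[OF refl], subst bracket_sum_left)
      (auto simp: scaleR_sum_right scaleR_diff_right mult.commute)
  also have "\<dots> = (\<Sum>i<k. \<Sum>j<l. (u i p * v j p) *\<^sub>R bracket L (a i) (b j) p - (v j p * anchor_vf L (b j) p (u i)) *\<^sub>R a i p)"
    by (rule sum.swap)
  also have "\<dots> = (\<Sum>i<k. \<Sum>j<l. (u i p * v j p) *\<^sub>R bracket L (a i) (b j) p)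
      - (\<Sum>i<k. anchor_vf L ?b p (u i) *\<^sub>R a i p)"
    using assms(3) by (simp add: sum_subtractf anc scaleR_sum_left)
  finally show ?thesis unfolding 1 by simp
qed

end


section \<open>Lie algebras as Lie algebroids over a point\<close>

lemma smooth_manifold_point: "smooth_manifold point_manifold"
proof -
  have top: "topspace (Euclidean_space 0) = {\<lambda>_. 0}"
    by (auto simp: topspace_Euclidean_space fun_eq_iff)
  have im: "(\<lambda>(_::unit) (_::nat). 0::real) ` UNIV = {\<lambda>_. 0}" by auto
  have "openin (Euclidean_space 0) {\<lambda>_. 0}" using openin_topspace[of "Euclidean_space 0"] top by simp
  moreover have "homeomorphic_map (discrete_topology (UNIV :: unit set))
      (subtopology (Euclidean_space 0) {\<lambda>_. 0}) (\<lambda>_ _. 0)"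
  proof (rule bijective_open_imp_homeomorphic_map)
    show "open_map (discrete_topology (UNIV :: unit set)) (subtopology (Euclidean_space 0) {\<lambda>_. 0}) (\<lambda>_ _. 0)"
      unfolding open_map_def
    proof (intro allI impI)
      fix U :: "unit set"
      have "U = {} \<or> (\<lambda>_ _. 0::real) ` U = topspace (subtopology (Euclidean_space 0) {\<lambda>_. 0})"
        using top by auto
      then show "openin (subtopology (Euclidean_space 0) {\<lambda>_. 0}) ((\<lambda>_ _. 0) ` U)"
        using openin_topspace by (metis image_empty openin_empty)
    qed
  qed (auto simp: top inj_on_def continuous_map_def)
  ultimately show ?thesis
    unfolding smooth_manifold_def point_manifold_def
    by (simp add: im Hausdorff_space_discrete_topology second_countable_discrete_topology)
qed

text \<open>\<open>Euclidean_space 0\<close> has only one point, so continuity is automatic and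
  there are no partial derivatives to check.\<close>

lemma smooth_funs_point [simp]: "f \<in> smooth_funs point_manifold"
proof -
  have "continuous_map (subtopology (Euclidean_space 0) S) euclideanreal g" for S g
  proof -
    have "topspace (subtopology (Euclidean_space 0) S) \<subseteq> {\<lambda>_. 0}"
      by (auto simp: topspace_Euclidean_space fun_eq_iff)
    then have "{x \<in> topspace (subtopology (Euclidean_space 0) S). g x \<in> U} = {} \<or>
      {x \<in> topspace (subtopology (Euclidean_space 0) S). g x \<in> U} = topspace (subtopology (Euclidean_space 0) S)" for U
      by blast
    moreover have "openin X W" if "W = {} \<or> W = topspace X" for X :: "(nat \<Rightarrow> real) topology" and W
      using that by auto
    ultimately have "openin (subtopology (Euclidean_space 0) S)
        {x \<in> topspace (subtopology (Euclidean_space 0) S). g x \<in> U}" for U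
      by simp
    then show ?thesis unfolding continuous_map_def by simp
  qed
  then have "Ck_on 0 k S g" for k S g by (cases k) auto
  then show ?thesis by (auto simp: smooth_funs_def smooth_fun_on_def Cinf_on_def point_manifold_def)
qed

lemma smooth_map_point: "smooth_map M point_manifold (\<lambda>_. ())"
  by (auto simp: smooth_map_def point_manifold_def)

lemma lie_algebra_finite_dimensional: "lie_algebra (br0 :: 'h::real_vector \<Rightarrow> _) \<Longrightarrow> finite_dimensional TYPE('h)"
  by (simp add: lie_algebra_def finite_dimensional_def)

lemma lie_algebra_bilinear: "lie_algebra br0 \<Longrightarrow> bilinear br0"
  by (simp add: lie_algebra_def)

lemma lie_algebra_anti:
  assumes "lie_algebra br0"
  shows "br0 x y = - br0 y x"
proof -
  have "br0 (x + y) (x + y) = 0" "br0 x x = 0" "br0 y y = 0"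
    using assms by (simp_all add: lie_algebra_def)
  then have "br0 x y + br0 y x = 0"
    using lie_algebra_bilinear[OF assms] by (simp add: bilinear_ladd bilinear_radd)
  then show ?thesis using eq_neg_iff_add_eq_0 by blast
qed

lemma lie_algebra_jacobi: "lie_algebra br0 \<Longrightarrow> br0 x (br0 y z) + br0 y (br0 z x) + br0 z (br0 x y) = 0"
  by (simp add: lie_algebra_def)

lemma point_algebroid_simps [simp]:
  "vbun (point_algebroid br0) = trivial_bundle point_manifold"
  "anchor (point_algebroid br0) p v f = 0"
  "bracket (point_algebroid br0) a b p = br0 (a p) (b p)"
  by (simp_all add: point_algebroid_def)

lemma lie_algebroid_point:
  fixes br0 :: "'h::real_vector \<Rightarrow> 'h \<Rightarrow> 'h"
  assumes br0: "lie_algebra br0"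
  shows "lie_algebroid (point_algebroid br0)"
proof -
  note fd = lie_algebra_finite_dimensional[OF br0]
  note M = smooth_manifold_point
  have sec: "Y \<in> sections (trivial_bundle point_manifold)" for Y :: "unit \<Rightarrow> 'h"
    by (simp add: sections_trivial_iff[OF M fd])
  note bil = bilinear_ladd[OF lie_algebra_bilinear[OF br0]] bilinear_lmul[OF lie_algebra_bilinear[OF br0]]
    bilinear_rmul[OF lie_algebra_bilinear[OF br0]]
  have anc: "anchor_map (trivial_bundle point_manifold :: (unit, 'h) vbundle) (anchor (point_algebroid br0))"
    unfolding anchor_map_def
    using smooth_fun_on_const[OF M] by (auto simp: tangent_space_def)
  show ?thesis
  proof (rule lie_algebroidI)
    show "bracket (point_algebroid br0) a b p = - bracket (point_algebroid br0) b a p" for a b p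
      using lie_algebra_anti[OF br0, of "a p" "b p"] by simp
  qed (use anc in \<open>simp_all add: vector_bundle_trivial[OF M fd] sec lie_algebra_jacobi[OF br0] bil
      anchor_vf_def vf_bracket_def\<close>)
qed


section \<open>The action up to homotopy of a splitting\<close>

text \<open>The Jacobi identity in the form that the bracket with \<open>a\<close> is a derivation.
  It enters axioms (i), (iii) and (iv) of the action in this form, with \<open>a\<close> a lifted
  constant.\<close>

lemma bracket_jacobi_derivation:
  assumes L: "lie_algebroid L"
    and a: "a \<in> Gamma L" and b: "b \<in> Gamma L" and c: "c \<in> Gamma L"
  shows "bracket L a (bracket L b c) p = bracket L (bracket L a b) c p + bracket L b (bracket L a c) p"
proof -
  note [simp] = bracket_closed[OF L]
  have "bracket L c a = (\<lambda>p. - bracket L a c p)" using bracket_anti[OF L c a] by blast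
  then have "bracket L b (bracket L c a) p = - bracket L b (bracket L a c) p"
    using bracket_uminus_right[OF L b, of "bracket L a c" p] a c by simp
  moreover have "bracket L c (bracket L a b) p = - bracket L (bracket L a b) c p"
    using bracket_anti[OF L c, of "bracket L a b" p] a b by simp
  ultimately have "bracket L a (bracket L b c) p -
      (bracket L (bracket L a b) c p + bracket L b (bracket L a c) p) = 0"
    using bracket_jacobi[OF L a b c, of p] by (simp add: algebra_simps)
  then show ?thesis by simp
qed

lemma bundle_map_to_point_functional:
  fixes F :: "'m \<Rightarrow> 'v::real_vector \<Rightarrow> 'h::real_vector" and l :: "'h \<Rightarrow> real"
  assumes F: "bundle_map B (trivial_bundle N) \<phi> F" and fd: "finite_dimensional TYPE('h)" and l: "linear l"
  shows "smooth_functional B (\<lambda>p v. l (F p v))"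
  unfolding smooth_functional_def
proof (intro conjI allI ballI)
  have B: "vector_bundle B" using F by (simp add: bundle_map_def)
  show "l (F p (v + w)) = l (F p v) + l (F p w)" if "v \<in> fibre B p" "w \<in> fibre B p" for p v w
    using F that l by (simp add: bundle_map_def linear_add)
  show "l (F p (c *\<^sub>R v)) = c * l (F p v)" if "v \<in> fibre B p" for p c v
    using F that l by (simp add: bundle_map_def linear_scale)
  have "smooth_fun_on (base B) V (\<lambda>p. l (F p (e i p)))" if V: "(V, e) \<in> frames B" and i: "i < brank B" for V e i
  proof -
    have "smooth_along (trivial_bundle N) (base B) \<phi> V (\<lambda>p. F p (e i p))"
      using F V i unfolding bundle_map_def by blast
    from smooth_along_trivial_iff[THEN iffD1, OF vector_bundle_manifold[OF B] fd vector_bundle_frameD(1)[OF B V] this]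
    show ?thesis using l by simp
  qed
  then show "case x of (V, e) \<Rightarrow> \<forall>i<brank B. smooth_fun_on (base B) V (\<lambda>p. l (F p (e i p)))"
    if "x \<in> frames B" for x
    using that by (cases x) simp
qed

lemma kernel_algebroid_simps [simp]:
  "vbun (kernel_algebroid A F) = kernel_bundle (vbun A) F"
  "anchor (kernel_algebroid A F) = anchor A"
  "bracket (kernel_algebroid A F) = bracket A"
  "anchor_vf (kernel_algebroid A F) = anchor_vf A"
  by (simp_all add: kernel_algebroid_def anchor_vf_def fun_eq_iff)

section \<open>The kernel algebroid of a surjective morphism to a Lie algebra\<close>

context
  fixes br0 :: "'h::real_vector \<Rightarrow> 'h \<Rightarrow> 'h"
    and A :: "('n, 'w::real_vector) algebroid"
    and F :: "'n \<Rightarrow> 'w \<Rightarrow> 'h"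
  assumes br0: "lie_algebra br0"
    and F: "lie_algebroid_morphism A (point_algebroid br0) (\<lambda>_. ()) F"
    and surj: "\<And>p. F p ` fibre (vbun A) p = UNIV"
begin

lemma morphism_algebroid: "lie_algebroid A"
  and morphism_bundle_map: "bundle_map (vbun A) (trivial_bundle point_manifold) (\<lambda>_. ()) F"
  using F by (simp_all add: lie_algebroid_morphism_def)

lemmas morphism_bundle = algebroid_bundle[OF morphism_algebroid]
  and morphism_manifold = algebroid_manifold[OF morphism_algebroid]
  and h_dim = lie_algebra_finite_dimensional[OF br0]
  and morphism_functional = bundle_map_to_point_functional[OF morphism_bundle_map lie_algebra_finite_dimensional[OF br0]]

lemmas gamma_kernel_iff = sections_kernel_bundle[OF morphism_bundle h_dim morphism_functional surj]
  and kernel_vector_bundle = vector_bundle_kernel[OF morphism_bundle h_dim morphism_functional surj]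
  and kernel_frames_iff = frames_kernel_bundle[OF morphism_bundle h_dim morphism_functional surj]

text \<open>A section with constant image has a decomposition with one term and coefficient 1. Both
  anchor terms of the morphism condition then differentiate a constant, and only the bracket of
  \<open>'h\<close> is left.\<close>

lemma morphism_constant_bracket:
  assumes a: "a \<in> Gamma A" "\<And>p. F p (a p) = y"
    and b: "b \<in> Gamma A" "\<And>p. F p (b p) = z"
  shows "F p (bracket A a b p) = br0 y z"
proof -
  have sec: "Y \<in> sections (trivial_bundle point_manifold)" for Y :: "unit \<Rightarrow> 'h"
    by (simp add: sections_trivial_iff[OF smooth_manifold_point h_dim])
  have dec: "decomposition A (point_algebroid br0) (\<lambda>_. ()) F c 1 (\<lambda>_ _. 1) (\<lambda>_ _. w)"
    if "\<And>p. F p (c p) = w" for c w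
    unfolding decomposition_def using that sec smooth_funs_const[OF morphism_manifold] by simp
  have tan: "anchor A p (c p) (\<lambda>_. t) = 0" if "c \<in> Gamma A" for c t
    using tangent_space_const[OF morphism_manifold vector_fieldsD(1)[OF morphism_manifold
          anchor_vf_vector_field[OF morphism_algebroid that]], of p]
    by (simp add: anchor_vf_def)
  have "F p (bracket A a b p) =
      (\<Sum>i<(1::nat). \<Sum>j<(1::nat). (1 * 1) *\<^sub>R bracket (point_algebroid br0) (\<lambda>_. y) (\<lambda>_. z) ())
      + (\<Sum>j<(1::nat). anchor A p (a p) (\<lambda>_. 1) *\<^sub>R z) - (\<Sum>i<(1::nat). anchor A p (b p) (\<lambda>_. 1) *\<^sub>R y)"
    using F a(1) b(1) dec[OF a(2)] dec[OF b(2)] unfolding lie_algebroid_morphism_def by blast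
  then show ?thesis using tan a(1) b(1) by simp
qed

text \<open>Kernel sections have constant image 0, and \<open>br0 y 0 = 0\<close>. With
  \<open>y = 0\<close> this closes the kernel under the bracket; with \<open>a\<close> the lift of
  \<open>y\<close> it makes \<open>nabla\<close> map kernel sections to kernel sections.\<close>

lemma gamma_kernel_bracket:
  assumes "a \<in> Gamma A" "\<And>p. F p (a p) = y" "b \<in> sections (kernel_bundle (vbun A) F)"
  shows "bracket A a b \<in> sections (kernel_bundle (vbun A) F)"
proof -
  have b: "b \<in> Gamma A" "\<And>p. F p (b p) = 0"
    using assms(3) by (simp_all add: gamma_kernel_iff)
  have "br0 y 0 = 0" using lie_algebra_bilinear[OF br0] by (rule bilinear_rzero)
  then show ?thesis
    using morphism_constant_bracket[OF assms(1,2) b] bracket_closed[OF morphism_algebroid assms(1) b(1)]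
    by (simp add: gamma_kernel_iff)
qed

text \<open>The identities restrict because kernel sections are ambient sections. What remains is
  closure, and smoothness of the anchor on kernel frames, which holds because these are smooth in
  the ambient bundle.\<close>

lemma lie_algebroid_kernel: "lie_algebroid (kernel_algebroid A F)"
proof (rule lie_algebroidI, unfold kernel_algebroid_simps)
  note A = morphism_algebroid
  show "vector_bundle (kernel_bundle (vbun A) F)" by (rule kernel_vector_bundle)
  show "anchor_map (kernel_bundle (vbun A) F) (anchor A)"
  proof -
    have "smooth_fun_on (base (vbun A)) U (\<lambda>p. anchor A p (e i p) f)"
      if "(U, e) \<in> frames (kernel_bundle (vbun A) F)" "i < brank (kernel_bundle (vbun A) F)"
        "f \<in> smooth_funs (base (vbun A))" for U e i f
    proof (rule smooth_functional_section[OF morphism_bundle anchor_map_functional[OF algebroid_anchor[OF A] that(3)]])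
      show "openin (mtop (base (vbun A))) U"
        using that(1) by (simp only: kernel_frames_iff)
      show "smooth_section_on (vbun A) U (e i)"
        using that(1,2) by (simp only: kernel_frames_iff kernel_bundle_simps)
    qed
    then show ?thesis
      using algebroid_anchor[OF A] unfolding anchor_map_def by auto
  qed
  show "bracket A a b \<in> sections (kernel_bundle (vbun A) F)"
    if "a \<in> sections (kernel_bundle (vbun A) F)" "b \<in> sections (kernel_bundle (vbun A) F)" for a b
    using that by (intro gamma_kernel_bracket[of a 0]) (simp_all add: gamma_kernel_iff)
  show "bracket A a b p = - bracket A b a p"
    if "a \<in> sections (kernel_bundle (vbun A) F)" "b \<in> sections (kernel_bundle (vbun A) F)" for a b p
    by (rule bracket_anti[OF A]) (use that in \<open>simp_all add: gamma_kernel_iff\<close>)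
qed (simp_all add: gamma_kernel_iff bracket_add_left[OF morphism_algebroid]
    bracket_scaleR_left[OF morphism_algebroid] bracket_jacobi[OF morphism_algebroid]
    bracket_leibniz[OF morphism_algebroid] anchor_vf_bracket[OF morphism_algebroid])

text \<open>\<open>F\<close> is given over the map to the point, while the sequence needs it over
  the identity of M. The fibre maps are the same, and smoothness is retested with linear
  functionals.\<close>

lemma bundle_ses_kernel:
  "bundle_ses (kernel_bundle (vbun A) F) (vbun A) (trivial_bundle (base (vbun A))) (\<lambda>p e. e) F"
proof -
  note M = morphism_manifold and B = morphism_bundle
  have "bundle_map (kernel_bundle (vbun A) F) (vbun A) id (\<lambda>p e. e)"
    unfolding bundle_map_def
  proof (intro conjI)
    show "\<forall>(U, e)\<in>frames (kernel_bundle (vbun A) F). \<forall>i<brank (kernel_bundle (vbun A) F).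
        smooth_along (vbun A) (base (kernel_bundle (vbun A) F)) id U (\<lambda>p. e i p)"
      unfolding kernel_bundle_simps by (clarify, simp only: kernel_frames_iff)
  qed (use kernel_vector_bundle B smooth_map_id[OF M] in auto)
  moreover have "bundle_map (vbun A) (trivial_bundle (base (vbun A))) id F"
    unfolding bundle_map_def
  proof (intro conjI)
    show "vector_bundle (trivial_bundle (base (vbun A)) :: ('n, 'h) vbundle)"
      by (rule vector_bundle_trivial[OF M h_dim])
    show "smooth_map (base (vbun A)) (base (trivial_bundle (base (vbun A)) :: ('n, 'h) vbundle)) id"
      using smooth_map_id[OF M] by simp
    show "\<forall>(U, e)\<in>frames (vbun A). \<forall>i<brank (vbun A).
        smooth_along (trivial_bundle (base (vbun A))) (base (vbun A)) id U (\<lambda>p. F p (e i p))"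
    proof clarify
      fix U e i assume e: "(U, e) \<in> frames (vbun A)" "i < brank (vbun A)"
      show "smooth_along (trivial_bundle (base (vbun A))) (base (vbun A)) id U (\<lambda>p. F p (e i p))"
      proof (rule smooth_along_trivial_iff[THEN iffD2, OF M h_dim vector_bundle_frameD(1)[OF B e(1)]], intro allI impI)
        fix l :: "'h \<Rightarrow> real" assume l: "linear l"
        show "smooth_fun_on (base (vbun A)) U (\<lambda>p. l (F p (e i p)))"
          by (rule smooth_functional_section[OF B morphism_functional[OF l]
              vector_bundle_frameD(1)[OF B e(1)] vector_bundle_frameD(2)[OF B e]])
      qed
    qed
  qed (use B morphism_bundle_map in \<open>auto simp: bundle_map_def\<close>)
  moreover have "fibrewise_exact (kernel_bundle (vbun A) F) (vbun A) (trivial_bundle (base (vbun A))) (\<lambda>p e. e) id F"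
    using surj by (simp add: fibrewise_exact_def)
  ultimately show ?thesis by (simp add: bundle_ses_def)
qed

section \<open>Lifts of constants, curvature and the axioms of the action\<close>

context
  fixes \<sigma> :: "'n \<Rightarrow> 'h \<Rightarrow> 'w"
  assumes \<sigma>: "bundle_splitting (vbun A) (trivial_bundle (base (vbun A))) F \<sigma>"
begin

lemma splitting_linear: "\<sigma> p (y + z) = \<sigma> p y + \<sigma> p z" "\<sigma> p (c *\<^sub>R y) = c *\<^sub>R \<sigma> p y"
  and splitting_right_inverse: "F p (\<sigma> p y) = y"
  using \<sigma> by (simp_all add: bundle_splitting_def bundle_map_def)

text \<open>Smoothness of the bundle map \<open>\<sigma>\<close> is demanded on frames only. A basis
  of \<open>'h\<close> is a constant frame, and \<open>y\<close> is a combination of it with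
  constant coefficients.\<close>

lemma splitting_section: "(\<lambda>p. \<sigma> p y) \<in> Gamma A"
proof -
  let ?d = "dim (UNIV :: 'h set)"
  note B = morphism_bundle and M = morphism_manifold
  have fib: "\<sigma> p z \<in> fibre (vbun A) p" for p z
    using \<sigma> by (simp add: bundle_splitting_def bundle_map_def)
  obtain b where b: "basis_family {..<?d} b (UNIV :: 'h set)"
    using finite_dimensional_basis[OF h_dim] .
  have fr: "(UNIV, \<lambda>i _. b i) \<in> frames (trivial_bundle (base (vbun A)) :: ('n, 'h) vbundle)"
    using b by (auto simp: frames_trivial_bundle)
  have bs: "(\<lambda>p. \<sigma> p (b i)) \<in> Gamma A" if "i < ?d" for i
  proof -
    have all: "\<forall>(U, e)\<in>frames (trivial_bundle (base (vbun A)) :: ('n, 'h) vbundle). \<forall>i<?d.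
        smooth_along (vbun A) (base (vbun A)) id U (\<lambda>p. \<sigma> p (e i p))"
      using \<sigma> unfolding bundle_splitting_def bundle_map_def trivial_bundle_simps by blast
    have "\<forall>i<?d. smooth_section_on (vbun A) UNIV (\<lambda>p. \<sigma> p (b i))"
      using bspec[OF all fr] by (simp only: prod.case)
    then have "smooth_section_on (vbun A) UNIV (\<lambda>p. \<sigma> p (b i))"
      using that by (elim allE impE) assumption
    then show ?thesis using fib by (simp add: sections_def)
  qed
  obtain a where a: "y = (\<Sum>i<?d. a i *\<^sub>R b i)" using basis_familyD(3)[OF b UNIV_I, of y] by (rule exE)
  have lin: "linear (\<sigma> p)" for p using splitting_linear by (intro linearI)
  have "(\<lambda>p. \<Sum>i<?d. a i *\<^sub>R \<sigma> p (b i)) \<in> Gamma A"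
    using bs by (intro sections_sum[OF B] sections_scaleR[OF B]) simp
  then show ?thesis by (simp add: a linear_sum[OF lin] linear_scale[OF lin])
qed

lemma splitting_curvature_section:
  "(\<lambda>p. bracket A (\<lambda>q. \<sigma> q y) (\<lambda>q. \<sigma> q z) p - \<sigma> p (br0 y z)) \<in> sections (kernel_bundle (vbun A) F)"
proof -
  note A = morphism_algebroid
  have br: "bracket A (\<lambda>q. \<sigma> q y) (\<lambda>q. \<sigma> q z) \<in> Gamma A"
    by (intro bracket_closed[OF A] splitting_section)
  have "F p (bracket A (\<lambda>q. \<sigma> q y) (\<lambda>q. \<sigma> q z) p) = br0 y z" for p
    by (intro morphism_constant_bracket splitting_section splitting_right_inverse)
  moreover have "F p (v - w) = F p v - F p w"
    if "v \<in> fibre (vbun A) p" "w \<in> fibre (vbun A) p" for v w p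
    using fibre_map_add[OF morphism_bundle h_dim morphism_functional surj that(1), of "- 1 *\<^sub>R w"]
      fibre_map_scale[OF morphism_bundle h_dim morphism_functional surj that(2), of "-1"]
      subspace_scale[OF vector_bundle_subspace[OF morphism_bundle] that(2), of "-1"] by simp
  ultimately show ?thesis
    using gamma_diff[OF A br splitting_section] gamma_fibre[OF A br] gamma_fibre[OF A splitting_section]
    by (simp add: gamma_kernel_iff splitting_right_inverse)
qed

lemma splitting_action:
  "action_up_to_homotopy br0 (kernel_algebroid A F)
     (\<lambda>y. anchor_vf A (\<lambda>p. \<sigma> p y))
     (\<lambda>y. bracket A (\<lambda>p. \<sigma> p y))
     (\<lambda>y0 y1 p. bracket A (\<lambda>q. \<sigma> q y0) (\<lambda>q. \<sigma> q y1) p - \<sigma> p (br0 y0 y1))"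
proof -
  note A = morphism_algebroid
  let ?K = "sections (kernel_bundle (vbun A) F)" and ?S = "\<lambda>y p. \<sigma> p y"
  let ?\<omega> = "\<lambda>y z p. bracket A (?S y) (?S z) p - ?S (br0 y z) p"
  have K: "s \<in> Gamma A" if "s \<in> ?K" for s using that by (simp add: gamma_kernel_iff)
  note S = splitting_section
  note \<omega>K = splitting_curvature_section
  have bil: "bilinear br0" using lie_algebra_bilinear[OF br0] .
  have Sbr: "?S (br0 y z) \<in> Gamma A" for y z by (rule S)
  have SS: "bracket A (?S y) (?S z) \<in> Gamma A" for y z
    by (intro bracket_closed[OF A] S)
  have Sadd: "?S (y + z) = (\<lambda>p. ?S y p + ?S z p)" for y z by (simp add: splitting_linear)
  have Sscale: "?S (c *\<^sub>R y) = (\<lambda>p. c *\<^sub>R ?S y p)" for c y by (simp add: splitting_linear)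
  have S0: "\<sigma> p 0 = 0" for p using splitting_linear(2)[of p 0 0] by simp
  have nablaK: "bracket A (?S y) s \<in> ?K" if "s \<in> ?K" for y s
    by (rule gamma_kernel_bracket[OF S splitting_right_inverse that])
  \<comment> \<open>The derivation form of Jacobi leaves the bracket of \<open>s\<close> with the
    bracket of the two lifts; subtracting the lift of \<open>br0 y z\<close> inside turns it into
    \<open>\<omega>\<close>.\<close>
  have jac: "bracket A (?S y) (bracket A (?S z) s) p - bracket A (?S z) (bracket A (?S y) s) p
      - bracket A (?S (br0 y z)) s p = bracket A (?\<omega> y z) s p" if "s \<in> ?K" for y z s p
    using bracket_jacobi_derivation[OF A S[of y] S[of z] K[OF that], of p]
      bracket_diff_left[OF A SS[of y z] Sbr[of y z] K[OF that]] by simp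
  have bilin: "bilinear (\<lambda>y z. ?\<omega> y z p)" for p
    unfolding bilinear_def
  proof (intro conjI allI linearI)
    fix x y z :: 'h and c :: real
    show "?\<omega> x (y + z) p = ?\<omega> x y p + ?\<omega> x z p"
      using bracket_add_right[OF A S[of y] S[of z] S[of x]] by (simp add: Sadd splitting_linear bilinear_radd[OF bil])
    show "?\<omega> x (c *\<^sub>R y) p = c *\<^sub>R ?\<omega> x y p"
      using bracket_scaleR_right[OF A S[of x] S[of y]] by (simp add: Sscale splitting_linear bilinear_rmul[OF bil] scaleR_diff_right)
    show "?\<omega> (y + z) x p = ?\<omega> y x p + ?\<omega> z x p"
      using bracket_add_left[OF A S[of y] S[of z] S[of x]] by (simp add: Sadd splitting_linear bilinear_ladd[OF bil])
    show "?\<omega> (c *\<^sub>R y) x p = c *\<^sub>R ?\<omega> y x p"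
      using bracket_scaleR_left[OF A S[of y] S[of x]] by (simp add: Sscale splitting_linear bilinear_lmul[OF bil] scaleR_diff_right)
  qed
  have alt: "?\<omega> y y p = 0" for y p
  proof -
    have "bracket A (?S y) (?S y) p = - bracket A (?S y) (?S y) p" by (rule bracket_anti[OF A S S])
    then have "2 *\<^sub>R bracket A (?S y) (?S y) p = 0" by (simp add: scaleR_2 eq_neg_iff_add_eq_0)
    moreover have "br0 y y = 0" using br0 by (simp add: lie_algebra_def)
    ultimately show ?thesis by (simp add: S0)
  qed
  \<comment> \<open>Three kinds of terms vanish separately: the triple brackets of lifts by Jacobi
    in \<open>A\<close>, the brackets of a lift with a lifted bracket in pairs by antisymmetry, and
    the lifts of double brackets by Jacobi in \<open>'h\<close>.\<close>
  have d0: "d_nabla br0 (\<lambda>y. bracket A (?S y)) ?\<omega> y0 y1 y2 p = 0" for y0 y1 y2 p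
  proof -
    have n: "bracket A (?S x) (?\<omega> y z) p = bracket A (?S x) (bracket A (?S y) (?S z)) p - bracket A (?S x) (?S (br0 y z)) p"
      for x y z by (rule bracket_diff_right[OF A SS Sbr S])
    have an: "bracket A (?S (br0 x y)) (?S z) p = - bracket A (?S z) (?S (br0 x y)) p" for x y z
      by (rule bracket_anti[OF A S S])
    have j: "bracket A (?S y0) (bracket A (?S y1) (?S y2)) p =
        bracket A (bracket A (?S y0) (?S y1)) (?S y2) p + bracket A (?S y1) (bracket A (?S y0) (?S y2)) p"
      by (rule bracket_jacobi_derivation[OF A S S S])
    have j': "bracket A (bracket A (?S y0) (?S y1)) (?S y2) p = - bracket A (?S y2) (bracket A (?S y0) (?S y1)) p"
      by (rule bracket_anti[OF A SS S])
    have anti: "br0 (br0 y0 y1) y2 = - br0 y2 (br0 y0 y1)" "br0 (br0 y1 y2) y0 = - br0 y0 (br0 y1 y2)"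
      "br0 (br0 y0 y2) y1 = - br0 y1 (br0 y0 y2)" "br0 y0 y2 = - br0 y2 y0"
      by (rule lie_algebra_anti[OF br0])+
    \<comment> \<open>The minus sign is written as \<open>- 1 *\<^sub>R\<close> because
      \<open>splitting_linear\<close> offers only additivity and scaling.\<close>
    then have "br0 (br0 y0 y1) y2 + - 1 *\<^sub>R br0 (br0 y0 y2) y1 + br0 (br0 y1 y2) y0 =
        - (br0 y0 (br0 y1 y2) + br0 y1 (br0 y2 y0) + br0 y2 (br0 y0 y1))"
      using bilinear_rneg[OF bil, of y1 "br0 y2 y0"] by simp
    then have "br0 (br0 y0 y1) y2 + - 1 *\<^sub>R br0 (br0 y0 y2) y1 + br0 (br0 y1 y2) y0 = 0"
      by (simp only: lie_algebra_jacobi[OF br0] minus_zero)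
    then have "\<sigma> p (br0 (br0 y0 y1) y2 + - 1 *\<^sub>R br0 (br0 y0 y2) y1 + br0 (br0 y1 y2) y0) = 0"
      by (simp only: S0)
    then have s: "\<sigma> p (br0 (br0 y0 y1) y2) - \<sigma> p (br0 (br0 y0 y2) y1) + \<sigma> p (br0 (br0 y1 y2) y0) = 0"
      by (simp only: splitting_linear) simp
    show ?thesis
      unfolding d_nabla_def n an[of y0 y1] an[of y0 y2] an[of y1 y2] j j'
      using s by (simp add: algebra_simps)
  qed
  show ?thesis
    unfolding action_up_to_homotopy_def Let_def kernel_algebroid_simps kernel_bundle_simps
  proof (intro conjI allI ballI ext)
    show "lie_algebra br0" by (rule br0)
    show "lie_algebroid (kernel_algebroid A F)" by (rule lie_algebroid_kernel)
    show "anchor_vf A (?S y) \<in> vector_fields (base (vbun A))" for y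
      by (rule anchor_vf_vector_field[OF A S])
    show "anchor_vf A (?S (y + z)) p f = anchor_vf A (?S y) p f + anchor_vf A (?S z) p f" for y z p f
      unfolding Sadd by (rule anchor_vf_add[OF A S S])
    show "anchor_vf A (?S (c *\<^sub>R y)) p f = c * anchor_vf A (?S y) p f" for c y p f
      unfolding Sscale by (rule anchor_vf_scale[OF A S])
    fix y z :: 'h and s assume s: "s \<in> ?K"
    show "bracket A (?S y) s \<in> ?K" by (rule nablaK[OF s])
    show "bracket A (?S (y + z)) s p = bracket A (?S y) s p + bracket A (?S z) s p" for p
      unfolding Sadd by (rule bracket_add_left[OF A S S K[OF s]])
    show "bracket A (?S (c *\<^sub>R y)) s p = c *\<^sub>R bracket A (?S y) s p" for c p
      unfolding Sscale by (rule bracket_scaleR_left[OF A S K[OF s]])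
    show "bracket A (?S y) (\<lambda>p. c *\<^sub>R s p) p = c *\<^sub>R bracket A (?S y) s p" for c p
      by (rule bracket_scaleR_right[OF A S K[OF s]])
    show "bracket A (?S y) (\<lambda>p. f p *\<^sub>R s p) p = f p *\<^sub>R bracket A (?S y) s p + anchor_vf A (?S y) p f *\<^sub>R s p"
      if "f \<in> smooth_funs (base (vbun A))" for f p
      by (rule bracket_leibniz[OF A S K[OF s] that])
    show "anchor_vf A (bracket A (?S y) s) p f = vf_bracket (anchor_vf A (?S y)) (anchor_vf A s) p f" for p f
      by (simp add: anchor_vf_bracket[OF A S K[OF s]])
    show "bracket A (?S y) (bracket A (?S z) s) p - bracket A (?S z) (bracket A (?S y) s) p
      - bracket A (?S (br0 y z)) s p = bracket A (?\<omega> y z) s p" for p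
      by (rule jac[OF s])
    fix t assume t: "t \<in> ?K"
    show "bracket A (?S y) (\<lambda>p. s p + t p) p = bracket A (?S y) s p + bracket A (?S y) t p" for p
      by (rule bracket_add_right[OF A K[OF s] K[OF t] S])
    show "bracket A (?S y) (bracket A s t) p = bracket A (bracket A (?S y) s) t p + bracket A s (bracket A (?S y) t) p" for p
      by (rule bracket_jacobi_derivation[OF A S K[OF s] K[OF t]])
  next
    show "?\<omega> y z \<in> ?K" for y z by (rule \<omega>K)
    show "bilinear (\<lambda>y z. ?\<omega> y z p)" for p by (rule bilin)
    show "?\<omega> y y p = 0" for y p by (rule alt)
    show "vf_bracket (anchor_vf A (?S y)) (anchor_vf A (?S z)) p f - anchor_vf A (?S (br0 y z)) p f
        = anchor_vf A (?\<omega> y z) p f" for y z p f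
      by (simp add: anchor_vf_diff[OF A SS Sbr] anchor_vf_bracket[OF A S S])
    show "d_nabla br0 (\<lambda>y. bracket A (?S y)) ?\<omega> y0 y1 y2 p = 0" for y0 y1 y2 p by (rule d0)
  qed
qed

end

end


section \<open>Tensoriality of the Jacobiator\<close>

context
  fixes L :: "('m, 'v::real_vector) algebroid"
  assumes B: "vector_bundle (vbun L)" and anc: "anchor_map (vbun L) (anchor L)"
    and closed: "\<And>a b. a \<in> Gamma L \<Longrightarrow> b \<in> Gamma L \<Longrightarrow> bracket L a b \<in> Gamma L"
    and add: "\<And>a b c p. a \<in> Gamma L \<Longrightarrow> b \<in> Gamma L \<Longrightarrow> c \<in> Gamma L \<Longrightarrow>
      bracket L a (\<lambda>p. b p + c p) p = bracket L a b p + bracket L a c p"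
    and anti: "\<And>a b p. a \<in> Gamma L \<Longrightarrow> b \<in> Gamma L \<Longrightarrow> bracket L a b p = - bracket L b a p"
    and leib: "\<And>a b f p. a \<in> Gamma L \<Longrightarrow> b \<in> Gamma L \<Longrightarrow> f \<in> smooth_funs (base (vbun L)) \<Longrightarrow>
      bracket L a (\<lambda>p. f p *\<^sub>R b p) p = f p *\<^sub>R bracket L a b p + anchor_vf L a p f *\<^sub>R b p"
begin

lemmas anchor_base = vector_bundle_manifold[OF B]

lemma anchor_field: "a \<in> Gamma L \<Longrightarrow> anchor_vf L a \<in> vector_fields (base (vbun L))"
  unfolding anchor_vf_def by (rule anchor_map_vector_field[OF B anc])

lemma anchor_field_tangent: "a \<in> Gamma L \<Longrightarrow> anchor_vf L a p \<in> tangent_space (base (vbun L)) p"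
  using vector_fieldsD(1)[OF anchor_base anchor_field] .

lemma anchor_vf_lin:
  "a \<in> Gamma L \<Longrightarrow> b \<in> Gamma L \<Longrightarrow>
     anchor_vf L (\<lambda>p. a p + b p) p f = anchor_vf L a p f + anchor_vf L b p f"
  "a \<in> Gamma L \<Longrightarrow> anchor_vf L (\<lambda>p. g p *\<^sub>R a p) p f = g p * anchor_vf L a p f"
  using anc sections_fibre[OF B] unfolding anchor_map_def anchor_vf_def by blast+

text \<open>In this context the bracket is additive, antisymmetric and Leibniz, while Jacobi and
  compatibility with the anchor are still open. For smooth \<open>f\<close> both sides are additive
  in the right argument; for other \<open>f\<close> both are 0.\<close>

lemma anchor_defect_add:
  assumes a: "a \<in> Gamma L" and b: "b \<in> Gamma L" and c: "c \<in> Gamma L"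
    and hb: "\<And>p f. anchor_vf L (bracket L a b) p f = vf_bracket (anchor_vf L a) (anchor_vf L b) p f"
    and hc: "\<And>p f. anchor_vf L (bracket L a c) p f = vf_bracket (anchor_vf L a) (anchor_vf L c) p f"
  shows "anchor_vf L (bracket L a (\<lambda>p. b p + c p)) p f =
    vf_bracket (anchor_vf L a) (anchor_vf L (\<lambda>p. b p + c p)) p f"
proof (cases "f \<in> smooth_funs (base (vbun L))")
  case False
  then show ?thesis
    using tangent_space_nonsmooth[OF anchor_field_tangent[OF closed[OF a sections_add[OF B b c]]]]
      vf_bracket_nonsmooth[OF anchor_base anchor_field[OF a] anchor_field[OF sections_add[OF B b c]]] by simp
next
  case True
  have "bracket L a (\<lambda>p. b p + c p) = (\<lambda>p. bracket L a b p + bracket L a c p)"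
    using add[OF a b c] by blast
  then have "anchor_vf L (bracket L a (\<lambda>p. b p + c p)) p f =
      anchor_vf L (bracket L a b) p f + anchor_vf L (bracket L a c) p f"
    using anchor_vf_lin(1)[OF closed[OF a b] closed[OF a c]] by simp
  moreover have "(\<lambda>q. anchor_vf L (\<lambda>p. b p + c p) q f) = (\<lambda>q. anchor_vf L b q f + anchor_vf L c q f)"
    using anchor_vf_lin(1)[OF b c] by blast
  ultimately show ?thesis
    using tangent_space_add[OF anchor_field_tangent[OF a, of p] vector_fieldsD(2)[OF anchor_base anchor_field[OF b] True] vector_fieldsD(2)[OF anchor_base anchor_field[OF c] True]]
    by (simp add: hb hc vf_bracket_def anchor_vf_lin(1)[OF b c])
qed

text \<open>Both sides produce the same extra term \<rho>(a)(g) \<rho>(b), one from the Leibniz rule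
  of the bracket, the other from the product rule of the derivation \<rho>(a).\<close>

lemma anchor_defect_scale:
  assumes a: "a \<in> Gamma L" and b: "b \<in> Gamma L" and g: "g \<in> smooth_funs (base (vbun L))"
    and hb: "\<And>p f. anchor_vf L (bracket L a b) p f = vf_bracket (anchor_vf L a) (anchor_vf L b) p f"
  shows "anchor_vf L (bracket L a (\<lambda>p. g p *\<^sub>R b p)) p f =
    vf_bracket (anchor_vf L a) (anchor_vf L (\<lambda>p. g p *\<^sub>R b p)) p f"
proof (cases "f \<in> smooth_funs (base (vbun L))")
  case False
  then show ?thesis
    using tangent_space_nonsmooth[OF anchor_field_tangent[OF closed[OF a sections_scale[OF B g b]]]]
      vf_bracket_nonsmooth[OF anchor_base anchor_field[OF a] anchor_field[OF sections_scale[OF B g b]]] by simp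
next
  case True
  have ag: "(\<lambda>p. anchor_vf L a p g) \<in> smooth_funs (base (vbun L))"
    using vector_fieldsD(2)[OF anchor_base anchor_field[OF a] g] .
  have "bracket L a (\<lambda>p. g p *\<^sub>R b p) = (\<lambda>p. g p *\<^sub>R bracket L a b p + anchor_vf L a p g *\<^sub>R b p)"
    using leib[OF a b g] by blast
  then have "anchor_vf L (bracket L a (\<lambda>p. g p *\<^sub>R b p)) p f =
      g p * anchor_vf L (bracket L a b) p f + anchor_vf L a p g * anchor_vf L b p f"
    using anchor_vf_lin(1)[OF sections_scale[OF B g closed[OF a b]] sections_scale[OF B ag b]]
      anchor_vf_lin(2)[OF closed[OF a b], of g] anchor_vf_lin(2)[OF b, of "\<lambda>p. anchor_vf L a p g"] by simp
  moreover have "(\<lambda>q. anchor_vf L (\<lambda>p. g p *\<^sub>R b p) q f) = (\<lambda>q. g q * anchor_vf L b q f)"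
    using anchor_vf_lin(2)[OF b] by blast
  ultimately show ?thesis
    using tangent_space_mult[OF anchor_field_tangent[OF a, of p] g vector_fieldsD(2)[OF anchor_base anchor_field[OF b] True]]
    by (simp add: hb vf_bracket_def anchor_vf_lin(2)[OF b] algebra_simps)
qed

text \<open>Additivity and scaling are available in the right argument only; antisymmetry carries
  the result over to the left one.\<close>

lemma anchor_defect_swap:
  assumes a: "a \<in> Gamma L" and b: "b \<in> Gamma L"
    and h: "anchor_vf L (bracket L a b) p f = vf_bracket (anchor_vf L a) (anchor_vf L b) p f"
  shows "anchor_vf L (bracket L b a) p f = vf_bracket (anchor_vf L b) (anchor_vf L a) p f"
proof -
  have "bracket L b a = (\<lambda>p. -1 *\<^sub>R bracket L a b p)" by (rule ext) (simp add: anti[OF b a])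
  then have "anchor_vf L (bracket L b a) p f = - anchor_vf L (bracket L a b) p f"
    using anchor_vf_lin(2)[OF closed[OF a b], of "\<lambda>_. -1"] by simp
  with h show ?thesis by (simp add: vf_bracket_def)
qed

abbreviation jacobiator :: "('m \<Rightarrow> 'v) \<Rightarrow> ('m \<Rightarrow> 'v) \<Rightarrow> ('m \<Rightarrow> 'v) \<Rightarrow> 'm \<Rightarrow> 'v" where
  "jacobiator a b c p \<equiv>
     bracket L a (bracket L b c) p + bracket L b (bracket L c a) p + bracket L c (bracket L a b) p"

text \<open>This form has \<open>c\<close> in the right slot of every bracket in which it occurs,
  the slot in which additivity and the Leibniz rule are assumed.\<close>

lemma jacobiator_alt:
  assumes a: "a \<in> Gamma L" and b: "b \<in> Gamma L" and c: "c \<in> Gamma L"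
  shows "jacobiator a b c p =
    bracket L a (bracket L b c) p - bracket L b (bracket L a c) p - bracket L (bracket L a b) c p"
proof -
  have "bracket L c a = (\<lambda>p. (- 1) *\<^sub>R bracket L a c p)" by (rule ext) (simp add: anti[OF c a])
  \<comment> \<open>Real homogeneity is not among the assumptions; it is the Leibniz rule for a
    constant function, whose derivative is 0.\<close>
  moreover have "bracket L b (\<lambda>p. (- 1) *\<^sub>R bracket L a c p) p = - bracket L b (bracket L a c) p"
    using leib[OF b closed[OF a c] smooth_funs_const[OF anchor_base], of "- 1"] tangent_space_const[OF anchor_base anchor_field_tangent[OF b]] by simp
  moreover have "bracket L c (bracket L a b) p = - bracket L (bracket L a b) c p"
    by (rule anti[OF c closed[OF a b]])
  ultimately show ?thesis by simp
qed

lemma jacobiator_add: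
  assumes a: "a \<in> Gamma L" and b: "b \<in> Gamma L" and c: "c \<in> Gamma L"
    and d: "d \<in> Gamma L"
  shows "jacobiator a b (\<lambda>p. c p + d p) p = jacobiator a b c p + jacobiator a b d p"
proof -
  have "bracket L x (\<lambda>p. c p + d p) = (\<lambda>p. bracket L x c p + bracket L x d p)" if "x \<in> Gamma L" for x
    using add[OF that c d] by blast
  then show ?thesis
    unfolding jacobiator_alt[OF a b sections_add[OF B c d]] jacobiator_alt[OF a b c] jacobiator_alt[OF a b d]
    using add[OF a closed[OF b c] closed[OF b d]] add[OF b closed[OF a c] closed[OF a d]] a b closed[OF a b]
    by simp
qed

text \<open>In the expansion the terms with one derivative of \<open>f\<close> cancel between the
  two nested brackets and the bracket of \<open>bracket L a b\<close> with \<open>c\<close>, except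
  for those along \<open>c\<close>. The coefficient of \<open>c\<close> is the commutator of
  \<rho>(a) and \<rho>(b) minus \<rho>([a, b]), applied to \<open>f\<close>, and vanishes by
  \<open>h\<close>.\<close>

lemma jacobiator_scale:
  assumes a: "a \<in> Gamma L" and b: "b \<in> Gamma L" and c: "c \<in> Gamma L"
    and f: "f \<in> smooth_funs (base (vbun L))"
    and h: "\<And>p. anchor_vf L (bracket L a b) p f = vf_bracket (anchor_vf L a) (anchor_vf L b) p f"
  shows "jacobiator a b (\<lambda>p. f p *\<^sub>R c p) p = f p *\<^sub>R jacobiator a b c p"
proof -
  have e: "bracket L x (\<lambda>p. f p *\<^sub>R c p) = (\<lambda>p. f p *\<^sub>R bracket L x c p + anchor_vf L x p f *\<^sub>R c p)"
    if "x \<in> Gamma L" for x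
    using leib[OF that c f] by blast
  have sm: "(\<lambda>p. anchor_vf L x p f) \<in> smooth_funs (base (vbun L))" if "x \<in> Gamma L" for x
    using vector_fieldsD(2)[OF anchor_base anchor_field[OF that] f] .
  have ee: "bracket L x (bracket L y (\<lambda>p. f p *\<^sub>R c p)) p =
      f p *\<^sub>R bracket L x (bracket L y c) p + anchor_vf L x p f *\<^sub>R bracket L y c p
      + anchor_vf L y p f *\<^sub>R bracket L x c p + anchor_vf L x p (\<lambda>q. anchor_vf L y q f) *\<^sub>R c p"
    if x: "x \<in> Gamma L" and y: "y \<in> Gamma L" for x y
    unfolding e[OF y]
    using add[OF x sections_scale[OF B f closed[OF y c]] sections_scale[OF B sm[OF y] c]]
      leib[OF x closed[OF y c] f] leib[OF x c sm[OF y]] by simp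
  show ?thesis
    unfolding jacobiator_alt[OF a b sections_scale[OF B f c]] jacobiator_alt[OF a b c]
    unfolding ee[OF a b] ee[OF b a] e[OF closed[OF a b]] h vf_bracket_def
    by (simp add: algebra_simps)
qed

end


section \<open>The algebroid of an action up to homotopy\<close>

lemma tangent_space_times:
  assumes v: "v \<in> tangent_space M p"
  shows "(\<lambda>f. c * v f) \<in> tangent_space M p"
  unfolding tangent_space_def
  by (auto simp: tangent_space_add[OF v] tangent_space_scale[OF v] tangent_space_mult[OF v]
      tangent_space_nonsmooth[OF v] algebra_simps)

lemma vderiv_times:
  assumes M: "smooth_manifold M" and fd: "finite_dimensional TYPE('h::real_vector)"
    and v: "v \<in> tangent_space M p" and Y: "(Y :: 'm \<Rightarrow> 'h) \<in> sections (trivial_bundle M)"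
  shows "vderiv (\<lambda>f. c * v f) Y = c *\<^sub>R vderiv v Y"
  by (rule linear_functional_eqI[OF fd])
    (simp add: linear_vderiv[OF M fd tangent_space_times[OF v] Y] linear_vderiv[OF M fd v Y] linear_scale)

lemma vderiv_section:
  fixes Y :: "'m \<Rightarrow> 'h::real_vector"
  assumes M: "smooth_manifold M" and fd: "finite_dimensional TYPE('h)"
    and X: "X \<in> vector_fields M" and Y: "Y \<in> sections (trivial_bundle M)"
  shows "(\<lambda>p. vderiv (X p) Y) \<in> sections (trivial_bundle M)"
proof (rule sections_trivial_iff[THEN iffD2, OF M fd], intro allI impI)
  fix l :: "'h \<Rightarrow> real" assume l: "linear l"
  have "(\<lambda>p. X p (\<lambda>q. l (Y q))) \<in> smooth_funs M"
    by (rule vector_fieldsD(2)[OF M X sections_trivialD[OF M fd Y l]])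
  then show "(\<lambda>p. l (vderiv (X p) Y)) \<in> smooth_funs M"
    by (simp add: linear_vderiv[OF M fd vector_fieldsD(1)[OF M X] Y l])
qed

text \<open>In a fixed basis of \<open>'h\<close> the family is a combination of the fixed sections
  \<open>T (b i)\<close> with smooth coefficients. This allows \<open>nabla\<close>,
  \<open>\<omega>\<close> and \<open>br0\<close>, given for constant arguments, to be evaluated on
  varying \<open>'h\<close>-components.\<close>

lemma linear_family_section:
  fixes T :: "'h::real_vector \<Rightarrow> 'm \<Rightarrow> 'v::real_vector"
  assumes B: "vector_bundle B" and fd: "finite_dimensional TYPE('h)"
    and T: "\<And>y. T y \<in> sections B" and lin: "\<And>p. linear (\<lambda>y. T y p)"
    and Y: "Y \<in> sections (trivial_bundle (base B))"
  shows "(\<lambda>p. T (Y p) p) \<in> sections B"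
proof -
  let ?d = "dim (UNIV :: 'h set)"
  obtain b and \<kappa> :: "nat \<Rightarrow> 'h \<Rightarrow> real" where \<kappa>: "\<forall>i<?d. linear (\<kappa> i)" "\<forall>y. (\<Sum>i<?d. \<kappa> i y *\<^sub>R b i) = y"
    using finite_dimensional_coordinates[OF fd] by blast
  have "T (Y p) p = (\<Sum>i<?d. \<kappa> i (Y p) *\<^sub>R T (b i) p)" for p
  proof -
    have "T (Y p) p = T (\<Sum>i<?d. \<kappa> i (Y p) *\<^sub>R b i) p" using \<kappa>(2) by simp
    also have "\<dots> = (\<Sum>i<?d. \<kappa> i (Y p) *\<^sub>R T (b i) p)"
      by (simp only: linear_sum[OF lin] linear_scale[OF lin])
    finally show ?thesis .
  qed
  moreover have "(\<lambda>p. \<Sum>i<?d. \<kappa> i (Y p) *\<^sub>R T (b i) p) \<in> sections B"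
    using sections_trivialD[OF vector_bundle_manifold[OF B] fd Y] \<kappa>(1) T
    by (intro sections_sum[OF B] sections_scale[OF B]) auto
  ultimately show ?thesis by simp
qed

text \<open>
  The closed formula for the Leibniz extension: the terms without derivatives are tensorial in the
  \<open>'h\<close>-components, which are differentiated along the anchors.
\<close>

definition action_bracket ::
  "('h::real_vector \<Rightarrow> 'h \<Rightarrow> 'h) \<Rightarrow> ('m, 'v::real_vector) algebroid \<Rightarrow>
   ('h \<Rightarrow> 'm \<Rightarrow> ('m \<Rightarrow> real) \<Rightarrow> real) \<Rightarrow> ('h \<Rightarrow> ('m \<Rightarrow> 'v) \<Rightarrow> 'm \<Rightarrow> 'v) \<Rightarrow>
   ('h \<Rightarrow> 'h \<Rightarrow> 'm \<Rightarrow> 'v) \<Rightarrow> ('m \<Rightarrow> 'v \<times> 'h) \<Rightarrow> ('m \<Rightarrow> 'v \<times> 'h) \<Rightarrow> 'm \<Rightarrow> 'v \<times> 'h" where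
  "action_bracket br0 E \<alpha> nabla \<omega> a b = (\<lambda>p.
     (bracket E (\<lambda>q. fst (a q)) (\<lambda>q. fst (b q)) p + nabla (snd (a p)) (\<lambda>q. fst (b q)) p
        - nabla (snd (b p)) (\<lambda>q. fst (a q)) p + \<omega> (snd (a p)) (snd (b p)) p,
      br0 (snd (a p)) (snd (b p))
        + vderiv (\<lambda>f. anchor E p (fst (a p)) f + \<alpha> (snd (a p)) p f) (\<lambda>q. snd (b q))
        - vderiv (\<lambda>f. anchor E p (fst (b p)) f + \<alpha> (snd (b p)) p f) (\<lambda>q. snd (a q))))"

lemma product_algebroid_simps [simp]:
  "vbun (product_algebroid E \<alpha> br) = bundle_sum (vbun E) (trivial_bundle (base (vbun E)))"
  "anchor (product_algebroid E \<alpha> br) p v f = anchor E p (fst v) f + \<alpha> (snd v) p f"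
  "bracket (product_algebroid E \<alpha> br) = br"
  by (simp_all add: product_algebroid_def case_prod_beta)

context
  fixes br0 :: "'h::real_vector \<Rightarrow> 'h \<Rightarrow> 'h"
    and E :: "('m, 'v::real_vector) algebroid"
    and \<alpha> :: "'h \<Rightarrow> 'm \<Rightarrow> ('m \<Rightarrow> real) \<Rightarrow> real" and nabla and \<omega>
  assumes act: "action_up_to_homotopy br0 E \<alpha> nabla \<omega>"
begin

lemma action_facts:
  "lie_algebra br0" "lie_algebroid E"
  "\<forall>y. \<alpha> y \<in> vector_fields (base (vbun E))"
  "\<forall>y z p f. \<alpha> (y + z) p f = \<alpha> y p f + \<alpha> z p f"
  "\<forall>c y p f. \<alpha> (c *\<^sub>R y) p f = c * \<alpha> y p f"
  "\<forall>y. \<forall>s\<in>Gamma E. nabla y s \<in> Gamma E"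
  "\<forall>y z. \<forall>s\<in>Gamma E. nabla (y + z) s = (\<lambda>p. nabla y s p + nabla z s p)"
  "\<forall>c y. \<forall>s\<in>Gamma E. nabla (c *\<^sub>R y) s = (\<lambda>p. c *\<^sub>R nabla y s p)"
  "\<forall>y. \<forall>s\<in>Gamma E. \<forall>t\<in>Gamma E. nabla y (\<lambda>p. s p + t p) = (\<lambda>p. nabla y s p + nabla y t p)"
  "\<forall>c y. \<forall>s\<in>Gamma E. nabla y (\<lambda>p. c *\<^sub>R s p) = (\<lambda>p. c *\<^sub>R nabla y s p)"
  "\<forall>y z. \<omega> y z \<in> Gamma E" "\<forall>p. bilinear (\<lambda>y z. \<omega> y z p)" "\<forall>y p. \<omega> y y p = 0"
  "\<forall>y. \<forall>f\<in>smooth_funs (base (vbun E)). \<forall>s\<in>Gamma E.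
     nabla y (\<lambda>p. f p *\<^sub>R s p) = (\<lambda>p. f p *\<^sub>R nabla y s p + \<alpha> y p f *\<^sub>R s p)"
  "\<forall>y. \<forall>s\<in>Gamma E. \<forall>t\<in>Gamma E.
     nabla y (bracket E s t) = (\<lambda>p. bracket E (nabla y s) t p + bracket E s (nabla y t) p)"
  "\<forall>y. \<forall>s\<in>Gamma E. anchor_vf E (nabla y s) = vf_bracket (\<alpha> y) (anchor_vf E s)"
  "\<forall>y z. \<forall>s\<in>Gamma E.
     (\<lambda>p. nabla y (nabla z s) p - nabla z (nabla y s) p - nabla (br0 y z) s p) = bracket E (\<omega> y z) s"
  "\<forall>y z. (\<lambda>p f. vf_bracket (\<alpha> y) (\<alpha> z) p f - \<alpha> (br0 y z) p f) = anchor_vf E (\<omega> y z)"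
  "\<forall>y0 y1 y2. d_nabla br0 nabla \<omega> y0 y1 y2 = (\<lambda>_. 0)"
  using act unfolding action_up_to_homotopy_def Let_def by - (elim conjE, assumption)+

lemmas E_algebroid = action_facts(2) and h_lie = action_facts(1)
lemmas E_bundle = algebroid_bundle[OF E_algebroid] and E_manifold = algebroid_manifold[OF E_algebroid]
lemmas h_fin_dim = lie_algebra_finite_dimensional[OF h_lie] and h_bilinear = lie_algebra_bilinear[OF h_lie]

lemma alpha_add: "\<alpha> (y + z) p f = \<alpha> y p f + \<alpha> z p f"
  and alpha_scale: "\<alpha> (c *\<^sub>R y) p f = c * \<alpha> y p f"
  and alpha_vf: "\<alpha> y \<in> vector_fields (base (vbun E))"
  and omega_section: "\<omega> y z \<in> Gamma E"
  and omega_bil: "bilinear (\<lambda>y z. \<omega> y z p)"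
  using action_facts(3-5,11,12) by simp_all

lemma alpha_zero: "\<alpha> 0 p f = 0"
  using alpha_scale[of 0 0 p f] by simp

lemma nabla_section: "s \<in> Gamma E \<Longrightarrow> nabla y s \<in> Gamma E"
  and nabla_add_left: "s \<in> Gamma E \<Longrightarrow> nabla (y + z) s p = nabla y s p + nabla z s p"
  and nabla_scale_left: "s \<in> Gamma E \<Longrightarrow> nabla (c *\<^sub>R y) s p = c *\<^sub>R nabla y s p"
  using action_facts(6-8) by simp_all

lemma nabla_add:
  "s \<in> Gamma E \<Longrightarrow> t \<in> Gamma E \<Longrightarrow> nabla y (\<lambda>p. s p + t p) p = nabla y s p + nabla y t p"
  and nabla_scale: "s \<in> Gamma E \<Longrightarrow> nabla y (\<lambda>p. c *\<^sub>R s p) p = c *\<^sub>R nabla y s p"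
  and nabla_leibniz: "s \<in> Gamma E \<Longrightarrow> f \<in> smooth_funs (base (vbun E)) \<Longrightarrow>
     nabla y (\<lambda>p. f p *\<^sub>R s p) p = f p *\<^sub>R nabla y s p + \<alpha> y p f *\<^sub>R s p"
  and nabla_bracket: "s \<in> Gamma E \<Longrightarrow> t \<in> Gamma E \<Longrightarrow>
     nabla y (bracket E s t) p = bracket E (nabla y s) t p + bracket E s (nabla y t) p"
  using action_facts(9,10,14,15) by simp_all

lemma nabla_diff:
  assumes "s \<in> Gamma E" "t \<in> Gamma E"
  shows "nabla y (\<lambda>p. s p - t p) p = nabla y s p - nabla y t p"
  using nabla_add[OF assms(1) gamma_scaleR[OF E_algebroid assms(2), of "- 1"]] nabla_scale[OF assms(2), of y "- 1"]
  by simp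

lemma nabla_linear: "s \<in> Gamma E \<Longrightarrow> linear (\<lambda>y. nabla y s p)"
  by (rule linearI) (simp_all add: nabla_add_left nabla_scale_left)

lemma nabla_zero_left: "s \<in> Gamma E \<Longrightarrow> nabla 0 s p = 0"
  using linear_0[OF nabla_linear] .

lemma omega_anti: "\<omega> y z p = - \<omega> z y p"
proof -
  have "\<omega> (y + z) (y + z) p = 0" "\<omega> y y p = 0" "\<omega> z z p = 0"
    using action_facts(13) by simp_all
  then have "\<omega> y z p + \<omega> z y p = 0"
    using bilinear_ladd[OF omega_bil, of y z "y + z" p] bilinear_radd[OF omega_bil, of _ y z p] by simp
  then show ?thesis using eq_neg_iff_add_eq_0 by blast
qed

lemma nabla_curvature:
  assumes "s \<in> Gamma E"
  shows "nabla y (nabla z s) p - nabla z (nabla y s) p - nabla (br0 y z) s p = bracket E (\<omega> y z) s p"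
  using fun_cong[OF action_facts(17)[rule_format, OF assms]] .

lemma alpha_curvature: "\<alpha> (br0 y z) p f = vf_bracket (\<alpha> y) (\<alpha> z) p f - anchor_vf E (\<omega> y z) p f"
  using fun_cong[OF fun_cong[OF action_facts(18)[rule_format]], of y z p f] by simp

text \<open>The condition \<open>d_nabla = 0\<close> rewritten by antisymmetry in cyclic form, as it
  arises in the cyclic sum of nested brackets of constant sections.\<close>

lemma omega_cocycle:
  "nabla y0 (\<omega> y1 y2) p + nabla y1 (\<omega> y2 y0) p + nabla y2 (\<omega> y0 y1) p
   + \<omega> y0 (br0 y1 y2) p + \<omega> y1 (br0 y2 y0) p + \<omega> y2 (br0 y0 y1) p = 0"
proof -
  have "\<omega> y2 y0 = (\<lambda>p. - 1 *\<^sub>R \<omega> y0 y2 p)" using omega_anti[of y2 y0] by auto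
  then have 1: "nabla y1 (\<omega> y2 y0) p = - nabla y1 (\<omega> y0 y2) p"
    using nabla_scale[OF omega_section[of y0 y2], of y1 "- 1"] by simp
  have 2: "\<omega> y1 (br0 y2 y0) p = \<omega> (br0 y0 y2) y1 p"
    using bilinear_rneg[OF omega_bil, of y1 "br0 y0 y2" p] omega_anti[of y1 "br0 y0 y2" p]
    by (simp add: lie_algebra_anti[OF h_lie, of y2 y0])
  have 3: "\<omega> y0 (br0 y1 y2) p = - \<omega> (br0 y1 y2) y0 p" "\<omega> y2 (br0 y0 y1) p = - \<omega> (br0 y0 y1) y2 p"
    by (rule omega_anti)+
  have "d_nabla br0 nabla \<omega> y0 y1 y2 p = 0" using action_facts(19) by simp
  then show ?thesis unfolding 1 2 3 d_nabla_def by (simp add: algebra_simps)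
qed

section \<open>Sections and anchor of the sum bundle\<close>

abbreviation "trivial_A \<equiv> trivial_bundle (base (vbun E)) :: ('m, 'h) vbundle"
abbreviation "Gamma_A \<equiv> sections (bundle_sum (vbun E) trivial_A)"
abbreviation "bracket_A \<equiv> action_bracket br0 E \<alpha> nabla \<omega>"
abbreviation "anchor_A a p \<equiv> \<lambda>f. anchor E p (fst (a p)) f + \<alpha> (snd (a p)) p f"

lemmas A_bundle = vector_bundle_bundle_sum[OF E_bundle vector_bundle_trivial[OF E_manifold h_fin_dim] trivial_bundle_simps(1)]

lemma product_section_iff:
  "a \<in> Gamma_A \<longleftrightarrow> (\<lambda>p. fst (a p)) \<in> Gamma E \<and> (\<lambda>p. snd (a p)) \<in> sections trivial_A"
  using smooth_section_on_bundle_sum[OF E_bundle vector_bundle_trivial[OF E_manifold h_fin_dim] _ openin_manifold_UNIV[OF E_manifold], of a]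
  by (auto simp: sections_def mem_Times_iff simp del: id_apply)

lemma constant_product_section: "s \<in> Gamma E \<Longrightarrow> (\<lambda>p. (s p, y)) \<in> Gamma_A"
  by (simp add: product_section_iff sections_trivial_const[OF E_manifold h_fin_dim])

text \<open>With a basis b_i of \<open>'h\<close> and its coordinates \<kappa>_i, a section is its
  E-part with second entry 0 plus the sum of the constants (0, b_i) scaled by the smooth functions
  \<kappa>_i(\<open>snd a\<close>). All pieces are global.\<close>

lemma product_section_induct:
  assumes a: "a \<in> Gamma_A"
    and const: "\<And>s y. s \<in> Gamma E \<Longrightarrow> Q (\<lambda>p. (s p, y))"
    and add: "\<And>a b. a \<in> Gamma_A \<Longrightarrow> b \<in> Gamma_A \<Longrightarrow> Q a \<Longrightarrow> Q b \<Longrightarrow> Q (\<lambda>p. a p + b p)"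
    and scale: "\<And>a f. a \<in> Gamma_A \<Longrightarrow> f \<in> smooth_funs (base (vbun E)) \<Longrightarrow> Q a \<Longrightarrow> Q (\<lambda>p. f p *\<^sub>R a p)"
  shows "Q a"
proof -
  let ?d = "dim (UNIV :: 'h set)"
  obtain b and \<kappa> :: "nat \<Rightarrow> 'h \<Rightarrow> real" where \<kappa>: "\<forall>i<?d. linear (\<kappa> i)" "\<forall>y. (\<Sum>i<?d. \<kappa> i y *\<^sub>R b i) = y"
    using finite_dimensional_coordinates[OF h_fin_dim] by blast
  have a': "(\<lambda>p. fst (a p)) \<in> Gamma E" "(\<lambda>p. snd (a p)) \<in> sections trivial_A"
    using a by (simp_all add: product_section_iff)
  \<comment> \<open>The partial sums are treated one by one; being a section is carried along
    because the hypothesis \<open>add\<close> asks for it.\<close>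
  have "n \<le> ?d \<Longrightarrow> (\<lambda>p. (fst (a p), 0) + (\<Sum>i<n. \<kappa> i (snd (a p)) *\<^sub>R (0, b i))) \<in> Gamma_A \<and>
      Q (\<lambda>p. (fst (a p), 0) + (\<Sum>i<n. \<kappa> i (snd (a p)) *\<^sub>R (0, b i)))" for n
  proof (induction n)
    case 0
    then show ?case using const[OF a'(1), of 0] constant_product_section[OF a'(1), of 0] by simp
  next
    case (Suc n)
    have f: "(\<lambda>p. \<kappa> n (snd (a p))) \<in> smooth_funs (base (vbun E))"
      using sections_trivialD[OF E_manifold h_fin_dim a'(2)] \<kappa>(1) Suc.prems by simp
    have c: "(\<lambda>p. (0, b n)) \<in> Gamma_A" "Q (\<lambda>p. (0, b n))"
      using constant_product_section[OF gamma_zero[OF E_algebroid]] const[OF gamma_zero[OF E_algebroid]] by auto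
    have sc: "(\<lambda>p. \<kappa> n (snd (a p)) *\<^sub>R (0, b n)) \<in> Gamma_A" "Q (\<lambda>p. \<kappa> n (snd (a p)) *\<^sub>R (0, b n))"
      using sections_scale[OF A_bundle, of "\<lambda>p. \<kappa> n (snd (a p))" "\<lambda>_. (0, b n)"] f c scale[OF c(1) f c(2)] by simp_all
    from Suc have IH: "(\<lambda>p. (fst (a p), 0) + (\<Sum>i<n. \<kappa> i (snd (a p)) *\<^sub>R (0, b i))) \<in> Gamma_A"
      "Q (\<lambda>p. (fst (a p), 0) + (\<Sum>i<n. \<kappa> i (snd (a p)) *\<^sub>R (0, b i)))" by simp_all
    show ?case
      using sections_add[OF A_bundle IH(1) sc(1)] add[OF IH(1) sc(1) IH(2) sc(2)]
      by (simp only: sum.lessThan_Suc add.assoc)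
  qed
  moreover have "(fst (a p), 0) + (\<Sum>i<?d. \<kappa> i (snd (a p)) *\<^sub>R (0, b i)) = a p" for p
    using \<kappa>(2) by (simp add: prod_eq_iff fst_sum snd_sum)
  ultimately show ?thesis by fastforce
qed

lemma product_anchor_map:
  "anchor_map (bundle_sum (vbun E) trivial_A)
     (anchor (product_algebroid E \<alpha> br'))"
  unfolding anchor_map_def
proof (intro conjI allI ballI)
  fix p v w and f :: "'m \<Rightarrow> real" and c :: real
  assume v: "v \<in> fibre (bundle_sum (vbun E) trivial_A) p"
  have "anchor E p (fst v) \<in> tangent_space (base (vbun E)) p"
    using algebroid_anchor[OF E_algebroid] v unfolding anchor_map_def by (auto simp: mem_Times_iff)
  from tangent_space_plus[OF E_manifold this vector_fieldsD(1)[OF E_manifold alpha_vf[of "snd v"], of p]]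
  show "anchor (product_algebroid E \<alpha> br') p v \<in>
      tangent_space (base (bundle_sum (vbun E) trivial_A)) p"
    by (simp add: product_algebroid_def case_prod_beta)
  show "anchor (product_algebroid E \<alpha> br') p (c *\<^sub>R v) f = c * anchor (product_algebroid E \<alpha> br') p v f"
    using v by (auto simp: mem_Times_iff anchor_linear(2)[OF E_algebroid] alpha_scale algebra_simps)
  assume w: "w \<in> fibre (bundle_sum (vbun E) trivial_A) p"
  show "anchor (product_algebroid E \<alpha> br') p (v + w) f =
      anchor (product_algebroid E \<alpha> br') p v f + anchor (product_algebroid E \<alpha> br') p w f"
    using v w by (auto simp: mem_Times_iff anchor_linear(1)[OF E_algebroid] alpha_add)
next
  fix x assume "x \<in> frames (bundle_sum (vbun E) trivial_A)"
  then obtain V e V' e' where V: "(V, e) \<in> frames (vbun E)" and V': "(V', e') \<in> frames trivial_A"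
    and x: "x = (V \<inter> V', \<lambda>i p. if i < brank (vbun E) then (e i p, 0) else (0, e' (i - brank (vbun E)) p))"
    by (cases x) (auto simp: frames_bundle_sum)
  obtain b where b: "V' = UNIV" "e' = (\<lambda>i _. b i)" using V' by (auto simp: frames_trivial_bundle)
  have "smooth_fun_on (base (vbun E)) V (\<lambda>p. anchor (product_algebroid E \<alpha> br') p
      (if i < brank (vbun E) then (e i p, 0) else (0, b (i - brank (vbun E)))) f)"
    if f: "f \<in> smooth_funs (base (vbun E))" for i f
  proof (cases "i < brank (vbun E)")
    case True
    have "smooth_fun_on (base (vbun E)) V (\<lambda>p. anchor E p (e i p) f)"
      using algebroid_anchor[OF E_algebroid] V True f unfolding anchor_map_def by blast
    with True show ?thesis by (simp add: alpha_zero)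
  next
    case False
    have z: "anchor E p 0 f = 0" for p
      using anchor_linear(2)[OF E_algebroid, of 0 p 0 f] subspace_0[OF vector_bundle_subspace[OF E_bundle]] by simp
    have "smooth_fun_on (base (vbun E)) UNIV (\<lambda>p. \<alpha> y p f)" for y
      using vector_fieldsD(2)[OF E_manifold alpha_vf f] by (simp add: smooth_funs_def)
    then have "smooth_fun_on (base (vbun E)) V (\<lambda>p. \<alpha> y p f)" for y
      by (rule smooth_fun_on_subset[OF E_manifold]) simp
    with False show ?thesis by (simp add: z)
  qed
  then show "case x of (U, e) \<Rightarrow> \<forall>i<brank (bundle_sum (vbun E) trivial_A).
      \<forall>f\<in>smooth_funs (base (bundle_sum (vbun E) trivial_A)).
        smooth_fun_on (base (bundle_sum (vbun E) trivial_A)) U (\<lambda>p. anchor (product_algebroid E \<alpha> br') p (e i p) f)"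
    unfolding x b by (simp del: product_algebroid_simps(2))
qed

lemma product_anchor_vf: "anchor_vf (product_algebroid E \<alpha> br') a = anchor_A a"
  by (simp add: anchor_vf_def fun_eq_iff)

lemma anchor_A_field: "a \<in> Gamma_A \<Longrightarrow> anchor_A a \<in> vector_fields (base (vbun E))"
  using anchor_map_vector_field[OF A_bundle product_anchor_map, of a]
  by (simp add: product_algebroid_def case_prod_beta)

lemma anchor_A_tangent: "a \<in> Gamma_A \<Longrightarrow> anchor_A a p \<in> tangent_space (base (vbun E)) p"
  using vector_fieldsD(1)[OF E_manifold anchor_A_field] .

section \<open>The extended bracket and the axioms of a Lie algebroid\<close>

lemma action_bracket_closed:
  assumes a: "a \<in> Gamma_A" and b: "b \<in> Gamma_A"
  shows "bracket_A a b \<in> Gamma_A"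
proof -
  have a': "(\<lambda>p. fst (a p)) \<in> Gamma E" "(\<lambda>p. snd (a p)) \<in> sections trivial_A"
    and b': "(\<lambda>p. fst (b p)) \<in> Gamma E" "(\<lambda>p. snd (b p)) \<in> sections trivial_A"
    using a b by (simp_all add: product_section_iff)
  note T = vector_bundle_trivial[OF E_manifold h_fin_dim]
  have a'': "(\<lambda>p. snd (a p)) \<in> sections (trivial_bundle (base trivial_A))"
    and b'': "(\<lambda>p. snd (b p)) \<in> sections (trivial_bundle (base trivial_A))"
    using a'(2) b'(2) by simp_all
  have n: "(\<lambda>p. nabla (Y p) s p) \<in> Gamma E"
    if "s \<in> Gamma E" "Y \<in> sections trivial_A" for s Y
    by (rule linear_family_section[OF E_bundle h_fin_dim nabla_section[OF that(1)] nabla_linear[OF that(1)] that(2)])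
  \<comment> \<open>\<open>linear_family_section\<close> fills one linear slot at a time, so the two
    slots of \<open>\<omega>\<close>, and below those of \<open>br0\<close>, are made variable in
    turn.\<close>
  have "(\<lambda>p. \<omega> y (snd (b p)) p) \<in> Gamma E" for y
    by (rule linear_family_section[OF E_bundle h_fin_dim omega_section _ b'(2)])
      (use omega_bil in \<open>auto simp: bilinear_def\<close>)
  then have w: "(\<lambda>p. \<omega> (snd (a p)) (snd (b p)) p) \<in> Gamma E"
    by (rule linear_family_section[OF E_bundle h_fin_dim _ _ a'(2), where T = "\<lambda>y p. \<omega> y (snd (b p)) p"])
      (use omega_bil in \<open>auto simp: bilinear_def\<close>)
  have "(\<lambda>p. br0 y (snd (b p))) \<in> sections trivial_A" for y
    by (rule linear_family_section[OF T h_fin_dim _ _ b'', where T = "\<lambda>z p. br0 y z"])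
      (use h_bilinear in \<open>auto simp: bilinear_def sections_trivial_const[OF E_manifold h_fin_dim]\<close>)
  then have l: "(\<lambda>p. br0 (snd (a p)) (snd (b p))) \<in> sections trivial_A"
    by (rule linear_family_section[OF T h_fin_dim _ _ a'', where T = "\<lambda>y p. br0 y (snd (b p))"])
      (use h_bilinear in \<open>auto simp: bilinear_def\<close>)
  have "(\<lambda>p. bracket E (\<lambda>q. fst (a q)) (\<lambda>q. fst (b q)) p + nabla (snd (a p)) (\<lambda>q. fst (b q)) p
        - nabla (snd (b p)) (\<lambda>q. fst (a q)) p + \<omega> (snd (a p)) (snd (b p)) p) \<in> Gamma E"
    by (intro gamma_add[OF E_algebroid] gamma_diff[OF E_algebroid] bracket_closed[OF E_algebroid] a' b' n w)
  moreover have "(\<lambda>p. br0 (snd (a p)) (snd (b p)) + vderiv (anchor_A a p) (\<lambda>q. snd (b q)) - vderiv (anchor_A b p) (\<lambda>q. snd (a q)))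
      \<in> sections trivial_A"
    by (intro sections_add[OF T] sections_diff[OF T] l vderiv_section[OF E_manifold h_fin_dim anchor_A_field[OF a] b'(2)]
        vderiv_section[OF E_manifold h_fin_dim anchor_A_field[OF b] a'(2)])
  ultimately show ?thesis by (simp add: product_section_iff action_bracket_def)
qed

lemma action_bracket_anti:
  assumes a: "a \<in> Gamma_A" and b: "b \<in> Gamma_A"
  shows "bracket_A a b p = - bracket_A b a p"
proof -
  have "bracket E (\<lambda>q. fst (a q)) (\<lambda>q. fst (b q)) p = - bracket E (\<lambda>q. fst (b q)) (\<lambda>q. fst (a q)) p"
    by (rule bracket_anti[OF E_algebroid]) (use a b in \<open>simp_all add: product_section_iff\<close>)
  moreover have "\<omega> (snd (a p)) (snd (b p)) p = - \<omega> (snd (b p)) (snd (a p)) p" by (rule omega_anti)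
  moreover have "br0 (snd (a p)) (snd (b p)) = - br0 (snd (b p)) (snd (a p))" by (rule lie_algebra_anti[OF h_lie])
  ultimately show ?thesis by (simp add: action_bracket_def)
qed

lemma action_bracket_add:
  assumes a: "a \<in> Gamma_A" and b: "b \<in> Gamma_A" and c: "c \<in> Gamma_A"
  shows "bracket_A a (\<lambda>p. b p + c p) p = bracket_A a b p + bracket_A a c p"
proof -
  have s: "(\<lambda>p. fst (x p)) \<in> Gamma E" "(\<lambda>p. snd (x p)) \<in> sections trivial_A"
    if "x \<in> Gamma_A" for x using that by (simp_all add: product_section_iff)
  have fib: "fst (x p) \<in> fibre (vbun E) p" if "x \<in> Gamma_A" for x using gamma_fibre[OF E_algebroid s(1)[OF that]] .
  have "anchor_A (\<lambda>p. b p + c p) p = (\<lambda>f. anchor_A b p f + anchor_A c p f)"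
    by (simp add: fun_eq_iff anchor_linear(1)[OF E_algebroid fib[OF b] fib[OF c]] alpha_add)
  then have "vderiv (anchor_A (\<lambda>p. b p + c p) p) (\<lambda>q. snd (a q)) =
      vderiv (anchor_A b p) (\<lambda>q. snd (a q)) + vderiv (anchor_A c p) (\<lambda>q. snd (a q))"
    using vderiv_plus[OF E_manifold h_fin_dim anchor_A_tangent[OF b] anchor_A_tangent[OF c] s(2)[OF a]] by simp
  moreover have "vderiv (anchor_A a p) (\<lambda>q. snd (b q) + snd (c q)) =
      vderiv (anchor_A a p) (\<lambda>q. snd (b q)) + vderiv (anchor_A a p) (\<lambda>q. snd (c q))"
    by (rule vderiv_add[OF E_manifold h_fin_dim anchor_A_tangent[OF a] s(2)[OF b] s(2)[OF c]])
  moreover note bracket_add_right[OF E_algebroid s(1)[OF b] s(1)[OF c] s(1)[OF a], of p]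
    nabla_add[OF s(1)[OF b] s(1)[OF c], of "snd (a p)" p]
    nabla_add_left[OF s(1)[OF a], of "snd (b p)" "snd (c p)" p]
    bilinear_radd[OF omega_bil, of "snd (a p)" "snd (b p)" "snd (c p)" p]
    bilinear_radd[OF h_bilinear, of "snd (a p)" "snd (b p)" "snd (c p)"]
  ultimately show ?thesis by (simp add: action_bracket_def)
qed

text \<open>The derivative of \<open>g\<close> appears three times: along \<rho> of the E-part from
  the bracket of \<open>E\<close>, along \<alpha> of the \<open>'h\<close>-part from
  \<open>nabla\<close>, and along the full anchor from \<open>vderiv\<close>. The first two add up
  to the full anchor in the E-component.\<close>

lemma action_bracket_leibniz:
  assumes a: "a \<in> Gamma_A" and b: "b \<in> Gamma_A" and g: "g \<in> smooth_funs (base (vbun E))"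
  shows "bracket_A a (\<lambda>p. g p *\<^sub>R b p) p = g p *\<^sub>R bracket_A a b p + anchor_A a p g *\<^sub>R b p"
proof -
  have s: "(\<lambda>p. fst (x p)) \<in> Gamma E" "(\<lambda>p. snd (x p)) \<in> sections trivial_A"
    if "x \<in> Gamma_A" for x using that by (simp_all add: product_section_iff)
  have fib: "fst (x p) \<in> fibre (vbun E) p" if "x \<in> Gamma_A" for x using gamma_fibre[OF E_algebroid s(1)[OF that]] .
  have "anchor_A (\<lambda>p. g p *\<^sub>R b p) p = (\<lambda>f. g p * anchor_A b p f)"
    by (simp add: fun_eq_iff anchor_linear(2)[OF E_algebroid fib[OF b]] alpha_scale distrib_left)
  then have "vderiv (anchor_A (\<lambda>p. g p *\<^sub>R b p) p) (\<lambda>q. snd (a q)) = g p *\<^sub>R vderiv (anchor_A b p) (\<lambda>q. snd (a q))"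
    using vderiv_times[OF E_manifold h_fin_dim anchor_A_tangent[OF b] s(2)[OF a]] by simp
  moreover have "vderiv (anchor_A a p) (\<lambda>q. g q *\<^sub>R snd (b q)) = g p *\<^sub>R vderiv (anchor_A a p) (\<lambda>q. snd (b q)) + anchor_A a p g *\<^sub>R snd (b p)"
    by (rule vderiv_scale[OF E_manifold h_fin_dim anchor_A_tangent[OF a] s(2)[OF b] g])
  moreover note bracket_leibniz[OF E_algebroid s(1)[OF a] s(1)[OF b] g, of p]
    nabla_leibniz[OF s(1)[OF b] g, of "snd (a p)" p]
    nabla_scale_left[OF s(1)[OF a], of "g p" "snd (b p)" p]
    bilinear_rmul[OF omega_bil, of "snd (a p)" "g p" "snd (b p)" p]
    bilinear_rmul[OF h_bilinear, of "snd (a p)" "g p" "snd (b p)"]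
  ultimately show ?thesis
    by (simp add: action_bracket_def prod_eq_iff anchor_vf_def algebra_simps)
qed

lemma action_bracket_constant:
  assumes s: "s \<in> Gamma E" and t: "t \<in> Gamma E"
  shows "bracket_A (\<lambda>p. (s p, y)) (\<lambda>p. (t p, z)) =
    (\<lambda>p. (bracket E s t p + nabla y t p - nabla z s p + \<omega> y z p, br0 y z))"
  using vderiv_const[OF E_manifold h_fin_dim anchor_A_tangent[OF constant_product_section[OF s, of y]]]
    vderiv_const[OF E_manifold h_fin_dim anchor_A_tangent[OF constant_product_section[OF t, of z]]]
  by (simp add: action_bracket_def)

lemma constant_bracket_section:
  assumes s: "s \<in> Gamma E" and t: "t \<in> Gamma E"
  shows "(\<lambda>p. bracket E s t p + nabla y t p - nabla z s p + \<omega> y z p) \<in> Gamma E"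
  by (intro gamma_add[OF E_algebroid] gamma_diff[OF E_algebroid] bracket_closed[OF E_algebroid] nabla_section omega_section s t)

text \<open>Axiom (ii) turns the \<open>nabla\<close> terms into brackets of \<alpha> with \<rho>,
  and the second relation of (iii) combines \<rho>(\<omega>(y, z)) with \<alpha> of the bracket. The
  sum is the bilinear expansion of the bracket of \<rho>(s) + \<alpha>(y) and \<rho>(t) +
  \<alpha>(z).\<close>

lemma action_bracket_anchor_constant:
  assumes s: "s \<in> Gamma E" and t: "t \<in> Gamma E"
  shows "anchor_A (bracket_A (\<lambda>p. (s p, y)) (\<lambda>p. (t p, z))) p f = vf_bracket (anchor_A (\<lambda>p. (s p, y))) (anchor_A (\<lambda>p. (t p, z))) p f"
proof (cases "f \<in> smooth_funs (base (vbun E))")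
  case False
  note c = constant_product_section[OF s, of y] constant_product_section[OF t, of z]
  show ?thesis
    using tangent_space_nonsmooth[OF anchor_A_tangent[OF action_bracket_closed[OF c]] False]
      vf_bracket_nonsmooth[OF E_manifold anchor_A_field[OF c(1)] anchor_A_field[OF c(2)] False] by simp
next
  case True
  have sm: "(\<lambda>q. anchor E q (u q) f) \<in> smooth_funs (base (vbun E))" if "u \<in> Gamma E" for u
    using vector_fieldsD(2)[OF E_manifold anchor_vf_vector_field[OF E_algebroid that] True] by (simp add: anchor_vf_def)
  have sma: "(\<lambda>q. \<alpha> y q f) \<in> smooth_funs (base (vbun E))" for y
    using vector_fieldsD(2)[OF E_manifold alpha_vf True] .
  have tan: "anchor E p (u p) \<in> tangent_space (base (vbun E)) p" if "u \<in> Gamma E" for u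
    using vector_fieldsD(1)[OF E_manifold anchor_vf_vector_field[OF E_algebroid that], of p] by (simp add: anchor_vf_def)
  have tana: "\<alpha> y p \<in> tangent_space (base (vbun E)) p" for y
    using vector_fieldsD(1)[OF E_manifold alpha_vf] .
  note sec = bracket_closed[OF E_algebroid s t] nabla_section[OF s] nabla_section[OF t] omega_section
  have "anchor_vf E (\<lambda>p. bracket E s t p + nabla y t p - nabla z s p + \<omega> y z p) p f =
     anchor_vf E (bracket E s t) p f + anchor_vf E (nabla y t) p f - anchor_vf E (nabla z s) p f
     + anchor_vf E (\<omega> y z) p f"
    using sec by (simp add: anchor_vf_add[OF E_algebroid] anchor_vf_diff[OF E_algebroid] gamma_add[OF E_algebroid] gamma_diff[OF E_algebroid])
  also have "\<dots> = vf_bracket (anchor_vf E s) (anchor_vf E t) p f + vf_bracket (\<alpha> y) (anchor_vf E t) p f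
      - vf_bracket (\<alpha> z) (anchor_vf E s) p f + anchor_vf E (\<omega> y z) p f"
    using s t by (simp add: anchor_vf_bracket[OF E_algebroid] action_facts(16))
  finally have "anchor_A (bracket_A (\<lambda>p. (s p, y)) (\<lambda>p. (t p, z))) p f =
      vf_bracket (anchor_vf E s) (anchor_vf E t) p f + vf_bracket (\<alpha> y) (anchor_vf E t) p f
      - vf_bracket (\<alpha> z) (anchor_vf E s) p f + vf_bracket (\<alpha> y) (\<alpha> z) p f"
    unfolding action_bracket_constant[OF s t] by (simp add: anchor_vf_def alpha_curvature)
  then show ?thesis
    using s t by (simp add: vf_bracket_def anchor_vf_def tangent_space_add[OF tan[OF s]] tangent_space_add[OF tan[OF t]]
        tangent_space_add[OF tana] sm sma)
qed

lemma action_bracket_jacobi_constant: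
  fixes y0 y1 y2 :: 'h
  assumes s0: "s0 \<in> Gamma E" and s1: "s1 \<in> Gamma E" and s2: "s2 \<in> Gamma E"
  defines "c0 \<equiv> \<lambda>p. (s0 p, y0)" and "c1 \<equiv> \<lambda>p. (s1 p, y1)" and "c2 \<equiv> \<lambda>p. (s2 p, y2)"
  shows "bracket_A c0 (bracket_A c1 c2) p + bracket_A c1 (bracket_A c2 c0) p + bracket_A c2 (bracket_A c0 c1) p = 0"
proof -
  let ?B = "bracket E"
  \<comment> \<open>Besides additivity, the expansion uses the derivation rule of (i) for
    \<open>nabla\<close> of a bracket.\<close>
  have ex: "bracket_A (\<lambda>p. (r p, x)) (bracket_A (\<lambda>p. (s p, y)) (\<lambda>p. (t p, z))) p =
     (?B r (?B s t) p + ?B r (nabla y t) p - ?B r (nabla z s) p + ?B r (\<omega> y z) p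
      + ?B (nabla x s) t p + ?B s (nabla x t) p + nabla x (nabla y t) p - nabla x (nabla z s) p
      + nabla x (\<omega> y z) p - nabla (br0 y z) r p + \<omega> x (br0 y z) p, br0 x (br0 y z))"
    if r: "r \<in> Gamma E" and s: "s \<in> Gamma E" and t: "t \<in> Gamma E" for r s t x y z
  proof -
    note sec = bracket_closed[OF E_algebroid s t] nabla_section[OF s, of z] nabla_section[OF t, of y] omega_section[of y z]
    have 1: "(\<lambda>p. ?B s t p + nabla y t p) \<in> Gamma E"
      "(\<lambda>p. ?B s t p + nabla y t p - nabla z s p) \<in> Gamma E"
      using sec by (auto intro!: gamma_add[OF E_algebroid] gamma_diff[OF E_algebroid])
    show ?thesis
      unfolding action_bracket_constant[OF s t] action_bracket_constant[OF r constant_bracket_section[OF s t]]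
        bracket_add_right[OF E_algebroid 1(2) sec(4) r] bracket_diff_right[OF E_algebroid 1(1) sec(2) r]
        bracket_add_right[OF E_algebroid sec(1,3) r]
        nabla_add[OF 1(2) sec(4)] nabla_diff[OF 1(1) sec(2)] nabla_add[OF sec(1,3)] nabla_bracket[OF s t]
      by (simp add: algebra_simps)
  qed
  have an: "?B r s p + ?B s r p = 0" if "r \<in> Gamma E" "s \<in> Gamma E" for r s
    using bracket_anti[OF E_algebroid that, of p] by simp
  have curv: "nabla y (nabla z s) p - nabla z (nabla y s) p - nabla (br0 y z) s p + ?B s (\<omega> y z) p = 0"
    if "s \<in> Gamma E" for s y z
    using nabla_curvature[OF that, of y z p] bracket_anti[OF E_algebroid omega_section that, of y z p] by simp
  \<comment> \<open>The surviving terms are grouped by the identity that kills them: Jacobi in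
    \<open>E\<close>, three antisymmetric pairs, three instances of curvature (iii) and the cocycle
    condition (iv). The other mixed terms cancel pairwise as they stand.\<close>
  have "fst (bracket_A c0 (bracket_A c1 c2) p + bracket_A c1 (bracket_A c2 c0) p + bracket_A c2 (bracket_A c0 c1) p) =
      (?B s0 (?B s1 s2) p + ?B s1 (?B s2 s0) p + ?B s2 (?B s0 s1) p)
      + (?B s0 (nabla y1 s2) p + ?B (nabla y1 s2) s0 p)
      + (?B s1 (nabla y2 s0) p + ?B (nabla y2 s0) s1 p)
      + (?B s2 (nabla y0 s1) p + ?B (nabla y0 s1) s2 p)
      + (nabla y0 (nabla y1 s2) p - nabla y1 (nabla y0 s2) p - nabla (br0 y0 y1) s2 p + ?B s2 (\<omega> y0 y1) p)
      + (nabla y1 (nabla y2 s0) p - nabla y2 (nabla y1 s0) p - nabla (br0 y1 y2) s0 p + ?B s0 (\<omega> y1 y2) p)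
      + (nabla y2 (nabla y0 s1) p - nabla y0 (nabla y2 s1) p - nabla (br0 y2 y0) s1 p + ?B s1 (\<omega> y2 y0) p)
      + (nabla y0 (\<omega> y1 y2) p + nabla y1 (\<omega> y2 y0) p + nabla y2 (\<omega> y0 y1) p
         + \<omega> y0 (br0 y1 y2) p + \<omega> y1 (br0 y2 y0) p + \<omega> y2 (br0 y0 y1) p)"
    unfolding c0_def c1_def c2_def ex[OF s0 s1 s2] ex[OF s1 s2 s0] ex[OF s2 s0 s1]
    by (simp add: algebra_simps)
  also have "\<dots> = 0"
    unfolding bracket_jacobi[OF E_algebroid s0 s1 s2] an[OF s0 nabla_section[OF s2]] an[OF s1 nabla_section[OF s0]]
      an[OF s2 nabla_section[OF s1]] curv[OF s0] curv[OF s1] curv[OF s2] omega_cocycle by simp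
  finally show ?thesis
    unfolding c0_def c1_def c2_def ex[OF s0 s1 s2] ex[OF s1 s2 s0] ex[OF s2 s0 s1]
    by (simp add: prod_eq_iff lie_algebra_jacobi[OF h_lie])
qed

text \<open>\<open>product_section_induct\<close> is always applied to the last argument of an
  expression. Swapping in the anchor identity and cyclic rotation in the Jacobiator bring the other
  arguments into that place.\<close>

lemma lie_algebroid_product: "lie_algebroid (product_algebroid E \<alpha> bracket_A)"
proof -
  let ?P = "product_algebroid E \<alpha> bracket_A"
  have B: "vector_bundle (vbun ?P)" using A_bundle by simp
  have anc: "anchor_map (vbun ?P) (anchor ?P)" using product_anchor_map by simp
  have closed: "bracket ?P a b \<in> Gamma ?P" if "a \<in> Gamma ?P" "b \<in> Gamma ?P" for a b
    using action_bracket_closed that by simp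
  have add: "bracket ?P a (\<lambda>p. b p + c p) p = bracket ?P a b p + bracket ?P a c p"
    if "a \<in> Gamma ?P" "b \<in> Gamma ?P" "c \<in> Gamma ?P" for a b c p
    using action_bracket_add that by simp
  have anti: "bracket ?P a b p = - bracket ?P b a p" if "a \<in> Gamma ?P" "b \<in> Gamma ?P" for a b p
    using action_bracket_anti[of a b p] that by simp
  have leib: "bracket ?P a (\<lambda>p. f p *\<^sub>R b p) p = f p *\<^sub>R bracket ?P a b p + anchor_vf ?P a p f *\<^sub>R b p"
    if "a \<in> Gamma ?P" "b \<in> Gamma ?P" "f \<in> smooth_funs (base (vbun ?P))" for a b f p
    using action_bracket_leibniz[of a b f p] that by (simp add: product_anchor_vf)
  note ten = B anc closed add anti leib
  have GP: "Gamma ?P = Gamma_A" and baseP: "base (vbun ?P) = base (vbun E)" by simp_all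
  let ?hom = "\<lambda>a b. \<forall>p f. anchor_vf ?P (bracket ?P a b) p f = vf_bracket (anchor_vf ?P a) (anchor_vf ?P b) p f"
  \<comment> \<open>The first argument is still constant here; only the second one is
    generalized.\<close>
  have hom1: "?hom (\<lambda>p. (s p, y)) b" if s: "s \<in> Gamma E" and b: "b \<in> Gamma_A" for s y b
    using b
  proof (rule product_section_induct)
    note c = constant_product_section[OF s, of y, folded GP]
    show "?hom (\<lambda>p. (s p, y)) (\<lambda>p. (t p, z))" if "t \<in> Gamma E" for t z
      using action_bracket_anchor_constant[OF s that] by (simp add: product_anchor_vf)
    show "?hom (\<lambda>p. (s p, y)) (\<lambda>p. a p + b p)"
      if "a \<in> Gamma_A" "b \<in> Gamma_A" "?hom (\<lambda>p. (s p, y)) a" "?hom (\<lambda>p. (s p, y)) b" for a b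
      by (intro allI anchor_defect_add[OF ten c that(1,2)[folded GP]]) (use that(3,4) in blast)+
    show "?hom (\<lambda>p. (s p, y)) (\<lambda>p. g p *\<^sub>R a p)"
      if "a \<in> Gamma_A" "g \<in> smooth_funs (base (vbun E))" "?hom (\<lambda>p. (s p, y)) a" for a g
      by (intro allI anchor_defect_scale[OF ten c that(1)[folded GP] that(2)[folded baseP]])
        (use that(3) in simp_all)
  qed
  \<comment> \<open>After a swap, \<open>hom1\<close> is the base case for the argument that was
    constant so far.\<close>
  have hom: "?hom b a" if a: "a \<in> Gamma_A" and b: "b \<in> Gamma_A" for a b
    using a
  proof (rule product_section_induct)
    show "?hom b (\<lambda>p. (s p, y))" if s: "s \<in> Gamma E" for s y
      by (intro allI anchor_defect_swap[OF ten constant_product_section[OF s, folded GP] b[folded GP]])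
        (use hom1[OF s b] in simp_all)
    show "?hom b (\<lambda>p. c p + d p)"
      if "c \<in> Gamma_A" "d \<in> Gamma_A" "?hom b c" "?hom b d" for c d
      by (intro allI anchor_defect_add[OF ten b[folded GP] that(1,2)[folded GP]]) (use that(3,4) in blast)+
    show "?hom b (\<lambda>p. g p *\<^sub>R c p)"
      if "c \<in> Gamma_A" "g \<in> smooth_funs (base (vbun E))" "?hom b c" for c g
      by (intro allI anchor_defect_scale[OF ten b[folded GP] that(1)[folded GP] that(2)[folded baseP]])
        (use that(3) in simp_all)
  qed
  let ?J = "\<lambda>a b c p. bracket ?P a (bracket ?P b c) p + bracket ?P b (bracket ?P c a) p + bracket ?P c (bracket ?P a b) p"
  \<comment> \<open>Together with \<open>step\<close>, three rotations generalize the three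
    arguments one after the other: \<open>jac1\<close>, \<open>jac2\<close> and \<open>jac\<close>
    have two, one and no constant arguments.\<close>
  have rot: "?J a b c p = ?J c a b p" for a b c p by (simp add: add.assoc add.commute add.left_commute)
  have step: "\<forall>p. ?J a b c p = 0" if a: "a \<in> Gamma_A" and b: "b \<in> Gamma_A" and c: "c \<in> Gamma_A"
    and const: "\<And>s y. s \<in> Gamma E \<Longrightarrow> \<forall>p. ?J a b (\<lambda>p. (s p, y)) p = 0" for a b c
    using c
  proof (rule product_section_induct)
    show "\<forall>p. ?J a b (\<lambda>p. (s p, y)) p = 0" if "s \<in> Gamma E" for s y
      by (rule const[OF that])
    show "\<forall>p. ?J a b (\<lambda>p. c p + d p) p = 0"
      if "c \<in> Gamma_A" "d \<in> Gamma_A" "\<forall>p. ?J a b c p = 0" "\<forall>p. ?J a b d p = 0" for c d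
      using that(3,4) by (simp only: jacobiator_add[OF ten a[folded GP] b[folded GP] that(1,2)[folded GP]]) simp
    show "\<forall>p. ?J a b (\<lambda>p. f p *\<^sub>R c p) p = 0"
      if "c \<in> Gamma_A" "f \<in> smooth_funs (base (vbun E))" "\<forall>p. ?J a b c p = 0" for c f
    proof -
      have h: "\<And>p. anchor_vf ?P (bracket ?P a b) p f = vf_bracket (anchor_vf ?P a) (anchor_vf ?P b) p f"
        using hom[OF b a] by blast
      show ?thesis
        using that(3)
        by (simp only: jacobiator_scale[OF ten a[folded GP] b[folded GP] that(1)[folded GP] that(2)[folded baseP] h]) simp
    qed
  qed
  have jac1: "\<forall>p. ?J (\<lambda>p. (s p, y)) (\<lambda>p. (t p, z)) c p = 0"
    if "s \<in> Gamma E" "t \<in> Gamma E" "c \<in> Gamma_A" for s t y z c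
    by (rule step[OF constant_product_section[OF that(1)] constant_product_section[OF that(2)] that(3)])
      (use action_bracket_jacobi_constant[OF that(1,2)] in simp)
  have jac2: "\<forall>p. ?J (\<lambda>p. (s p, y)) b c p = 0" if "s \<in> Gamma E" "b \<in> Gamma_A" "c \<in> Gamma_A" for s y b c
  proof -
    have "\<forall>p. ?J c (\<lambda>p. (s p, y)) b p = 0"
    proof (rule step[OF that(3) constant_product_section[OF that(1)] that(2)])
      show "\<forall>p. ?J c (\<lambda>p. (s p, y)) (\<lambda>p. (t p, z)) p = 0" if t: "t \<in> Gamma E" for t z
        using jac1[OF \<open>s \<in> _\<close> t \<open>c \<in> Gamma_A\<close>, of y z] rot[of "\<lambda>p. (s p, y)" "\<lambda>p. (t p, z)" c] by simp
    qed
    then show ?thesis using rot[of "\<lambda>p. (s p, y)" b c] by simp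
  qed
  have jac: "?J a b c p = 0" if "a \<in> Gamma_A" "b \<in> Gamma_A" "c \<in> Gamma_A" for a b c p
  proof -
    have "\<forall>p. ?J b c a p = 0"
    proof (rule step[OF that(2,3,1)])
      show "\<forall>p. ?J b c (\<lambda>p. (s p, y)) p = 0" if "s \<in> Gamma E" for s y
        using jac2[OF that \<open>b \<in> Gamma_A\<close> \<open>c \<in> Gamma_A\<close>, of y] rot[of b c "\<lambda>p. (s p, y)"] by simp
    qed
    then show ?thesis using rot[of b c a p] by simp
  qed
  show ?thesis
  proof (rule lie_algebroidI)
    show "vector_bundle (vbun ?P)" "anchor_map (vbun ?P) (anchor ?P)" by fact+
    fix a b assume a: "a \<in> Gamma ?P" and b: "b \<in> Gamma ?P"
    show "bracket ?P a b \<in> Gamma ?P" by (rule closed[OF a b])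
    show "bracket ?P a b p = - bracket ?P b a p" for p by (rule anti[OF a b])
    show "anchor_vf ?P (bracket ?P a b) p f = vf_bracket (anchor_vf ?P a) (anchor_vf ?P b) p f" for p f
      using hom[OF b[unfolded GP] a[unfolded GP]] by blast
    show "bracket ?P a (\<lambda>p. f p *\<^sub>R b p) p = f p *\<^sub>R bracket ?P a b p + anchor_vf ?P a p f *\<^sub>R b p"
      if "f \<in> smooth_funs (base (vbun ?P))" for f p by (rule leib[OF a b that])
    \<comment> \<open>Real homogeneity comes from the Leibniz rule with a constant function in the
      right slot, moved to the left by antisymmetry.\<close>
    show "bracket ?P (\<lambda>p. t *\<^sub>R a p) b p = t *\<^sub>R bracket ?P a b p" for t p
    proof -
      have M: "smooth_manifold (base (vbun ?P))" using E_manifold by simp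
      have "bracket ?P b (\<lambda>p. t *\<^sub>R a p) p = t *\<^sub>R bracket ?P b a p"
        using leib[OF b a smooth_funs_const[OF M], of t] tangent_space_const[OF M anchor_field_tangent[OF ten b]] by simp
      then show ?thesis
        using anti[OF sections_scaleR[OF B a] b] anti[OF b a] by simp
    qed
    fix c assume c: "c \<in> Gamma ?P"
    show "bracket ?P (\<lambda>p. a p + b p) c p = bracket ?P a c p + bracket ?P b c p" for p
      using anti[OF sections_add[OF B a b] c, of p] add[OF c a b, of p] anti[OF a c, of p] anti[OF b c, of p] by simp
    show "?J a b c p = 0" for p by (rule jac[OF a[unfolded GP] b[unfolded GP] c[unfolded GP]])
  qed
qed

section \<open>Existence and uniqueness of the extension\<close>

lemma extends_constant_bracket_action: "extends_constant_bracket br0 E nabla \<omega> bracket_A"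
  unfolding extends_constant_bracket_def by (simp add: action_bracket_constant)

text \<open>Both brackets are additive and Leibniz over the same anchor. Agreement on constant
  sections therefore spreads to the whole right argument, and by antisymmetry then to the left
  one.\<close>

lemma extension_unique:
  assumes L': "lie_algebroid (product_algebroid E \<alpha> br')" and ext: "extends_constant_bracket br0 E nabla \<omega> br'"
    and a: "a \<in> Gamma_A" and b: "b \<in> Gamma_A"
  shows "br' a b = bracket_A a b"
proof -
  let ?P' = "product_algebroid E \<alpha> br'"
  have G': "Gamma ?P' = Gamma_A" and base': "base (vbun ?P') = base (vbun E)" by simp_all
  have ind: "br' x c = bracket_A x c" if x: "x \<in> Gamma_A" and c: "c \<in> Gamma_A"
    and const: "\<And>s y. s \<in> Gamma E \<Longrightarrow> br' x (\<lambda>p. (s p, y)) = bracket_A x (\<lambda>p. (s p, y))" for x c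
    using c
  proof (rule product_section_induct)
    show "br' x (\<lambda>p. (s p, y)) = bracket_A x (\<lambda>p. (s p, y))" if "s \<in> Gamma E" for s y
      by (rule const[OF that])
    show "br' x (\<lambda>p. c p + d p) = bracket_A x (\<lambda>p. c p + d p)"
      if "c \<in> Gamma_A" "d \<in> Gamma_A" "br' x c = bracket_A x c" "br' x d = bracket_A x d" for c d
      using bracket_add_right[OF L', unfolded G', OF that(1,2) x] action_bracket_add[OF x that(1,2)] that(3,4)
      by (simp add: fun_eq_iff)
    show "br' x (\<lambda>p. f p *\<^sub>R c p) = bracket_A x (\<lambda>p. f p *\<^sub>R c p)"
      if "c \<in> Gamma_A" "f \<in> smooth_funs (base (vbun E))" "br' x c = bracket_A x c" for c f
      using bracket_leibniz[OF L', unfolded G' base', OF x that(1,2)] action_bracket_leibniz[OF x that(1,2)] that(3)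
      by (simp add: fun_eq_iff product_anchor_vf)
  qed
  have const: "br' (\<lambda>p. (s p, y)) c = bracket_A (\<lambda>p. (s p, y)) c" if s: "s \<in> Gamma E" and c: "c \<in> Gamma_A" for s y c
  proof (rule ind[OF constant_product_section[OF s] c])
    show "br' (\<lambda>p. (s p, y)) (\<lambda>p. (t p, z)) = bracket_A (\<lambda>p. (s p, y)) (\<lambda>p. (t p, z))" if "t \<in> Gamma E" for t z
      using ext s that by (simp add: extends_constant_bracket_def action_bracket_constant)
  qed
  show ?thesis
  proof (rule ind[OF a b])
    fix s y assume s: "s \<in> Gamma E"
    note c = constant_product_section[OF s, of y]
    have "br' a (\<lambda>p. (s p, y)) p = bracket_A a (\<lambda>p. (s p, y)) p" for p
      using bracket_anti[OF L', unfolded G', OF a c, of p] action_bracket_anti[OF a c, of p] const[OF s a, of y]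
      by simp
    then show "br' a (\<lambda>p. (s p, y)) = bracket_A a (\<lambda>p. (s p, y))" by blast
  qed
qed

section \<open>The short exact sequence of Lie algebroids\<close>

lemma inclusion_morphism: "lie_algebroid_morphism E (product_algebroid E \<alpha> bracket_A) id (\<lambda>p e. (e, 0))"
  unfolding lie_algebroid_morphism_def
proof (intro conjI ballI allI impI)
  let ?P = "product_algebroid E \<alpha> bracket_A"
  have incl: "(\<lambda>p. (s p, 0)) \<in> Gamma_A" if "s \<in> Gamma E" for s
    by (rule constant_product_section[OF that])
  show "lie_algebroid E" "lie_algebroid ?P" by (rule E_algebroid lie_algebroid_product)+
  show "bundle_map (vbun E) (vbun ?P) id (\<lambda>p e. (e, 0))"
    unfolding bundle_map_def product_algebroid_simps
  proof (intro conjI)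
    show "\<forall>(U, e)\<in>frames (vbun E). \<forall>i<brank (vbun E).
        smooth_along (bundle_sum (vbun E) trivial_A) (base (vbun E)) id U (\<lambda>p. (e i p, 0))"
    proof clarify
      fix U e i assume e: "(U, e) \<in> frames (vbun E)" "i < brank (vbun E)"
      have "smooth_section_on trivial_A U (\<lambda>p. 0)"
        unfolding trivial_bundle_simps by (rule smooth_along_zero[OF E_manifold])
      then have "smooth_section_on (bundle_sum (vbun E) trivial_A) U (\<lambda>p. (e i p, 0))"
        using vector_bundle_frameD(2)[OF E_bundle e]
        unfolding smooth_section_on_bundle_sum[OF E_bundle vector_bundle_trivial[OF E_manifold h_fin_dim] trivial_bundle_simps(1)
            vector_bundle_frameD(1)[OF E_bundle e(1)]] fst_conv snd_conv by blast
      then show "smooth_along (bundle_sum (vbun E) trivial_A) (base (vbun E)) id U (\<lambda>p. (e i p, 0))"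
        unfolding bundle_sum_simps .
    qed
  qed (use E_bundle A_bundle smooth_map_id[OF E_manifold] in auto)
  show "anchor ?P (id p) (v, 0) g = anchor E p v (\<lambda>q. g (id q))" for p v g
    by (simp add: alpha_zero)
  fix a b k u a' l v b' p
  assume a: "a \<in> Gamma E" and b: "b \<in> Gamma E"
    and dec: "decomposition E ?P id (\<lambda>p e. (e, 0)) a k u a' \<and> decomposition E ?P id (\<lambda>p e. (e, 0)) b l v b'"
  have u: "u i \<in> smooth_funs (base (vbun E))" "a' i \<in> Gamma_A" if "i < k" for i
    using dec that by (simp_all add: decomposition_def)
  have v: "v i \<in> smooth_funs (base (vbun E))" "b' i \<in> Gamma_A" if "i < l" for i
    using dec that by (simp_all add: decomposition_def)
  have ab: "(a p, 0) = (\<Sum>i<k. u i p *\<^sub>R a' i p)" "(b p, 0) = (\<Sum>i<l. v i p *\<^sub>R b' i p)" for p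
    using dec by (simp_all add: decomposition_def)
  \<comment> \<open>The base map is the identity, so a decomposition writes the section
    \<open>(a p, 0)\<close> as a combination of sections of the same algebroid. The bracket
    condition then is \<open>bracket_sum_sum\<close>, read through the equality of the two anchors
    on such sections.\<close>
  have anc: "anchor_vf ?P (\<lambda>p. (c p, 0)) p f = anchor E p (c p) f" for c f
    by (simp add: product_anchor_vf alpha_zero)
  have z: "\<omega> 0 0 p = 0" "br0 0 0 = 0"
    using bilinear_lzero[OF omega_bil] bilinear_lzero[OF h_bilinear] by auto
  \<comment> \<open>For zero \<open>'h\<close>-components the formula on constant sections reduces
    to the bracket of \<open>E\<close>.\<close>
  have "(bracket E a b p, 0) = bracket_A (\<lambda>p. (a p, 0)) (\<lambda>p. (b p, 0)) p"
    unfolding action_bracket_constant[OF a b] using a b by (simp add: nabla_zero_left z)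
  also have "\<dots> = (\<Sum>i<k. \<Sum>j<l. (u i p * v j p) *\<^sub>R bracket_A (a' i) (b' j) p)
      + (\<Sum>j<l. anchor E p (a p) (v j) *\<^sub>R b' j p) - (\<Sum>i<k. anchor E p (b p) (u i) *\<^sub>R a' i p)"
    using bracket_sum_sum[OF lie_algebroid_product, of k a' l b' u v p] u v
    by (simp add: anc flip: ab)
  finally show "(bracket E a b p, 0) = (\<Sum>i<k. \<Sum>j<l. (u i p * v j p) *\<^sub>R bracket ?P (a' i) (b' j) (id p))
      + (\<Sum>j<l. anchor E p (a p) (v j) *\<^sub>R b' j (id p)) - (\<Sum>i<k. anchor E p (b p) (u i) *\<^sub>R a' i (id p))"
    by simp
qed

text \<open>The \<open>'h\<close>-component of the closed formula already has the required shape,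
  \<open>br0\<close> plus derivatives along the anchors. Inserting the decompositions, bilinearity
  of \<open>br0\<close> gives the double sum and \<open>vderiv_sum\<close> the two anchor
  terms.\<close>

lemma projection_morphism:
  "lie_algebroid_morphism (product_algebroid E \<alpha> bracket_A) (point_algebroid br0) (\<lambda>_. ()) (\<lambda>p a. snd a)"
  unfolding lie_algebroid_morphism_def
proof (intro conjI ballI allI impI)
  let ?P = "product_algebroid E \<alpha> bracket_A" and ?S = "bundle_sum (vbun E) trivial_A"
  note M0 = smooth_manifold_point
  show "lie_algebroid ?P" "lie_algebroid (point_algebroid br0)"
    by (rule lie_algebroid_product lie_algebroid_point[OF h_lie])+
  show "bundle_map (vbun ?P) (vbun (point_algebroid br0)) (\<lambda>_. ()) (\<lambda>p a. snd a)"
    unfolding bundle_map_def product_algebroid_simps point_algebroid_simps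
  proof (intro conjI)
    show "\<forall>(U, e)\<in>frames ?S. \<forall>i<brank ?S.
        smooth_along (trivial_bundle point_manifold :: (unit, 'h) vbundle) (base ?S) (\<lambda>_. ()) U (\<lambda>p. snd (e i p))"
    proof clarify
      fix U e i assume e: "(U, e) \<in> frames ?S" "i < brank ?S"
      have U: "openin (mtop (base (vbun E))) U" using vector_bundle_frameD(1)[OF A_bundle e(1)] by simp
      have "smooth_section_on trivial_A U (\<lambda>p. snd (e i p))"
        using vector_bundle_frameD(2)[OF A_bundle e]
        unfolding smooth_section_on_bundle_sum[OF E_bundle vector_bundle_trivial[OF E_manifold h_fin_dim] trivial_bundle_simps(1) U] by blast
      then show "smooth_along (trivial_bundle point_manifold :: (unit, 'h) vbundle) (base ?S) (\<lambda>_. ()) U (\<lambda>p. snd (e i p))"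
        unfolding trivial_bundle_simps bundle_sum_simps smooth_along_trivial_iff[OF E_manifold h_fin_dim U] .
    qed
  qed (use A_bundle vector_bundle_trivial[OF M0 h_fin_dim] smooth_map_point in auto)
  \<comment> \<open>Functions on the point pull back to constants, which tangent vectors annihilate;
    the anchor over the point is 0.\<close>
  show "anchor (point_algebroid br0) () (snd v) g = anchor ?P p v (\<lambda>q. g ())" if "v \<in> fibre (vbun ?P) p" for p v g
  proof -
    have "anchor ?P p v \<in> tangent_space (base (vbun E)) p"
      using product_anchor_map that unfolding anchor_map_def by auto
    then show ?thesis using tangent_space_const[OF E_manifold] by (simp del: product_algebroid_simps(2))
  qed
  fix a b k u a' l v b' p
  assume a: "a \<in> Gamma ?P" and b: "b \<in> Gamma ?P"
    and dec: "decomposition ?P (point_algebroid br0) (\<lambda>_. ()) (\<lambda>p a. snd a) a k u a' \<and>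
      decomposition ?P (point_algebroid br0) (\<lambda>_. ()) (\<lambda>p a. snd a) b l v b'"
  have ab_sections: "a \<in> Gamma_A" "b \<in> Gamma_A" using a b by simp_all
  have u: "u i \<in> smooth_funs (base (vbun E))" if "i < k" for i
    using dec that by (simp add: decomposition_def)
  have v: "v i \<in> smooth_funs (base (vbun E))" if "i < l" for i
    using dec that by (simp add: decomposition_def)
  have ab: "snd (a q) = (\<Sum>i<k. u i q *\<^sub>R a' i ())" "snd (b q) = (\<Sum>i<l. v i q *\<^sub>R b' i ())" for q
    using dec by (simp_all add: decomposition_def)
  have lin: "linear (\<lambda>y. br0 y z)" "linear (\<lambda>z. br0 y z)" for y z
    using h_bilinear by (simp_all add: bilinear_def)
  have "br0 (\<Sum>i<k. u i p *\<^sub>R a' i ()) (\<Sum>j<l. v j p *\<^sub>R b' j ()) =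
      (\<Sum>i<k. \<Sum>j<l. (u i p * v j p) *\<^sub>R br0 (a' i ()) (b' j ()))"
    by (simp add: linear_sum[OF lin(1)] linear_scale[OF lin(1)] linear_sum[OF lin(2)] linear_scale[OF lin(2)] scaleR_sum_right)
      (subst sum.swap, simp add: mult.commute)
  moreover have "vderiv (anchor_A a p) (\<lambda>q. \<Sum>j<l. v j q *\<^sub>R b' j ()) = (\<Sum>j<l. anchor_A a p (v j) *\<^sub>R b' j ())"
    using v by (intro vderiv_sum[OF E_manifold h_fin_dim anchor_A_tangent[OF ab_sections(1)]]) simp
  moreover have "vderiv (anchor_A b p) (\<lambda>q. \<Sum>i<k. u i q *\<^sub>R a' i ()) = (\<Sum>i<k. anchor_A b p (u i) *\<^sub>R a' i ())"
    using u by (intro vderiv_sum[OF E_manifold h_fin_dim anchor_A_tangent[OF ab_sections(2)]]) simp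
  moreover have "snd (bracket_A a b p) = br0 (snd (a p)) (snd (b p)) + vderiv (anchor_A a p) (\<lambda>q. snd (b q)) - vderiv (anchor_A b p) (\<lambda>q. snd (a q))"
    by (simp add: action_bracket_def)
  ultimately have "snd (bracket_A a b p) = (\<Sum>i<k. \<Sum>j<l. (u i p * v j p) *\<^sub>R br0 (a' i ()) (b' j ()))
      + (\<Sum>j<l. anchor_A a p (v j) *\<^sub>R b' j ()) - (\<Sum>i<k. anchor_A b p (u i) *\<^sub>R a' i ())"
    by (simp only: ab)
  then show "snd (bracket ?P a b p) =
      (\<Sum>i<k. \<Sum>j<l. (u i p * v j p) *\<^sub>R bracket (point_algebroid br0) (a' i) (b' j) ())
      + (\<Sum>j<l. anchor ?P p (a p) (v j) *\<^sub>R b' j ()) - (\<Sum>i<k. anchor ?P p (b p) (u i) *\<^sub>R a' i ())"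
    by simp
qed

lemma product_ses:
  "lie_algebroid_ses E (product_algebroid E \<alpha> bracket_A) (point_algebroid br0) (\<lambda>p e. (e, 0)) (\<lambda>_. ()) (\<lambda>p a. snd a)"
proof -
  have "0 \<in> fibre (vbun E) p" for p
    using subspace_0[OF vector_bundle_subspace[OF E_bundle]] .
  then have "snd ` (fibre (vbun E) p \<times> (UNIV :: 'h set)) = UNIV" for p by force
  moreover have "(\<lambda>e. (e, 0)) ` fibre (vbun E) p = {a \<in> fibre (vbun E) p \<times> (UNIV :: 'h set). snd a = 0}" for p
    by force
  ultimately show ?thesis
    using inclusion_morphism projection_morphism
    by (simp add: lie_algebroid_ses_def fibrewise_exact_def inj_on_def)
qed

end


section \<open>The correspondence\<close>

theorem proposition3p3:
  fixes br0 :: "'h::real_vector \<Rightarrow> 'h \<Rightarrow> 'h"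
    and E :: "('m, 'v::real_vector) algebroid"
    and A :: "('n, 'w::real_vector) algebroid"
    and F :: "'n \<Rightarrow> 'w \<Rightarrow> 'h"
  assumes "lie_algebra br0"
  shows
    "(\<forall>\<alpha> nabla \<omega>.
        lie_algebroid E \<and> action_up_to_homotopy br0 E \<alpha> nabla \<omega> \<longrightarrow>
        (\<exists>br.
           lie_algebroid (product_algebroid E \<alpha> br) \<and>
           extends_constant_bracket br0 E nabla \<omega> br \<and>
           (\<forall>br'. lie_algebroid (product_algebroid E \<alpha> br') \<and>
                  extends_constant_bracket br0 E nabla \<omega> br' \<longrightarrow>
                  (\<forall>a\<in>sections (vbun (product_algebroid E \<alpha> br)).
                   \<forall>b\<in>sections (vbun (product_algebroid E \<alpha> br)). br' a b = br a b)) \<and>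
           lie_algebroid_ses E (product_algebroid E \<alpha> br) (point_algebroid br0)
             (\<lambda>p e. (e, 0)) (\<lambda>_. ()) (\<lambda>p a. snd a)))
     \<and>
     (lie_algebroid A \<and>
      lie_algebroid_morphism A (point_algebroid br0) (\<lambda>_. ()) F \<and>
      (\<forall>p. F p ` fibre (vbun A) p = UNIV) \<longrightarrow>
        lie_algebroid (kernel_algebroid A F) \<and>
        bundle_ses (vbun (kernel_algebroid A F)) (vbun A)
          (trivial_bundle (base (vbun A))) (\<lambda>p e. e) F \<and>
        (\<forall>\<sigma>. bundle_splitting (vbun A) (trivial_bundle (base (vbun A))) F \<sigma> \<longrightarrow>
           action_up_to_homotopy br0 (kernel_algebroid A F)
             (\<lambda>y. anchor_vf A (\<lambda>p. \<sigma> p y))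
             (\<lambda>y. bracket A (\<lambda>p. \<sigma> p y))
             (\<lambda>y0 y1 p. bracket A (\<lambda>q. \<sigma> q y0) (\<lambda>q. \<sigma> q y1) p - \<sigma> p (br0 y0 y1))))"
proof (intro conjI allI impI)
  fix \<alpha> nabla \<omega> assume "lie_algebroid E \<and> action_up_to_homotopy br0 E \<alpha> nabla \<omega>"
  then have act: "action_up_to_homotopy br0 E \<alpha> nabla \<omega>" by blast
  show "\<exists>br. lie_algebroid (product_algebroid E \<alpha> br) \<and>
      extends_constant_bracket br0 E nabla \<omega> br \<and>
      (\<forall>br'. lie_algebroid (product_algebroid E \<alpha> br') \<and> extends_constant_bracket br0 E nabla \<omega> br' \<longrightarrow>
         (\<forall>a\<in>sections (vbun (product_algebroid E \<alpha> br)).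
          \<forall>b\<in>sections (vbun (product_algebroid E \<alpha> br)). br' a b = br a b)) \<and>
      lie_algebroid_ses E (product_algebroid E \<alpha> br) (point_algebroid br0)
        (\<lambda>p e. (e, 0)) (\<lambda>_. ()) (\<lambda>p a. snd a)"
  \<comment> \<open>The witness is the closed formula. A competing bracket is compared with it on
    smooth sections, where the axioms constrain it.\<close>
  proof (intro exI[of _ "action_bracket br0 E \<alpha> nabla \<omega>"] conjI allI impI ballI)
    show "lie_algebroid (product_algebroid E \<alpha> (action_bracket br0 E \<alpha> nabla \<omega>))"
      by (rule lie_algebroid_product[OF act])
    show "extends_constant_bracket br0 E nabla \<omega> (action_bracket br0 E \<alpha> nabla \<omega>)"
      by (rule extends_constant_bracket_action[OF act])
    show "lie_algebroid_ses E (product_algebroid E \<alpha> (action_bracket br0 E \<alpha> nabla \<omega>)) (point_algebroid br0)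
        (\<lambda>p e. (e, 0)) (\<lambda>_. ()) (\<lambda>p a. snd a)"
      by (rule product_ses[OF act])
  next
    fix br' a b
    assume "lie_algebroid (product_algebroid E \<alpha> br') \<and> extends_constant_bracket br0 E nabla \<omega> br'"
      and "a \<in> sections (vbun (product_algebroid E \<alpha> (action_bracket br0 E \<alpha> nabla \<omega>)))"
      and "b \<in> sections (vbun (product_algebroid E \<alpha> (action_bracket br0 E \<alpha> nabla \<omega>)))"
    then show "br' a b = action_bracket br0 E \<alpha> nabla \<omega> a b"
      using extension_unique[OF act, of br' a b] by simp
  qed
next
  assume A: "lie_algebroid A \<and> lie_algebroid_morphism A (point_algebroid br0) (\<lambda>_. ()) F \<and>
      (\<forall>p. F p ` fibre (vbun A) p = UNIV)"
  then have F: "lie_algebroid_morphism A (point_algebroid br0) (\<lambda>_. ()) F"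
    and surj: "\<And>p. F p ` fibre (vbun A) p = UNIV" by blast+
  show "lie_algebroid (kernel_algebroid A F)"
    by (rule lie_algebroid_kernel[OF assms F surj])
  show "bundle_ses (vbun (kernel_algebroid A F)) (vbun A) (trivial_bundle (base (vbun A))) (\<lambda>p e. e) F"
    using bundle_ses_kernel[OF assms F surj] by simp
  show "action_up_to_homotopy br0 (kernel_algebroid A F)
      (\<lambda>y. anchor_vf A (\<lambda>p. \<sigma> p y)) (\<lambda>y. bracket A (\<lambda>p. \<sigma> p y))
      (\<lambda>y0 y1 p. bracket A (\<lambda>q. \<sigma> q y0) (\<lambda>q. \<sigma> q y1) p - \<sigma> p (br0 y0 y1))"
    if "bundle_splitting (vbun A) (trivial_bundle (base (vbun A))) F \<sigma>" for \<sigma>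
    by (rule splitting_action[OF assms F surj that])
qed

end
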